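(* Let $L^\sigma=\lim_{n\to\infty}W^\sigma_{-n}$ be the inductive limit of the twisted Weyl modules along the embeddings of $\mathfrak{osp}(1,2)[t]^\sigma$-modules $W^\sigma_{-n}\to W^\sigma_{-n-1}$, $w^\sigma_{-n}\mapsto g^+_{2n+1}w^\sigma_{-n-1}$, and let $\mathrm{ch}\,L^\sigma(x,q)=\lim_{n\to\infty}q^{n^2}\,\mathrm{ch}\,W^\sigma_{-n}(x,q^{-1})$. Then $$\mathrm{ch}\,L^\sigma(x,q)=\prod_{i=0}^\infty(1+q^{2i+1}x)\prod_{i=0}^\infty(1+q^{2i+1}x^{-1}).$$
   Context: Everything is over $\mathbb{C}$. $\mathfrak{osp}(1,2)$ is the Lie superalgebra with even part $\mathfrak{sl}_2$ (standard basis $e,h,f$) and odd part $\pi_1$ with basis $g^+,g^-$; the nontrivial brackets are $[e,f]=h$, $[h,e]=2e$, $[h,f]=-2f$, $[h,g^\pm]=\pm g^\pm$, $[g^+,g^-]_+=h$, $[g^+,g^+]_+=2e$, $[g^-,g^-]_+=-2f$, $[f,g^+]=-g^-$, $[e,g^-]=-g^+$. Write $y_i=y\otimes t^i$. The twisted current algebra is $\mathfrak{osp}(1,2)[t]^\sigma=\bigoplus_{i\ge0}\mathfrak{sl}_2\otimes t^{2i}\oplus\bigoplus_{i\ge0}\pi_1\otimes t^{2i+1}$. $W^\sigma_{-n}$ is the cyclic ($\mathfrak{sl}_2$-integrable) $\mathfrak{osp}(1,2)[t]^\sigma$-module with generator $w_{-n}^\sigma$ and defining relations $f_{2i}w^\sigma_{-n}=0$,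 $g^-_{2i+1}w^\sigma_{-n}=0$, $h_{2i+2}w^\sigma_{-n}=0$ ($i\ge0$), $h_0w^\sigma_{-n}=-nw^\sigma_{-n}$, $e_0^{n+1}w^\sigma_{-n}=0$; it is graded by $t$-degree with $\deg w^\sigma_{-n}=0$, and $\mathrm{ch}\,M(x,q)=\sum_sq^s\,\mathrm{tr}(x^h|_{M_s})$. The limit of characters is taken coefficientwise (coefficients of $x^aq^b$). *)

theory Defs
  imports
    "Jordan_Normal_Form.VS_Connect"
    "HOL-Algebra.AbelCoset"
    "HOL-Library.Poly_Mapping"
    "HOL-Computational_Algebra.Formal_Laurent_Series"
    "HOL-Analysis.Infinite_Products"
begin

datatype osp = osp_e | osp_h | osp_f | osp_gp | osp_gm

lemma UNIV_osp: "(UNIV :: osp set) = {osp_e, osp_h, osp_f, osp_gp, osp_gm}"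
  by (auto intro: osp.exhaust)

instance osp :: finite
  by standard (unfold UNIV_osp, simp)

primrec parity :: "osp \<Rightarrow> nat" where
  "parity osp_e = 0"
| "parity osp_h = 0"
| "parity osp_f = 0"
| "parity osp_gp = 1"
| "parity osp_gm = 1"

definition koszul :: "osp \<Rightarrow> osp \<Rightarrow> complex" where
  "koszul y z = (- 1) ^ (parity y * parity z)"

definition term_of :: "complex \<Rightarrow> osp \<Rightarrow> osp \<Rightarrow> complex" where
  "term_of c x = (\<lambda>u. if u = x then c else 0)"

text \<open>\<open>superbracket y z\<close> is the coordinate vector of the superbracket of two basis elements.\<close>

fun superbracket :: "osp \<Rightarrow> osp \<Rightarrow> osp \<Rightarrow> complex" where
  "superbracket osp_e osp_f = term_of 1 osp_h"
| "superbracket osp_f osp_e = term_of (- 1) osp_h"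
| "superbracket osp_h osp_e = term_of 2 osp_e"
| "superbracket osp_e osp_h = term_of (- 2) osp_e"
| "superbracket osp_h osp_f = term_of (- 2) osp_f"
| "superbracket osp_f osp_h = term_of 2 osp_f"
| "superbracket osp_h osp_gp = term_of 1 osp_gp"
| "superbracket osp_gp osp_h = term_of (- 1) osp_gp"
| "superbracket osp_h osp_gm = term_of (- 1) osp_gm"
| "superbracket osp_gm osp_h = term_of 1 osp_gm"
| "superbracket osp_gp osp_gm = term_of 1 osp_h"
| "superbracket osp_gm osp_gp = term_of 1 osp_h"
| "superbracket osp_gp osp_gp = term_of 2 osp_e"
| "superbracket osp_gm osp_gm = term_of (- 2) osp_f"
| "superbracket osp_f osp_gp = term_of (- 1) osp_gm"
| "superbracket osp_gp osp_f = term_of 1 osp_gm"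
| "superbracket osp_e osp_gm = term_of (- 1) osp_gp"
| "superbracket osp_gm osp_e = term_of 1 osp_gp"
| "superbracket _ _ = (\<lambda>_. 0)"

lemma superbracket_skew: "superbracket z y x = - koszul y z * superbracket y z x"
  by (cases y; cases z) (simp_all add: koszul_def term_of_def)

lemma superbracket_jacobi:
  "(\<Sum>u\<in>UNIV. superbracket b c u * superbracket a u x) =
   (\<Sum>u\<in>UNIV. superbracket a b u * superbracket u c x) +
   koszul a b * (\<Sum>u\<in>UNIV. superbracket a c u * superbracket b u x)"
  unfolding UNIV_osp
  by (cases a; cases b; cases c) (simp_all add: koszul_def term_of_def)

text \<open>The letter \<open>(y, i)\<close> stands for \<open>y_i\<close>, that is, \<open>y\<close> tensored with the \<open>i\<close>-th power of \<open>t\<close>; the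
  letters in \<open>twisted\<close> form a basis of the twisted current algebra.\<close>

type_synonym letter = "osp \<times> nat"

definition twisted :: "letter set" where
  "twisted = {(y, i). even i \<longleftrightarrow> parity y = 0}"

datatype osp_word = Word (letters: "letter list")

instantiation osp_word :: monoid_add
begin

definition zero_osp_word :: osp_word where "0 = Word []"

definition plus_osp_word :: "osp_word \<Rightarrow> osp_word \<Rightarrow> osp_word" where
  "v + w = Word (letters v @ letters w)"

instance
  by standard (simp_all add: zero_osp_word_def plus_osp_word_def)

end

text \<open>Addition of words is concatenation, so that the library's convolution product on
  finitely supported functions is the product of the free algebra.\<close>

type_synonym tensor = "osp_word \<Rightarrow>\<^sub>0 complex"

definition gen :: "letter \<Rightarrow> tensor" where
  "gen l = Poly_Mapping.single (Word [l]) 1"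

definition scal :: "complex \<Rightarrow> tensor" where
  "scal c = Poly_Mapping.single 0 c"

definition tensors :: "tensor set" where
  "tensors = {p. \<forall>w \<in> Poly_Mapping.keys p. set (letters w) \<subseteq> twisted}"

abbreviation tensor_ring :: "tensor ring" where
  "tensor_ring \<equiv> class_ring \<lparr>carrier := tensors\<rparr>"

definition t_degree :: "osp_word \<Rightarrow> int" where
  "t_degree w = (\<Sum>l\<leftarrow>letters w. int (snd l))"

definition bracket_rel :: "letter \<Rightarrow> letter \<Rightarrow> tensor" where
  "bracket_rel k l = gen k * gen l - scal (koszul (fst k) (fst l)) * gen l * gen k
     - (\<Sum>x\<in>UNIV. scal (superbracket (fst k) (fst l) x) * gen (x, snd k + snd l))"

inductive_set left_ideal :: "tensor set \<Rightarrow> tensor set" for S where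
  zero: "0 \<in> left_ideal S"
| add: "p \<in> left_ideal S \<Longrightarrow> q \<in> left_ideal S \<Longrightarrow> p + q \<in> left_ideal S"
| mult: "p \<in> tensors \<Longrightarrow> s \<in> S \<Longrightarrow> p * s \<in> left_ideal S"

text \<open>The left ideal generated by \<open>enveloping_rels\<close> is the two-sided ideal whose quotient is the
  universal enveloping algebra of the twisted current algebra.\<close>

definition enveloping_rels :: "tensor set" where
  "enveloping_rels = {bracket_rel k l * p | k l p. k \<in> twisted \<and> l \<in> twisted \<and> p \<in> tensors}"

text \<open>\<open>act\<close> is the action of the letters (only those in \<open>twisted\<close> matter); \<open>piece M s\<close> is the
  homogeneous component of degree \<open>s\<close>.\<close>

record 'v osp_module = "(complex, 'v) module" +
  act :: "letter \<Rightarrow> 'v \<Rightarrow> 'v"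
  piece :: "int \<Rightarrow> 'v set"

definition osp_embedding ::
  "'v osp_module \<Rightarrow> 'w osp_module \<Rightarrow> ('v \<Rightarrow> 'w) \<Rightarrow> bool" where
  "osp_embedding M N \<phi> \<longleftrightarrow>
     \<phi> \<in> LinearCombinations.module_hom class_ring M N \<and>
     (\<forall>l\<in>twisted. \<forall>v\<in>carrier M. \<phi> (act M l v) = act N l (\<phi> v)) \<and>
     inj_on \<phi> (carrier M)"

text \<open>The coefficient of \<open>x^a q^s\<close> in the character: the operator \<open>x^h\<close> is multiplication by
  \<open>x^a\<close> on the \<open>a\<close>-eigenspace of \<open>h_0\<close>, so \<open>x^a\<close> occurs in its trace on the component of
  degree \<open>s\<close> with the dimension of that eigenspace as coefficient.\<close>

definition weight_space :: "'v osp_module \<Rightarrow> int \<Rightarrow> int \<Rightarrow> 'v set" where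
  "weight_space M a s = {v \<in> piece M s. act M (osp_h, 0) v = of_int a \<odot>\<^bsub>M\<^esub> v}"

definition ch :: "'v osp_module \<Rightarrow> int \<Rightarrow> int \<Rightarrow> nat" where
  "ch M a s = vectorspace.dim class_ring (M \<lparr>carrier := weight_space M a s\<rparr>)"

definition weyl_rels :: "nat \<Rightarrow> tensor set" where
  "weyl_rels n =
     (\<Union>i. {gen (osp_f, 2 * i), gen (osp_gm, 2 * i + 1), gen (osp_h, 2 * i + 2)}) \<union>
     {gen (osp_h, 0) + scal (of_nat n), gen (osp_e, 0) ^ (n + 1)}"

definition weyl_ideal :: "nat \<Rightarrow> tensor set" where
  "weyl_ideal n = left_ideal (enveloping_rels \<union> weyl_rels n)"

abbreviation weyl_class :: "nat \<Rightarrow> tensor \<Rightarrow> tensor set" where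
  "weyl_class n p \<equiv> weyl_ideal n +>\<^bsub>tensor_ring\<^esub> p"

text \<open>\<open>weyl n\<close> is the module with index \<open>-n\<close>, realised as the quotient of the free algebra by
  the left ideal of all relations. The fields \<open>mult\<close> and \<open>one\<close> of a module record are irrelevant.\<close>

definition weyl :: "nat \<Rightarrow> tensor set osp_module" where
  "weyl n = \<lparr>
     carrier = a_rcosets\<^bsub>tensor_ring\<^esub> (weyl_ideal n),
     monoid.mult = undefined,
     one = undefined,
     zero = weyl_ideal n,
     add = (\<lambda>X Y. X <+>\<^bsub>tensor_ring\<^esub> Y),
     module.smult = (\<lambda>c X. \<Union>p\<in>X. weyl_class n (scal c * p)),
     act = (\<lambda>l X. \<Union>p\<in>X. weyl_class n (gen l * p)),
     piece = (\<lambda>s. {weyl_class n p | p.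
                p \<in> tensors \<and> (\<forall>w \<in> Poly_Mapping.keys p. t_degree w = s)})\<rparr>"

definition weyl_gen :: "nat \<Rightarrow> tensor set" where
  "weyl_gen n = weyl_class n 1"

text \<open>A homomorphism out of the cyclic module \<open>weyl n\<close> sends the class of \<open>p\<close> to \<open>p\<close> applied to
  the image of the generator; here that image is the class of \<open>g^+_{2n+1}\<close>. The map is odd for
  the parity grading but commutes with the action without signs.\<close>

definition weyl_emb :: "nat \<Rightarrow> tensor set \<Rightarrow> tensor set" where
  "weyl_emb n X = (\<Union>p\<in>X. weyl_class (Suc n) (p * gen (osp_gp, 2 * n + 1)))"

definition trans_map :: "(nat \<Rightarrow> 'v \<Rightarrow> 'v) \<Rightarrow> nat \<Rightarrow> nat \<Rightarrow> 'v \<Rightarrow> 'v" where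
  "trans_map \<phi> n k v = fold \<phi> [n..<k] v"

definition lim_rel ::
  "(nat \<Rightarrow> 'v osp_module) \<Rightarrow> (nat \<Rightarrow> 'v \<Rightarrow> 'v) \<Rightarrow> ((nat \<times> 'v) \<times> (nat \<times> 'v)) set" where
  "lim_rel M \<phi> = {((n, v), (m, u)). v \<in> carrier (M n) \<and> u \<in> carrier (M m) \<and>
     (\<exists>k. n \<le> k \<and> m \<le> k \<and> trans_map \<phi> n k v = trans_map \<phi> m k u)}"

definition lim_class ::
  "(nat \<Rightarrow> 'v osp_module) \<Rightarrow> (nat \<Rightarrow> 'v \<Rightarrow> 'v) \<Rightarrow> nat \<Rightarrow> 'v \<Rightarrow> (nat \<times> 'v) set" where
  "lim_class M \<phi> n v = lim_rel M \<phi> `` {(n, v)}"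

text \<open>Two elements of the limit are added by choosing representatives at a common stage.\<close>

definition inductive_limit ::
  "(nat \<Rightarrow> 'v osp_module) \<Rightarrow> (nat \<Rightarrow> 'v \<Rightarrow> 'v) \<Rightarrow> (nat \<times> 'v) set osp_module" where
  "inductive_limit M \<phi> = \<lparr>
     carrier = {lim_class M \<phi> n v | n v. v \<in> carrier (M n)},
     monoid.mult = undefined,
     one = undefined,
     zero = lim_class M \<phi> 0 \<zero>\<^bsub>M 0\<^esub>,
     add = (\<lambda>X Y. \<Union>{lim_class M \<phi> n (v \<oplus>\<^bsub>M n\<^esub> u) | n v u. (n, v) \<in> X \<and> (n, u) \<in> Y}),
     module.smult = (\<lambda>c X. \<Union>{lim_class M \<phi> n (c \<odot>\<^bsub>M n\<^esub> v) | n v. (n, v) \<in> X}),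
     act = (\<lambda>l X. \<Union>{lim_class M \<phi> n (act (M n) l v) | n v. (n, v) \<in> X}),
     piece = (\<lambda>b. {lim_class M \<phi> n v | n v. v \<in> piece (M n) b})\<rparr>"

text \<open>The embedding \<open>weyl_emb n\<close> raises the t-degree by \<open>2n+1 = (n+1)^2 - n^2\<close>. Placing
  t-degree \<open>s\<close> of \<open>weyl n\<close> in degree \<open>n^2 - s\<close> therefore makes all embeddings degree-preserving and
  turns the character \<open>ch W(x,q)\<close> into \<open>q^(n^2) ch W(x,1/q)\<close>.\<close>

definition regraded_weyl :: "nat \<Rightarrow> tensor set osp_module" where
  "regraded_weyl n = (weyl n) \<lparr>piece := \<lambda>b. piece (weyl n) (int (n\<^sup>2) - b)\<rparr>"

definition L_sigma :: "(nat \<times> tensor set) set osp_module" where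
  "L_sigma = inductive_limit regraded_weyl weyl_emb"

text \<open>Formal power series in \<open>q\<close> whose coefficients are formal Laurent series in \<open>x\<close>; the
  infinite products converge in the \<open>q\<close>-adic topology.\<close>

definition product_side :: "int fls fps" where
  "product_side =
     prodinf (\<lambda>i. 1 + fps_X ^ (2 * i + 1) * fps_const fls_X) *
     prodinf (\<lambda>i. 1 + fps_X ^ (2 * i + 1) * fps_const fls_X_inv)"

text \<open>The coefficient of \<open>x^a q^b\<close>, which is zero for negative \<open>b\<close>.\<close>

definition product_coeff :: "int \<Rightarrow> int \<Rightarrow> int" where
  "product_coeff a b = fls_nth (fls_nth (fps_to_fls product_side) b) a"

end

theory Submission
  imports Defs "HOL-Library.Function_Algebras"
begin

text \<open>The module \<open>W_{-n}\<close> is filtered by the number of odd letters. The subquotients are cyclic over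
  the current algebra of \<open>sl_2\<close> in \<open>t\<^sup>2\<close>, generated by products of distinct \<open>g^+_{2j+1}\<close>; on the line
  through \<open>e_0\<^sup>a\<close> the elements \<open>h_{2i}/2\<close> act as power sums in \<open>a\<close> variables, and the relation
  \<open>e_0^{N+1} = 0\<close> kills high complete symmetric functions, so that products of elementary symmetric
  functions indexed by partitions in a box span. The resulting \<open>3\<^sup>n\<close> vectors are independent: in the
  tensor product of \<open>n\<close> three-dimensional evaluation modules at points with distinct squares, which is
  cyclic, the relations of \<open>W_{-n}\<close> hold up to terms of lower t-degree.

  The embedding multiplies by \<open>g^+_{2n+1}\<close>, hence maps basis vectors to basis vectors as soon as they are
  indexed by the set \<open>S\<close> of odd letters that do \<^emph>\<open>not\<close> occur. The limit therefore has a basis indexed by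
  triples (finite set \<open>S\<close>, exponent \<open>a\<close>, partition in an \<open>a\<close> by \<open>|S| - a\<close> box). With \<open>G_k\<close> the generating
  function of \<open>k\<close>-element sets of odd numbers, the Pascal rule shows that the triples with
  \<open>|S| = a + b\<close> are counted by \<open>G_a G_b\<close>, which is a coefficient in \<open>x\<close> of the infinite product.\<close>

text \<open>Inside the stratum with \<open>c\<close> odd letters a second filtration is needed, by
  the sum of their indices: \<open>h_{2i}\<close> with \<open>i > 0\<close> raises this sum and
  \<open>f_{2i}\<close> loses odd letters. Modulo both, a sorted product is a lowest weight vector
  of weight \<open>-(n - c)\<close>, to which the theory of the \<open>sl_2\<close> Weyl module with
  its \<open>2^(n - c)\<close> vectors applies. Summing \<open>2^|S|\<close> over the subsets of
  \<open>n\<close> letters gives \<open>3^n\<close>.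

  The obstacle to independence is that \<open>h_{2i}\<close> acts on the vacuum of the tensor
  product by a nonzero scalar, so the generator of the Weyl module cannot be sent there; only the
  graded object attached to the degree filtration compares. Hence each vector is represented by its
  top degree part. The degree is visible on words only, so the basis is lifted from the enveloping
  algebra to the free algebra. As the \<open>3^n\<close> leading parts span a space of dimension
  \<open>3^n\<close>, they are independent, and so are the vectors.

  Even letters see a point only through its square, and odd letters carry one extra factor, which is
  invertible because the points are nonzero; interpolation then isolates each tensor factor, which
  gives cyclicity.\<close>

lemma poly_mapping_eq_sum_single:
  "p = (\<Sum>w\<in>Poly_Mapping.keys p. Poly_Mapping.single w (Poly_Mapping.lookup p w))"
  by (rule poly_mapping_eqI)
    (auto simp: lookup_sum lookup_single when_def in_keys_iff sum.delta)

lemma letters_plus [simp]: "letters (v + w) = letters v @ letters w"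
  by (simp add: plus_osp_word_def)

lemma letters_zero [simp]: "letters 0 = []"
  by (simp add: zero_osp_word_def)

lemma word_eq_zero_iff: "w = 0 \<longleftrightarrow> letters w = []"
  by (cases w) (simp add: zero_osp_word_def)

lemma tensor_induct [case_names zero single add]:
  fixes p :: tensor
  assumes "P 0" "\<And>w c. P (Poly_Mapping.single w c)" "\<And>p q. P p \<Longrightarrow> P q \<Longrightarrow> P (p + q)"
  shows "P p"
proof -
  have "P (\<Sum>w\<in>A. Poly_Mapping.single w (Poly_Mapping.lookup p w))" if "finite A" for A
    using that by induction (auto intro: assms)
  then show ?thesis
    using poly_mapping_eq_sum_single[of p] finite_keys[of p] by metis
qed

lemma tensors_induct [consumes 1, case_names zero single add]:
  assumes "p \<in> tensors" "P 0"
    "\<And>w c. set (letters w) \<subseteq> twisted \<Longrightarrow> P (Poly_Mapping.single w c)"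
    "\<And>p q. p \<in> tensors \<Longrightarrow> q \<in> tensors \<Longrightarrow> P p \<Longrightarrow> P q \<Longrightarrow> P (p + q)"
  shows "P p"
proof -
  have "P (\<Sum>w\<in>A. Poly_Mapping.single w (Poly_Mapping.lookup p w)) \<and>
      (\<Sum>w\<in>A. Poly_Mapping.single w (Poly_Mapping.lookup p w)) \<in> tensors"
    if "finite A" "A \<subseteq> Poly_Mapping.keys p" for A
    using that
  proof induction
    case empty
    then show ?case using assms(2) by (simp add: tensors_def)
  next
    case (insert w A)
    have w: "set (letters w) \<subseteq> twisted"
      using insert.prems assms(1) by (auto simp: tensors_def)
    have s: "Poly_Mapping.single w (Poly_Mapping.lookup p w) \<in> tensors"
      using w by (auto simp: tensors_def)
    have t: "Poly_Mapping.single w (Poly_Mapping.lookup p w) + q \<in> tensors" if "q \<in> tensors" for q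
      using that s keys_add by (fastforce simp: tensors_def)
    show ?case using insert w s t by (auto intro!: assms)
  qed
  then show ?thesis
    using poly_mapping_eq_sum_single[of p] finite_keys[of p] by (metis order_refl)
qed

lemma tensors_0 [simp]: "0 \<in> tensors" and tensors_1 [simp]: "1 \<in> tensors"
  and tensors_scal [simp]: "scal c \<in> tensors"
  and tensors_single: "set (letters w) \<subseteq> twisted \<Longrightarrow> Poly_Mapping.single w c \<in> tensors"
  and tensors_gen [simp]: "l \<in> twisted \<Longrightarrow> gen l \<in> tensors"
  by (auto simp: tensors_def scal_def gen_def)

lemma tensors_add [simp]: "p \<in> tensors \<Longrightarrow> q \<in> tensors \<Longrightarrow> p + q \<in> tensors"
  using keys_add[of p q] by (fastforce simp: tensors_def)

lemma tensors_uminus [simp]: "p \<in> tensors \<Longrightarrow> - p \<in> tensors"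
  by (auto simp: tensors_def in_keys_iff)

lemma tensors_diff [simp]: "p \<in> tensors \<Longrightarrow> q \<in> tensors \<Longrightarrow> p - q \<in> tensors"
  using tensors_add[of p "- q"] by simp

lemma tensors_mult [simp]: "p \<in> tensors \<Longrightarrow> q \<in> tensors \<Longrightarrow> p * q \<in> tensors"
  using keys_mult[of p q] by (fastforce simp: tensors_def)

lemma tensors_sum [simp]: "(\<And>i. i \<in> A \<Longrightarrow> f i \<in> tensors) \<Longrightarrow> sum f A \<in> tensors"
  by (induction A rule: infinite_finite_induct) auto

lemma tensors_power [simp]: "p \<in> tensors \<Longrightarrow> p ^ n \<in> tensors"
  by (induction n) auto

lemma tensors_prod_list [simp]: "(\<And>x. x \<in> set xs \<Longrightarrow> x \<in> tensors) \<Longrightarrow> prod_list xs \<in> tensors"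
  by (induction xs) auto

lemma scal_mult_commute: "scal c * p = p * scal c"
  by (induction p rule: tensor_induct) (simp_all add: scal_def mult_single algebra_simps)

lemma scal_simps [simp]: "scal 0 = 0" "scal 1 = 1"
  by (simp_all add: scal_def)

lemma scal_add: "scal (c + d) = scal c + scal d" and scal_mult: "scal (c * d) = scal c * scal d"
  and scal_minus: "scal (- c) = - scal c"
  by (simp_all add: scal_def single_add mult_single single_uminus)

section \<open>Left ideals of the free algebra and the enveloping algebra\<close>

lemma superbracket_twisted:
  assumes "(a, i) \<in> twisted" "(b, j) \<in> twisted" "superbracket a b x \<noteq> 0"
  shows "(x, i + j) \<in> twisted"
  using assms by (cases a; cases b; cases x) (auto simp: twisted_def term_of_def)

lemma bracket_rel_tensors:
  assumes "k \<in> twisted" "l \<in> twisted"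
  shows "bracket_rel k l \<in> tensors"
proof -
  have "scal (superbracket (fst k) (fst l) x) * gen (x, snd k + snd l) \<in> tensors" for x
    using superbracket_twisted[of "fst k" "snd k" "fst l" "snd l" x] assms
    by (cases "superbracket (fst k) (fst l) x = 0") auto
  then show ?thesis using assms unfolding bracket_rel_def by auto
qed

lemma left_ideal_tensors: "S \<subseteq> tensors \<Longrightarrow> x \<in> left_ideal S \<Longrightarrow> x \<in> tensors"
  by (rotate_tac 1, induction rule: left_ideal.induct) auto

lemma left_ideal_mult:
  assumes "x \<in> left_ideal S" "q \<in> tensors"
  shows "q * x \<in> left_ideal S"
  using assms
proof induction
  case (mult p s)
  then show ?case using left_ideal.mult[of "q * p" s S] by (simp add: mult.assoc)
qed (auto intro: left_ideal.intros simp: distrib_left)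

lemma left_ideal_uminus: "x \<in> left_ideal S \<Longrightarrow> - x \<in> left_ideal S"
  using left_ideal_mult[of x S "- 1"] by simp

lemma left_ideal_diff: "x \<in> left_ideal S \<Longrightarrow> y \<in> left_ideal S \<Longrightarrow> x - y \<in> left_ideal S"
  using left_ideal.add[of x S "- y"] left_ideal_uminus by fastforce

lemma left_ideal_gen: "s \<in> S \<Longrightarrow> s \<in> left_ideal S"
  using left_ideal.mult[of 1 s S] by simp

lemma left_ideal_mono: "x \<in> left_ideal S \<Longrightarrow> S \<subseteq> T \<Longrightarrow> x \<in> left_ideal T"
  by (induction rule: left_ideal.induct) (auto intro: left_ideal.intros)

lemma enveloping_rels_tensors: "enveloping_rels \<subseteq> tensors"
  by (auto simp: enveloping_rels_def bracket_rel_tensors)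

text \<open>The right factor carried by each element of \<open>enveloping_rels\<close> absorbs
  \<open>q\<close>, so this left ideal is two-sided. That makes the product of \<open>uea\<close>
  well defined.\<close>

lemma enveloping_ideal_mult_right:
  assumes "x \<in> left_ideal enveloping_rels" "q \<in> tensors"
  shows "x * q \<in> left_ideal enveloping_rels"
  using assms
proof induction
  case (mult p s)
  then obtain k l r where s: "s = bracket_rel k l * r" "k \<in> twisted" "l \<in> twisted" "r \<in> tensors"
    by (auto simp: enveloping_rels_def)
  then have "s * q = bracket_rel k l * (r * q)" "r * q \<in> tensors"
    using mult.prems by (simp_all add: mult.assoc)
  then have "s * q \<in> enveloping_rels"
    using s unfolding enveloping_rels_def by blast
  then show ?case using left_ideal.mult[of p "s * q"] mult by (simp add: mult.assoc)
qed (auto intro: left_ideal.intros simp: distrib_right)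

text \<open>A concatenation is empty only if both words are, so the coefficient of the empty word is
  multiplicative: it is the augmentation.\<close>

lemma lookup_mult_zero:
  fixes p q :: tensor
  shows "Poly_Mapping.lookup (p * q) 0 = Poly_Mapping.lookup p 0 * Poly_Mapping.lookup q 0"
proof (induction p rule: tensor_induct)
  case (single v c)
  show ?case
    by (induction q rule: tensor_induct)
      (auto simp: mult_single lookup_single when_def word_eq_zero_iff distrib_left lookup_add)
qed (auto simp: distrib_right lookup_add)

text \<open>Every term of a bracket relation contains a letter, so the augmentation vanishes on the
  ideal. The class \<open>ring_1\<close> requires this for its axiom that 0 and 1 differ.\<close>

lemma one_notin_enveloping_ideal: "1 \<notin> left_ideal enveloping_rels"
proof -
  have g: "Poly_Mapping.lookup (gen l) 0 = 0" for l
    by (simp add: gen_def lookup_single zero_osp_word_def)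
  have "Poly_Mapping.lookup x 0 = 0" if "x \<in> left_ideal enveloping_rels" for x
    using that
    by induction (auto simp: lookup_add lookup_mult_zero enveloping_rels_def bracket_rel_def
        lookup_minus lookup_sum g)
  then show ?thesis using lookup_one_zero by (metis zero_neq_one)
qed

\<comment> \<open>The equivalence is partial because the letter type also contains letters outside
  \<open>twisted\<close>; \<open>tensors\<close> is the free algebra on the twisted ones.\<close>
quotient_type uea = tensor / partial:
  "\<lambda>p q. p \<in> tensors \<and> q \<in> tensors \<and> p - q \<in> left_ideal enveloping_rels"
proof (rule part_equivpI)
  show "\<exists>x. x \<in> tensors \<and> x \<in> tensors \<and> x - x \<in> left_ideal enveloping_rels"
    by (auto intro: left_ideal.zero exI[of _ 0])
  show "symp (\<lambda>p q. p \<in> tensors \<and> q \<in> tensors \<and> p - q \<in> left_ideal enveloping_rels)"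
    by (rule sympI) (metis left_ideal_uminus minus_diff_eq)
  show "transp (\<lambda>p q. p \<in> tensors \<and> q \<in> tensors \<and> p - q \<in> left_ideal enveloping_rels)"
    by (rule transpI) (metis left_ideal.add diff_add_cancel add_diff_eq)
qed

instantiation uea :: ring_1
begin

lift_definition zero_uea :: uea is 0 by (auto intro: left_ideal.zero)
lift_definition one_uea :: uea is 1 by (auto intro: left_ideal.zero)
lift_definition plus_uea :: "uea \<Rightarrow> uea \<Rightarrow> uea" is "(+)"
  by (auto simp: add_diff_add intro: left_ideal.add)
lift_definition minus_uea :: "uea \<Rightarrow> uea \<Rightarrow> uea" is "(-)"
proof -
  fix p q r s :: tensor
  assume *: "p \<in> tensors \<and> q \<in> tensors \<and> p - q \<in> left_ideal enveloping_rels"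
    "r \<in> tensors \<and> s \<in> tensors \<and> r - s \<in> left_ideal enveloping_rels"
  have "p - r - (q - s) = (p - q) - (r - s)" by (simp add: algebra_simps)
  with * show "p - r \<in> tensors \<and> q - s \<in> tensors \<and> p - r - (q - s) \<in> left_ideal enveloping_rels"
    by (simp only: tensors_diff left_ideal_diff simp_thms)
qed
lift_definition uminus_uea :: "uea \<Rightarrow> uea" is uminus
  using left_ideal_uminus by fastforce
lift_definition times_uea :: "uea \<Rightarrow> uea \<Rightarrow> uea" is "(*)"
proof -
  fix p q r s :: tensor
  assume *: "p \<in> tensors \<and> q \<in> tensors \<and> p - q \<in> left_ideal enveloping_rels"
    "r \<in> tensors \<and> s \<in> tensors \<and> r - s \<in> left_ideal enveloping_rels"
  have "p * r - q * s = (p - q) * r + q * (r - s)" by (simp add: algebra_simps)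
  with * show "p * r \<in> tensors \<and> q * s \<in> tensors \<and> p * r - q * s \<in> left_ideal enveloping_rels"
    by (simp add: left_ideal.add left_ideal_mult enveloping_ideal_mult_right)
qed

instance
proof
  show "(0::uea) \<noteq> 1"
    by transfer (use one_notin_enveloping_ideal left_ideal_uminus in fastforce)
qed (transfer; auto simp: algebra_simps intro: left_ideal.zero)+

end

text \<open>The default 0 outside \<open>tensors\<close> makes the map total; the rules for sums and
  products therefore assume membership in \<open>tensors\<close>.\<close>

lift_definition cls :: "tensor \<Rightarrow> uea" is "\<lambda>p. if p \<in> tensors then p else 0"
  by (auto intro: left_ideal.zero)

lemma cls_0 [simp]: "cls 0 = 0" and cls_1 [simp]: "cls 1 = 1"
  by (transfer; simp add: left_ideal.zero)+

lemma cls_add: "p \<in> tensors \<Longrightarrow> q \<in> tensors \<Longrightarrow> cls (p + q) = cls p + cls q"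
  and cls_mult: "p \<in> tensors \<Longrightarrow> q \<in> tensors \<Longrightarrow> cls (p * q) = cls p * cls q"
  and cls_diff: "p \<in> tensors \<Longrightarrow> q \<in> tensors \<Longrightarrow> cls (p - q) = cls p - cls q"
  by (transfer; simp add: left_ideal.zero)+

lemma cls_eq_iff: "p \<in> tensors \<Longrightarrow> q \<in> tensors \<Longrightarrow> cls p = cls q \<longleftrightarrow> p - q \<in> left_ideal enveloping_rels"
  by transfer simp

lemma cls_cases: obtains p where "p \<in> tensors" "u = cls p"
proof -
  have "\<exists>p\<in>tensors. u = cls p"
    by (induction u rule: uea.abs_induct) (auto simp: cls_def)
  then show ?thesis using that by blast
qed

lemma cls_sum: "(\<And>i. i \<in> A \<Longrightarrow> f i \<in> tensors) \<Longrightarrow> cls (sum f A) = (\<Sum>i\<in>A. cls (f i))"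
  by (induction A rule: infinite_finite_induct) (auto simp: cls_add)

lemma cls_prod_list: "(\<And>x. x \<in> set xs \<Longrightarrow> x \<in> tensors) \<Longrightarrow> cls (prod_list xs) = prod_list (map cls xs)"
  by (induction xs) (auto simp: cls_mult)

lemma cls_power: "p \<in> tensors \<Longrightarrow> cls (p ^ n) = cls p ^ n"
  by (induction n) (auto simp: cls_mult)

section \<open>Scalars, letters and commutation rules in the enveloping algebra\<close>

definition sc :: "complex \<Rightarrow> uea" where "sc c = cls (scal c)"

lemma sc_0 [simp]: "sc 0 = 0" and sc_1 [simp]: "sc 1 = 1"
  by (simp_all add: sc_def)

lemma sc_add: "sc (c + d) = sc c + sc d" and sc_mult: "sc (c * d) = sc c * sc d"
  by (simp_all add: sc_def scal_add scal_mult cls_add cls_mult)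

lemma sc_minus: "sc (- c) = - sc c"
  by (metis add.right_inverse sc_0 sc_add add_eq_0_iff)

lemma sc_diff: "sc (c - d) = sc c - sc d"
  using sc_add[of c "- d"] by (simp add: sc_minus)

lemma sc_commute: "x * sc c = sc c * x"
  by (metis cls_cases cls_mult sc_def scal_mult_commute tensors_scal)

lemma sc_of_nat: "sc (of_nat k) = of_nat k"
  by (induction k) (simp_all add: sc_add)

lemma sc_numeral [simp]: "sc (numeral k) = numeral k"
  by (metis of_nat_numeral sc_of_nat)

interpretation uea: vector_space "\<lambda>c x. sc c * x"
  by unfold_locales (simp_all add: sc_add sc_mult algebra_simps)

definition lt :: "letter \<Rightarrow> uea" where "lt l = cls (gen l)"

lemma lt_bracket:
  assumes "k \<in> twisted" "l \<in> twisted"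
  shows "lt k * lt l = sc (koszul (fst k) (fst l)) * lt l * lt k +
    (\<Sum>x\<in>UNIV. sc (superbracket (fst k) (fst l) x) * lt (x, snd k + snd l))"
proof -
  let ?t = "\<lambda>x. scal (superbracket (fst k) (fst l) x) * gen (x, snd k + snd l)"
  have t: "?t x \<in> tensors" for x
    using superbracket_twisted[of "fst k" "snd k" "fst l" "snd l" x] assms
    by (cases "superbracket (fst k) (fst l) x = 0") auto
  have c: "cls (?t x) = sc (superbracket (fst k) (fst l) x) * lt (x, snd k + snd l)" for x
    using superbracket_twisted[of "fst k" "snd k" "fst l" "snd l" x] assms
    by (cases "superbracket (fst k) (fst l) x = 0") (auto simp: cls_mult sc_def lt_def)
  have "bracket_rel k l \<in> left_ideal enveloping_rels"
    using assms tensors_1 unfolding enveloping_rels_def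
    by (intro left_ideal_gen) (metis (mono_tags, lifting) mem_Collect_eq mult_1_right)
  then have "cls (bracket_rel k l) = 0"
    using cls_eq_iff[of "bracket_rel k l" 0] bracket_rel_tensors assms by simp
  then show ?thesis
    using assms t
    by (simp add: bracket_rel_def cls_diff cls_mult cls_sum c)
      (simp add: sc_def lt_def cls_mult algebra_simps)
qed

definition ee :: "nat \<Rightarrow> uea" where "ee i = lt (osp_e, 2 * i)"
definition hh :: "nat \<Rightarrow> uea" where "hh i = lt (osp_h, 2 * i)"
definition ff :: "nat \<Rightarrow> uea" where "ff i = lt (osp_f, 2 * i)"
definition gp :: "nat \<Rightarrow> uea" where "gp i = lt (osp_gp, 2 * i + 1)"
definition gm :: "nat \<Rightarrow> uea" where "gm i = lt (osp_gm, 2 * i + 1)"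

lemmas letter_defs = ee_def hh_def ff_def gp_def gm_def

lemma twisted_cases:
  assumes "l \<in> twisted"
  obtains i where "lt l = ee i" | i where "lt l = hh i" | i where "lt l = ff i"
  | i where "lt l = gp i" | i where "lt l = gm i"
proof (cases l)
  case (Pair y j)
  have "2 * (j div 2) = j \<or> 2 * (j div 2) + 1 = j"
    by presburger
  then show ?thesis
    using assms that[of "j div 2"] unfolding Pair letter_defs
    by (cases y) (auto simp: twisted_def)
qed

text \<open>Two odd degrees add up to \<open>2 * (i + j + 1)\<close>, hence the shift by 1 in the
  brackets of two odd letters; in all other brackets the indices simply add.\<close>

lemma bracket_eqs:
  "ee i * ee j = ee j * ee i"
  "ff i * ff j = ff j * ff i"
  "hh i * hh j = hh j * hh i"
  "ff i * ee j = ee j * ff i - hh (i + j)"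
  "hh i * ee j = ee j * hh i + 2 * ee (i + j)"
  "hh i * ff j = ff j * hh i - 2 * ff (i + j)"
  "hh i * gp j = gp j * hh i + gp (i + j)"
  "hh i * gm j = gm j * hh i - gm (i + j)"
  "gm i * gp j = hh (i + j + 1) - gp j * gm i"
  "gp i * gp j = 2 * ee (i + j + 1) - gp j * gp i"
  "gm i * gm j = - 2 * ff (i + j + 1) - gm j * gm i"
  "ff i * gp j = gp j * ff i - gm (i + j)"
  "ff i * gm j = gm j * ff i"
  "ee i * gm j = gm j * ee i - gp (i + j)"
  "ee i * gp j = gp j * ee i"
proof -
  have mem: "(osp_e, 2 * i) \<in> twisted" "(osp_h, 2 * i) \<in> twisted" "(osp_f, 2 * i) \<in> twisted"
    "(osp_gp, 2 * i + 1) \<in> twisted" "(osp_gm, 2 * i + 1) \<in> twisted" for i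
    by (auto simp: twisted_def)
  note br = mem[THEN lt_bracket, OF mem(1)] mem[THEN lt_bracket, OF mem(2)]
    mem[THEN lt_bracket, OF mem(3)] mem[THEN lt_bracket, OF mem(4)] mem[THEN lt_bracket, OF mem(5)]
  note [simp] = UNIV_osp koszul_def term_of_def sc_minus
  show "ee i * ee j = ee j * ee i"
    unfolding letter_defs by (subst br) (simp add: algebra_simps)
  show "ff i * ff j = ff j * ff i"
    unfolding letter_defs by (subst br) (simp add: algebra_simps)
  show "hh i * hh j = hh j * hh i"
    unfolding letter_defs by (subst br) (simp add: algebra_simps)
  show "ff i * ee j = ee j * ff i - hh (i + j)"
    unfolding letter_defs by (subst br) (simp add: algebra_simps)
  show "hh i * ee j = ee j * hh i + 2 * ee (i + j)"
    unfolding letter_defs by (subst br) (simp add: algebra_simps)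
  show "hh i * ff j = ff j * hh i - 2 * ff (i + j)"
    unfolding letter_defs by (subst br) (simp add: algebra_simps)
  show "hh i * gp j = gp j * hh i + gp (i + j)"
    unfolding letter_defs by (subst br) (simp add: algebra_simps)
  show "hh i * gm j = gm j * hh i - gm (i + j)"
    unfolding letter_defs by (subst br) (simp add: algebra_simps)
  show "gm i * gp j = hh (i + j + 1) - gp j * gm i"
    unfolding letter_defs by (subst br) (simp add: algebra_simps)
  show "gp i * gp j = 2 * ee (i + j + 1) - gp j * gp i"
    unfolding letter_defs by (subst br) (simp add: algebra_simps)
  show "gm i * gm j = - 2 * ff (i + j + 1) - gm j * gm i"
    unfolding letter_defs by (subst br) (simp add: algebra_simps)
  show "ff i * gp j = gp j * ff i - gm (i + j)"
    unfolding letter_defs by (subst br) (simp add: algebra_simps)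
  show "ff i * gm j = gm j * ff i"
    unfolding letter_defs by (subst br) (simp add: algebra_simps)
  show "ee i * gm j = gm j * ee i - gp (i + j)"
    unfolding letter_defs by (subst br) (simp add: algebra_simps)
  show "ee i * gp j = gp j * ee i"
    unfolding letter_defs by (subst br) (simp add: algebra_simps)
qed

text \<open>The factor 1/2 absorbs the 2 of \<open>[h, e] = 2 e\<close>, so that the commutator with
  \<open>pp i\<close> shifts the index of \<open>ee j\<close> by \<open>i\<close> with coefficient
  1.\<close>

definition pp :: "nat \<Rightarrow> uea" where "pp k = sc (1 / 2) * hh k"

lemma half_two: "sc (1 / 2) * (2 * x) = x" "2 * (sc (1/2) * x) = x" "2 * sc (1/2) = 1"
proof -
  have *: "sc (1 / 2) * 2 = 1" "2 * sc (1/2) = 1"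
    using sc_mult[of "1/2" 2] sc_mult[of 2 "1/2"] by simp_all
  then show "sc (1 / 2) * (2 * x) = x" "2 * (sc (1/2) * x) = x" "2 * sc (1/2) = 1"
    by (simp_all flip: mult.assoc)
qed

lemma hh_pp: "hh k = 2 * pp k"
  by (simp add: pp_def half_two)

lemma sc_left_commute: "x * (sc c * y) = sc c * (x * y)"
  by (metis mult.assoc sc_commute)

lemma pp_commute: "pp i * pp j = pp j * pp i"
proof -
  have "pp i * pp j = sc (1 / 2) * (sc (1 / 2) * (hh i * hh j))" for i j
    unfolding pp_def mult.assoc by (subst sc_left_commute[of "hh i"]) (rule refl)
  then show ?thesis by (simp only: bracket_eqs(3)[of i j])
qed

lemma pp_ee: "pp i * ee j = ee j * pp i + ee (i + j)"
  unfolding pp_def mult.assoc bracket_eqs(5) distrib_left half_two sc_left_commute[of "ee j"] ..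

lemma ff_pp: "ff j * pp i = pp i * ff j + ff (i + j)"
proof -
  have "sc (1 / 2) * (hh i * ff j) = sc (1 / 2) * (ff j * hh i) - ff (i + j)"
    by (simp only: bracket_eqs(6)[of i j] right_diff_distrib half_two)
  then show ?thesis
    unfolding pp_def mult.assoc sc_left_commute[of "ff j"] by (simp add: algebra_simps)
qed

lemma ff_ee: "ff i * ee j = ee j * ff i - 2 * pp (i + j)"
  by (simp only: bracket_eqs(4) hh_pp)

lemma hh_0_pp: "hh 0 * pp i = pp i * hh 0"
  unfolding pp_def mult.assoc sc_left_commute[of "hh 0"] bracket_eqs(3)[of 0 i] ..

subsection \<open>Symmetric functions of the Cartan currents\<close>

text \<open>\<open>pp k\<close> plays the role of a power sum: it acts as \<open>x\<^sub>1\<^sup>k + \<dots> + x\<^sub>a\<^sup>k\<close> on products of \<open>a\<close>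
  letters \<open>ee i\<close>, read as monomials \<open>x\<^sup>i\<close>. Newton's identities then define the operators of the
  complete (\<open>hs\<close>) and elementary (\<open>es\<close>) symmetric functions.\<close>

fun hs :: "nat \<Rightarrow> uea" where
  "hs 0 = 1"
| "hs (Suc s) = sc (1 / of_nat (Suc s)) * (\<Sum>k\<le>s. pp (Suc k) * hs (s - k))"

fun es :: "nat \<Rightarrow> uea" where
  "es 0 = 1"
| "es (Suc s) = sc (1 / of_nat (Suc s)) * (\<Sum>k\<le>s. sc ((- 1) ^ k) * pp (Suc k) * es (s - k))"

declare hs.simps(2) [simp del] es.simps(2) [simp del]

lemma of_nat_sc_inverse: "of_nat (Suc s) * (sc (1 / of_nat (Suc s)) * x) = x"
proof -
  have "sc (of_nat (Suc s)) * sc (1 / of_nat (Suc s)) = 1"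
    by (simp flip: sc_mult del: of_nat_Suc)
  then show ?thesis by (simp add: sc_of_nat del: of_nat_Suc flip: mult.assoc)
qed

lemma of_nat_cancel: "of_nat (Suc s) * x = of_nat (Suc s) * (y :: uea) \<Longrightarrow> x = y"
proof -
  assume "of_nat (Suc s) * x = of_nat (Suc s) * y"
  then have "sc (1 / of_nat (Suc s)) * (of_nat (Suc s) * x) = sc (1 / of_nat (Suc s)) * (of_nat (Suc s) * y)"
    by simp
  moreover have "sc (1 / of_nat (Suc s)) * (of_nat (Suc s) * z) = z" for z
    using of_nat_sc_inverse[of s z] by (metis sc_left_commute sc_of_nat)
  ultimately show "x = y" by metis
qed

lemma of_nat_left_commute: "x * (of_nat n * y) = of_nat n * (x * (y :: uea))"
  by (metis mult.assoc mult_of_nat_commute)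

lemma hs_newton: "of_nat s * hs s = (\<Sum>k<s. pp (Suc k) * hs (s - Suc k))"
proof (cases s)
  case (Suc t)
  then show ?thesis
    by (simp only: hs.simps of_nat_sc_inverse lessThan_Suc_atMost diff_Suc_Suc)
qed simp

lemma es_newton: "of_nat s * es s = (\<Sum>k<s. sc ((- 1) ^ k) * pp (Suc k) * es (s - Suc k))"
proof (cases s)
  case (Suc t)
  then show ?thesis
    by (simp only: es.simps of_nat_sc_inverse lessThan_Suc_atMost diff_Suc_Suc)
qed simp

lemma commute_sum:
  fixes x :: uea
  assumes "\<And>k. k \<in> A \<Longrightarrow> x * f k = f k * x"
  shows "x * sum f A = sum f A * x"
  using assms by (simp add: sum_distrib_left sum_distrib_right)

lemma commute_mult: "x * a = a * x \<Longrightarrow> x * b = b * x \<Longrightarrow> x * (a * b) = a * b * (x :: uea)"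
  by (metis mult.assoc)

lemma hs_commute:
  assumes "\<And>k. x * pp (Suc k) = pp (Suc k) * x"
  shows "x * hs s = hs s * x"
proof (induction s rule: less_induct)
  case (less s)
  show ?case
  proof (cases s)
    case (Suc t)
    show ?thesis unfolding Suc hs.simps
      using assms less Suc
      by (intro commute_mult commute_sum) (auto simp: sc_commute)
  qed simp
qed

lemma es_commute:
  assumes "\<And>k. x * pp (Suc k) = pp (Suc k) * x"
  shows "x * es s = es s * x"
proof (induction s rule: less_induct)
  case (less s)
  show ?case
  proof (cases s)
    case (Suc t)
    show ?thesis unfolding Suc es.simps
      using assms less Suc
      by (intro commute_mult commute_sum) (auto simp: sc_commute)
  qed simp
qed

lemma pp_hs: "pp i * hs s = hs s * pp i" and pp_es: "pp i * es s = es s * pp i"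
  by (auto intro!: hs_commute es_commute pp_commute)

lemma es_hs: "es i * hs s = hs s * es i" and es_es: "es i * es j = es j * es i"
  by (auto intro!: hs_commute es_commute simp: pp_es)

lemma sum_triangle_swap:
  fixes f :: "nat \<Rightarrow> nat \<Rightarrow> 'a :: comm_monoid_add"
  shows "(\<Sum>i<n. \<Sum>j<n - i. f i j) = (\<Sum>j<n. \<Sum>i<n - j. f i j)"
  unfolding sum.Sigma[OF finite_lessThan ballI[OF finite_lessThan]]
  by (rule sum.reindex_bij_witness[of _ "\<lambda>(j, i). (i, j)" "\<lambda>(i, j). (j, i)"]) auto

lemma sum_triangle_diagonal:
  fixes f :: "nat \<Rightarrow> nat \<Rightarrow> 'a :: comm_monoid_add"
  shows "(\<Sum>i<n. \<Sum>j<n - i. f i j) = (\<Sum>l<n. \<Sum>i\<le>l. f i (l - i))"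
  unfolding sum.Sigma[OF finite_lessThan ballI[OF finite_lessThan]]
    sum.Sigma[OF finite_lessThan ballI[OF finite_atMost]]
  by (rule sum.reindex_bij_witness[of _ "\<lambda>(l, i). (i, l - i)" "\<lambda>(i, j). (i + j, i)"]) auto

text \<open>Read \<open>ff j\<close> as \<open>x^j\<close>: by \<open>ff_pp\<close>, moving
  \<open>ff\<close> to the right past \<open>pp k\<close> replaces \<open>p_k\<close> by
  \<open>p_k + x^k\<close>. The series exp(sum of \<open>p_k t^k / k\<close>) of the
  \<open>hs\<close> is thereby multiplied by \<open>1 / (1 - x t)\<close>, whose coefficients are
  the powers of \<open>x\<close>.\<close>

lemma ff_hs: "ff k * hs s = (\<Sum>i\<le>s. hs (s - i) * ff (k + i))"
proof (induction s arbitrary: k rule: less_induct)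
  case (less s)
  show ?case
  proof (cases s)
    case 0 then show ?thesis by simp
  next
    case (Suc t)
    \<comment> \<open>Newton's identity is available for \<open>s\<close> times \<open>hs s\<close>.
      The two sums that it produces end up with weights \<open>s - i\<close> and \<open>i\<close> on
      the same terms, which add up to \<open>s\<close>.\<close>
    have "of_nat s * (ff k * hs s) = ff k * (of_nat s * hs s)"
      by (rule of_nat_left_commute[symmetric])
    also have "\<dots> = (\<Sum>j<s. (ff k * pp (Suc j)) * hs (s - Suc j))"
      by (simp add: hs_newton sum_distrib_left mult.assoc)
    also have "\<dots> = (\<Sum>j<s. pp (Suc j) * (ff k * hs (s - Suc j))) + (\<Sum>j<s. ff (k + Suc j) * hs (s - Suc j))"
      unfolding ff_pp distrib_right sum.distrib mult.assoc by (simp only: add.commute)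
    also have "(\<Sum>j<s. pp (Suc j) * (ff k * hs (s - Suc j)))
        = (\<Sum>j<s. \<Sum>i<s - j. pp (Suc j) * (hs (s - Suc j - i) * ff (k + i)))"
    proof (rule sum.cong[OF refl])
      fix j assume "j \<in> {..<s}"
      then have "{..s - Suc j} = {..<s - j}" by auto
      then show "pp (Suc j) * (ff k * hs (s - Suc j)) = (\<Sum>i<s - j. pp (Suc j) * (hs (s - Suc j - i) * ff (k + i)))"
        using less[of "s - Suc j" k] \<open>j \<in> {..<s}\<close> by (simp add: sum_distrib_left)
    qed
    also have "\<dots> = (\<Sum>i<s. \<Sum>j<s - i. pp (Suc j) * hs (s - i - Suc j) * ff (k + i))"
      by (subst sum_triangle_swap) (simp add: mult.assoc diff_commute add.commute)
    also have "\<dots> = (\<Sum>i<s. of_nat (s - i) * (hs (s - i) * ff (k + i)))"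
      by (simp only: hs_newton sum_distrib_right mult.assoc[symmetric])
    also have "(\<Sum>j<s. ff (k + Suc j) * hs (s - Suc j))
        = (\<Sum>j<s. \<Sum>i<s - j. hs (s - Suc j - i) * ff (k + Suc j + i))"
    proof (rule sum.cong[OF refl])
      fix j assume "j \<in> {..<s}"
      then have "{..s - Suc j} = {..<s - j}" by auto
      then show "ff (k + Suc j) * hs (s - Suc j) = (\<Sum>i<s - j. hs (s - Suc j - i) * ff (k + Suc j + i))"
        using less[of "s - Suc j" "k + Suc j"] \<open>j \<in> {..<s}\<close> by simp
    qed
    also have "\<dots> = (\<Sum>l<s. \<Sum>j\<le>l. hs (s - Suc l) * ff (k + Suc l))"
      by (subst sum_triangle_diagonal) (auto intro!: sum.cong)
    also have "\<dots> = (\<Sum>l<s. of_nat (Suc l) * (hs (s - Suc l) * ff (k + Suc l)))"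
      by simp
    also have "(\<Sum>i<s. of_nat (s - i) * (hs (s - i) * ff (k + i))) = (\<Sum>i\<le>s. of_nat (s - i) * (hs (s - i) * ff (k + i)))"
      by (simp flip: lessThan_Suc_atMost)
    also have "(\<Sum>l<s. of_nat (Suc l) * (hs (s - Suc l) * ff (k + Suc l))) = (\<Sum>i\<le>s. of_nat i * (hs (s - i) * ff (k + i)))"
      by (subst sum.atMost_shift) simp
    also have "(\<Sum>i\<le>s. of_nat (s - i) * (hs (s - i) * ff (k + i))) + (\<Sum>i\<le>s. of_nat i * (hs (s - i) * ff (k + i)))
        = (\<Sum>i\<le>s. of_nat s * (hs (s - i) * ff (k + i)))"
      unfolding sum.distrib[symmetric] distrib_right[symmetric] of_nat_add[symmetric]
      by (intro sum.cong) auto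
    also have "\<dots> = of_nat s * (\<Sum>i\<le>s. hs (s - i) * ff (k + i))"
      by (simp add: sum_distrib_left)
    finally show ?thesis using of_nat_cancel[of t] Suc by blast
  qed
qed

text \<open>With \<open>p\<^sub>k\<close> acting on a single letter as multiplication by \<open>x\<^sup>k\<close>, the generating function of
  the \<open>es\<close> acts as \<open>1 + x t\<close>.\<close>

lemma es_ee: "es (Suc k) * ee i = ee i * es (Suc k) + ee (Suc i) * es k"
proof (induction k arbitrary: i rule: less_induct)
  case (less k)
  have step: "es (k - j) * ee i = ee i * es (k - j) + (if j < k then ee (Suc i) * es (k - Suc j) else 0)"
    if "j \<le> k" for i j
    using less[of "k - Suc j" i] that by (cases "j < k") (auto simp: Suc_diff_Suc)
  define c where "c j = sc ((- 1) ^ j)" for j :: nat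
  have cs: "c (Suc j) = - c j" for j by (simp add: c_def sc_minus)
  have cc: "x * (c j * y) = c j * (x * y)" for x y j by (simp add: c_def sc_left_commute)
  have pe: "pp l * (ee i * x) = ee i * (pp l * x) + ee (l + i) * x" for l i x
    by (simp add: pp_ee distrib_right flip: mult.assoc)
  have "of_nat (Suc k) * (es (Suc k) * ee i) = of_nat (Suc k) * es (Suc k) * ee i"
    by (simp only: mult.assoc)
  also have "\<dots> = (\<Sum>j\<le>k. c j * (pp (Suc j) * (es (k - j) * ee i)))"
    by (simp only: es_newton c_def lessThan_Suc_atMost sum_distrib_right mult.assoc diff_Suc_Suc)
  also have "\<dots> = (\<Sum>j\<le>k. c j * (pp (Suc j) * (ee i * es (k - j))))
      + (\<Sum>j\<le>k. c j * (pp (Suc j) * (if j < k then ee (Suc i) * es (k - Suc j) else 0)))"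
    unfolding sum.distrib[symmetric] distrib_left[symmetric]
    by (intro sum.cong refl) (simp only: step atMost_iff)
  also have "(\<Sum>j\<le>k. c j * (pp (Suc j) * (ee i * es (k - j))))
      = ee i * (\<Sum>j\<le>k. c j * (pp (Suc j) * es (k - j))) + (\<Sum>j\<le>k. c j * (ee (Suc (i + j)) * es (k - j)))"
    by (simp add: pe distrib_left sum.distrib sum_distrib_left cc[of "ee _"] add.commute)
  also have "(\<Sum>j\<le>k. c j * (pp (Suc j) * es (k - j))) = of_nat (Suc k) * es (Suc k)"
    by (simp only: es_newton c_def mult.assoc lessThan_Suc_atMost diff_Suc_Suc)
  also have "(\<Sum>j\<le>k. c j * (pp (Suc j) * (if j < k then ee (Suc i) * es (k - Suc j) else 0)))
      = (\<Sum>j<k. c j * (pp (Suc j) * (ee (Suc i) * es (k - Suc j))))"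
    by (simp flip: lessThan_Suc_atMost)
  also have "\<dots> = ee (Suc i) * (\<Sum>j<k. c j * (pp (Suc j) * es (k - Suc j)))
      + (\<Sum>j<k. c j * (ee (Suc (i + Suc j)) * es (k - Suc j)))"
    by (simp add: pe distrib_left sum.distrib sum_distrib_left cc[of "ee _"] add.commute)
  also have "(\<Sum>j<k. c j * (pp (Suc j) * es (k - Suc j))) = of_nat k * es k"
    by (simp only: es_newton c_def mult.assoc)
  \<comment> \<open>Shifting the index flips the sign of \<open>c\<close>, so up to sign this is the
    sum over \<open>j \<le> k\<close> obtained above without its first term. Only that first term
    survives the addition.\<close>
  also have "(\<Sum>j<k. c j * (ee (Suc (i + Suc j)) * es (k - Suc j)))
      = ee (Suc i) * es k - (\<Sum>j\<le>k. c j * (ee (Suc (i + j)) * es (k - j)))"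
  proof (cases k)
    case (Suc l)
    show ?thesis unfolding Suc sum.atMost_Suc_shift
      by (simp add: cs lessThan_Suc_atMost sum_negf) (simp add: c_def)
  qed (simp add: c_def)
  finally have "of_nat (Suc k) * (es (Suc k) * ee i) = of_nat (Suc k) * (ee i * es (Suc k) + ee (Suc i) * es k)"
    by (simp add: algebra_simps mult_of_nat_commute)
  then show ?case by (rule of_nat_cancel)
qed

text \<open>This is \<open>H(-t) E(t) = 1\<close>. By Newton's identities the logarithmic
  derivatives of the two factors are opposite, so the derivative of the product vanishes;
  multiplication by \<open>n = i + (n - i)\<close> plays the role of the Leibniz rule.\<close>

lemma hs_es_convolution:
  assumes "n > 0"
  shows "(\<Sum>i\<le>n. sc ((- 1) ^ i) * (hs i * es (n - i))) = 0"
proof -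
  define c where "c j = sc ((- 1) ^ j)" for j :: nat
  have cs: "c (Suc j) = - c j" for j by (simp add: c_def sc_minus)
  have cc: "x * (c j * y) = c j * (x * y)" for x y j by (simp add: c_def sc_left_commute)
  have cm: "c (i + j) = c i * c j" for i j by (simp add: c_def power_add sc_mult)
  have ca: "c a * x = - (c (a - Suc b) * (c b * x))" if "b < a" for a b x
    using cm[of "a - Suc b" "Suc b"] that by (simp add: cs mult.assoc)
  let ?S = "\<Sum>i\<le>n. c i * (hs i * es (n - i))"
  let ?T = "\<lambda>i k. c i * (c k * (pp (Suc k) * (hs i * es (n - Suc (i + k)))))"
  have nc: "of_nat m * (c j * y) = c j * (of_nat m * y)" for m j y
    by (rule cc)
  have "of_nat n * ?S = (\<Sum>i\<le>n. of_nat n * (c i * (hs i * es (n - i))))"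
    by (rule sum_distrib_left)
  also have "\<dots> = (\<Sum>i\<le>n. c i * ((of_nat i * hs i) * es (n - i)) + c i * (hs i * (of_nat (n - i) * es (n - i))))"
  proof (rule sum.cong[OF refl])
    fix i assume "i \<in> {..n}"
    then have "(of_nat n :: uea) = of_nat i + of_nat (n - i)" by (simp flip: of_nat_add)
    moreover have "hs i * (of_nat (n - i) * es (n - i)) = of_nat (n - i) * (hs i * es (n - i))"
      by (rule of_nat_left_commute)
    ultimately show "of_nat n * (c i * (hs i * es (n - i))) = c i * ((of_nat i * hs i) * es (n - i)) + c i * (hs i * (of_nat (n - i) * es (n - i)))"
      by (simp add: nc distrib_left distrib_right mult.assoc)
  qed
  also have "\<dots> = (\<Sum>i\<le>n. c i * ((of_nat i * hs i) * es (n - i))) + (\<Sum>i\<le>n. c i * (hs i * (of_nat (n - i) * es (n - i))))"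
    by (rule sum.distrib)
  also have "(\<Sum>i\<le>n. c i * ((of_nat i * hs i) * es (n - i)))
      = (\<Sum>i\<le>n. \<Sum>k<i. c i * (pp (Suc k) * (hs (i - Suc k) * es (n - i))))"
    by (simp only: hs_newton sum_distrib_left sum_distrib_right mult.assoc)
  \<comment> \<open>Writing \<open>i + Suc k\<close> for \<open>i\<close> turns the coefficient into
    \<open>c (i + Suc k)\<close>, whose sign is opposite to \<open>c i * c k\<close>. The terms then
    cancel those of the second sum one by one.\<close>
  also have "\<dots> = (\<Sum>i<n. \<Sum>k<n - i. - ?T i k)"
    unfolding sum.Sigma[OF finite_lessThan ballI[OF finite_lessThan]]
      sum.Sigma[OF finite_atMost ballI[OF finite_lessThan]]
    by (rule sum.reindex_bij_witness[of _ "\<lambda>(i, k). (i + Suc k, k)" "\<lambda>(i, k). (i - Suc k, k)"])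
      (auto simp: ca)
  also have "(\<Sum>i\<le>n. c i * (hs i * (of_nat (n - i) * es (n - i))))
      = (\<Sum>i<n. c i * (hs i * (of_nat (n - i) * es (n - i))))"
    by (simp flip: lessThan_Suc_atMost)
  also have "\<dots> = (\<Sum>i<n. \<Sum>k<n - i. ?T i k)"
    unfolding es_newton sum_distrib_left
  proof (intro sum.cong refl)
    fix i k
    have "hs i * (c k * pp (Suc k) * es (n - i - Suc k)) = c k * (pp (Suc k) * (hs i * es (n - Suc (i + k))))"
      by (metis cc diff_diff_left add_Suc_right mult.assoc pp_hs)
    then show "c i * (hs i * (sc ((- 1) ^ k) * pp (Suc k) * es (n - i - Suc k))) = ?T i k"
      by (simp add: c_def)
  qed
  finally have "of_nat n * ?S = 0" by (simp add: sum_negf)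
  then have "of_nat n * ?S = of_nat n * 0" by simp
  then have "?S = 0" using of_nat_cancel[of "n - 1" ?S 0] assms by simp
  then show ?thesis by (simp add: c_def)
qed

lemma pp_ee_power: "pp k * ee 0 ^ b = ee 0 ^ b * pp k + of_nat b * (ee 0 ^ (b - 1) * ee k)"
proof (induction b)
  case (Suc b)
  have c: "ee k * ee 0 ^ b = ee 0 ^ b * ee k"
    by (induction b) (simp_all, metis bracket_eqs(1) mult.assoc)
  have d: "of_nat b * (ee 0 * (ee 0 ^ (b - Suc 0) * ee k)) = of_nat b * (ee 0 ^ b * ee k)"
    by (cases b) (simp_all add: mult.assoc)
  have "pp k * ee 0 ^ Suc b = ee 0 * (pp k * ee 0 ^ b) + ee k * ee 0 ^ b"
    using pp_ee[of k 0] by (simp add: distrib_right flip: mult.assoc)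
  then show ?case
    unfolding Suc by (simp add: c distrib_left distrib_right of_nat_left_commute d mult.assoc)
qed simp

text \<open>The commutator is minus the sum of \<open>ee 0 ^ i * hh k * ee 0 ^ (b - i)\<close> over
  \<open>i \<le> b\<close>. Since \<open>hh k\<close> and \<open>ee 0\<close> commute up to a
  multiple of \<open>ee k\<close>, which commutes with \<open>ee 0\<close>, the summands form an
  arithmetic progression, and the sum is \<open>Suc b\<close> times the mean of its two
  ends.\<close>

lemma ff_ee_power:
  "ff k * ee 0 ^ Suc b = ee 0 ^ Suc b * ff k - of_nat (Suc b) * (ee 0 ^ b * pp k + pp k * ee 0 ^ b)"
proof (induction b)
  case 0
  then show ?case using ff_ee[of k 0] by (simp add: mult_2)
next
  case (Suc b)
  have e': "of_nat b * (ee 0 * (ee 0 ^ (b - Suc 0) * ee k)) = of_nat b * (ee 0 ^ b * ee k)"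
    by (cases b) (simp_all add: mult.assoc)
  have fe: "ff k * (ee 0 * x) = ee 0 * (ff k * x) - 2 * (pp k * x)" for x
    using ff_ee[of k 0] by (simp add: left_diff_distrib flip: mult.assoc)
  have "ff k * ee 0 ^ Suc (Suc b) = ee 0 * (ff k * ee 0 ^ Suc b) - 2 * (pp k * ee 0 ^ Suc b)"
    unfolding power_Suc[of _ "Suc b"] fe ..
  also have "\<dots> = ee 0 ^ Suc (Suc b) * ff k
      - of_nat (Suc b) * (ee 0 ^ Suc b * pp k + ee 0 * (pp k * ee 0 ^ b)) - 2 * (pp k * ee 0 ^ Suc b)"
    unfolding Suc right_diff_distrib of_nat_left_commute[of "ee 0"] distrib_left[of "ee 0"]
    by (simp add: mult.assoc)
  also have "\<dots> = ee 0 ^ Suc (Suc b) * ff k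
      - of_nat (Suc (Suc b)) * (ee 0 ^ Suc b * pp k + pp k * ee 0 ^ Suc b)"
  proof -
    let ?x = "ee 0 ^ Suc b * pp k" and ?y = "ee 0 ^ b * ee k"
    have "pp k * ee 0 ^ Suc b = ?x + of_nat (Suc b) * ?y"
      using pp_ee_power[of k "Suc b"] by simp
    moreover have "ee 0 * (pp k * ee 0 ^ b) = ?x + of_nat b * ?y"
      unfolding pp_ee_power by (simp add: distrib_left of_nat_left_commute e' mult.assoc)
    moreover have "of_nat (Suc b) * (?x + (?x + of_nat b * ?y)) + 2 * (?x + of_nat (Suc b) * ?y)
      = of_nat (Suc (Suc b)) * (?x + (?x + of_nat (Suc b) * ?y))"
      by (simp add: distrib_left distrib_right mult_2 mult_2_right)
    ultimately show ?thesis by (simp only: diff_diff_eq)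
  qed
  finally show ?case .
qed

text \<open>These subspaces play the role of submodules by which one divides: a relation modulo
  \<open>K\<close> is expressed as membership in \<open>K\<close>, without forming a
  quotient.\<close>

definition ev_stable :: "uea set \<Rightarrow> bool" where
  "ev_stable K \<longleftrightarrow> uea.subspace K \<and> (\<forall>i. \<forall>x\<in>K. ee i * x \<in> K \<and> hh i * x \<in> K \<and> ff i * x \<in> K)"

definition sym_stable :: "uea set \<Rightarrow> bool" where
  "sym_stable K \<longleftrightarrow> uea.subspace K \<and> (\<forall>k. \<forall>x\<in>K. es k * x \<in> K)"

lemma subspace_simps:
  assumes "uea.subspace K"
  shows "0 \<in> K" "x \<in> K \<Longrightarrow> y \<in> K \<Longrightarrow> x + y \<in> K" "x \<in> K \<Longrightarrow> y \<in> K \<Longrightarrow> x - y \<in> K"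
    "x \<in> K \<Longrightarrow> sc c * x \<in> K" "x \<in> K \<Longrightarrow> of_nat n * x \<in> K" "x \<in> K \<Longrightarrow> numeral l * x \<in> K"
    "x \<in> K \<Longrightarrow> - x \<in> K"
    "(\<And>i. i \<in> A \<Longrightarrow> f i \<in> K) \<Longrightarrow> sum f A \<in> K"
  using assms uea.subspace_scale[OF assms, of x "of_nat n"] uea.subspace_scale[OF assms, of x "numeral l"]
  by (auto simp: sc_of_nat intro: uea.subspace_0 uea.subspace_add uea.subspace_diff uea.subspace_scale
      uea.subspace_sum uea.subspace_neg)

lemma subspace_of_nat_cancel:
  assumes "uea.subspace K" "of_nat (Suc n) * x \<in> K"
  shows "x \<in> K"
  using subspace_simps(4)[OF assms, of "1 / of_nat (Suc n)"] of_nat_sc_inverse[of n x]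
  by (metis sc_left_commute sc_of_nat)

lemma subspace_sign_cancel:
  assumes "uea.subspace K" "sc ((- 1) ^ n) * x \<in> K"
  shows "x \<in> K"
proof -
  have "sc ((- 1) ^ n) * (sc ((- 1) ^ n) * x) = sc ((- 1) ^ n * (- 1) ^ n) * x"
    by (simp add: sc_mult mult.assoc)
  also have "\<dots> = x" by (simp flip: power_mult_distrib)
  finally show ?thesis using subspace_simps(4)[OF assms] by metis
qed

text \<open>The elementary symmetric functions generate the complete ones and the power sums: solve
  \<open>H(-t) E(t) = 1\<close> for its last \<open>hs\<close>, and Newton's identity for its last
  \<open>pp\<close>.\<close>

lemma sym_stableD:
  assumes "sym_stable K"
  shows "uea.subspace K" "x \<in> K \<Longrightarrow> es k * x \<in> K"
    "x \<in> K \<Longrightarrow> hs k * x \<in> K" "x \<in> K \<Longrightarrow> pp (Suc k) * x \<in> K"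
proof -
  show K: "uea.subspace K" and es: "x \<in> K \<Longrightarrow> es k * x \<in> K" for x k
    using assms by (auto simp: sym_stable_def)
  show "x \<in> K \<Longrightarrow> hs k * x \<in> K"
  proof (induction k arbitrary: x rule: less_induct)
    case (less n)
    show ?case
    proof (cases "n = 0")
      case False
      have "0 = (\<Sum>i\<le>n. sc ((- 1) ^ i) * (hs i * es (n - i))) * x"
        using hs_es_convolution[of n] False by simp
      also have "\<dots> = (\<Sum>i<n. sc ((- 1) ^ i) * (hs i * (es (n - i) * x))) + sc ((-1) ^ n) * (hs n * x)"
        by (simp add: sum_distrib_right distrib_right mult.assoc flip: lessThan_Suc_atMost)
      finally have "sc ((-1) ^ n) * (hs n * x) = - (\<Sum>i<n. sc ((- 1) ^ i) * (hs i * (es (n - i) * x)))"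
        by (rule minus_unique[OF sym, symmetric])
      also have "\<dots> \<in> K"
        using less es by (intro subspace_simps[OF K]) auto
      finally show ?thesis by (rule subspace_sign_cancel[OF K])
    qed (use less in simp)
  qed
  show "x \<in> K \<Longrightarrow> pp (Suc k) * x \<in> K"
  proof (induction k arbitrary: x rule: less_induct)
    case (less n)
    have "of_nat (Suc n) * es (Suc n) * x = (\<Sum>k<Suc n. sc ((- 1) ^ k) * (pp (Suc k) * (es (n - k) * x)))"
      by (simp only: es_newton sum_distrib_right mult.assoc diff_Suc_Suc)
    also have "\<dots> = (\<Sum>k<n. sc ((- 1) ^ k) * (pp (Suc k) * (es (n - k) * x))) + sc ((-1)^n) * (pp (Suc n) * x)"
      by simp
    finally have "sc ((-1)^n) * (pp (Suc n) * x) = of_nat (Suc n) * (es (Suc n) * x)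
        - (\<Sum>k<n. sc ((- 1) ^ k) * (pp (Suc k) * (es (n - k) * x)))"
      by (simp add: mult.assoc del: of_nat_Suc)
    also have "\<dots> \<in> K"
      using less es by (intro subspace_simps[OF K]) auto
    finally show ?case by (rule subspace_sign_cancel[OF K])
  qed
qed

lemma pp_stable_sym_stable:
  assumes K: "uea.subspace K" and p: "\<And>k x. x \<in> K \<Longrightarrow> pp (Suc k) * x \<in> K"
  shows "sym_stable K"
proof -
  have "es k * x \<in> K" if "x \<in> K" for k x
    using that
  proof (induction k arbitrary: x rule: less_induct)
    case (less n)
    show ?case
    proof (cases n)
      case (Suc m)
      have "of_nat (Suc m) * (es (Suc m) * x) = (\<Sum>k<Suc m. sc ((- 1) ^ k) * (pp (Suc k) * (es (m - k) * x)))"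
        by (simp only: es_newton sum_distrib_right mult.assoc[symmetric] diff_Suc_Suc)
      also have "\<dots> \<in> K"
        using less Suc by (intro subspace_simps[OF K] p) auto
      finally show ?thesis using subspace_of_nat_cancel[OF K] Suc by blast
    qed (use less in simp)
  qed
  then show ?thesis using K by (simp add: sym_stable_def)
qed

lemma ev_stableD:
  assumes "ev_stable K"
  shows "uea.subspace K" "x \<in> K \<Longrightarrow> ee i * x \<in> K" "x \<in> K \<Longrightarrow> hh i * x \<in> K" "x \<in> K \<Longrightarrow> ff i * x \<in> K"
    "x \<in> K \<Longrightarrow> pp i * x \<in> K" "sym_stable K" "x \<in> K \<Longrightarrow> ee i ^ n * x \<in> K"
proof -
  show *: "uea.subspace K" "x \<in> K \<Longrightarrow> ee i * x \<in> K" "x \<in> K \<Longrightarrow> hh i * x \<in> K" "x \<in> K \<Longrightarrow> ff i * x \<in> K" for x i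
    using assms by (auto simp: ev_stable_def)
  show p: "x \<in> K \<Longrightarrow> pp i * x \<in> K" for x i
    using * by (auto simp: pp_def mult.assoc intro: subspace_simps)
  show "sym_stable K" using * p by (intro pp_stable_sym_stable) auto
  show "x \<in> K \<Longrightarrow> ee i ^ n * x \<in> K"
    by (induction n) (auto simp: mult.assoc *)
qed

subsection \<open>Box bases\<close>

text \<open>These are the partitions into at most \<open>N\<close> positive parts, each at most
  \<open>a\<close>, written as weakly decreasing lists. The recursion asks whether the part
  \<open>Suc a\<close> occurs, which is the Pascal rule in the form used for spanning and for
  counting.\<close>

fun box_lists :: "nat \<Rightarrow> nat \<Rightarrow> nat list set" where
  "box_lists 0 N = {[]}"
| "box_lists (Suc a) 0 = {[]}"
| "box_lists (Suc a) (Suc N) = box_lists a (Suc N) \<union> (#) (Suc a) ` box_lists (Suc a) N"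

definition es_prod :: "nat list \<Rightarrow> uea" where
  "es_prod \<mu> = prod_list (map es \<mu>)"

lemma es_prod_simps [simp]: "es_prod [] = 1" "es_prod (k # \<mu>) = es k * es_prod \<mu>"
  by (simp_all add: es_prod_def)

lemma es_prod_es: "es_prod \<mu> * es k = es k * es_prod \<mu>"
  by (induction \<mu>) (simp_all, metis es_es mult.assoc)

lemma sym_stable_es_prod: "sym_stable K \<Longrightarrow> x \<in> K \<Longrightarrow> es_prod \<mu> * x \<in> K"
  by (induction \<mu>) (auto simp: mult.assoc sym_stableD)

lemma sym_stable_span:
  assumes K: "sym_stable K" and B: "\<And>k u. u \<in> B \<Longrightarrow> es k * u \<in> uea.span (K \<union> B)"
  shows "sym_stable (uea.span (K \<union> B))"
  unfolding sym_stable_def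
proof (intro conjI allI ballI)
  fix k x assume "x \<in> uea.span (K \<union> B)"
  then show "es k * x \<in> uea.span (K \<union> B)"
  proof (induction rule: uea.span_induct_alt)
    case (step c u y)
    have "es k * u \<in> uea.span (K \<union> B)"
      using step B sym_stableD(2)[OF K] by (auto intro: uea.span_base)
    then show ?case using step
      by (auto simp: distrib_left sc_left_commute intro: uea.span_add uea.span_scale)
  qed (auto intro: uea.span_zero)
qed auto

text \<open>The induction mirrors the Pascal rule for Gaussian binomials: modulo \<open>es a\<close> the pair
  \<open>(a, N)\<close> drops to \<open>(a - 1, N)\<close>, while the top coefficient of the product of the generating
  functions of \<open>es\<close> and \<open>hs\<close>, which is 1, forces \<open>hs N\<close> to kill \<open>es a * v\<close>.\<close>

lemma es_prod_box:
  assumes "sym_stable K" "\<And>k. k > a \<Longrightarrow> es k * v \<in> K" "\<And>k. k > N \<Longrightarrow> hs k * v \<in> K"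
  shows "es_prod \<mu> * v \<in> uea.span (K \<union> {es_prod \<nu> * v | \<nu>. \<nu> \<in> box_lists a N})"
  using assms
proof (induction a N arbitrary: K v \<mu> rule: box_lists.induct)
  case (1 N)
  have "sym_stable (uea.span (K \<union> {v}))"
  proof (rule sym_stable_span)
    fix k u assume "u \<in> {v}"
    then show "es k * u \<in> uea.span (K \<union> {v})"
      using 1 by (cases "k = 0") (auto intro: uea.span_base)
  qed (use 1 in auto)
  from sym_stable_es_prod[OF this, of v \<mu>] show ?case
    by (auto simp: uea.span_base)
next
  case (2 a)
  note K = sym_stableD[OF 2(1)]
  have e: "es k * v \<in> K" if "k > 0" for k
  proof -
    have "0 = (\<Sum>i\<le>k. sc ((- 1) ^ i) * (hs i * es (k - i))) * v"
      using hs_es_convolution that by simp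
    also have "\<dots> = (\<Sum>i\<le>k. sc ((- 1) ^ i) * (es (k - i) * (hs i * v)))"
      by (simp only: es_hs[symmetric] sum_distrib_right mult.assoc)
    also have "\<dots> = es k * v + (\<Sum>i<k. sc ((- 1) ^ (Suc i)) * (es (k - Suc i) * (hs (Suc i) * v)))"
      by (subst sum.atMost_shift) simp
    finally have "es k * v = - (\<Sum>i<k. sc ((- 1) ^ (Suc i)) * (es (k - Suc i) * (hs (Suc i) * v)))"
      by (rule eq_neg_iff_add_eq_0[THEN iffD2, OF sym])
    also have "\<dots> \<in> K" by (intro subspace_simps[OF K(1)] K(2) 2(3)) simp
    finally show ?thesis .
  qed
  have "sym_stable (uea.span (K \<union> {v}))"
  proof (rule sym_stable_span)
    fix k u assume "u \<in> {v}"
    then show "es k * u \<in> uea.span (K \<union> {v})"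
      using e by (cases "k = 0") (auto intro: uea.span_base)
  qed (use 2 in auto)
  from sym_stable_es_prod[OF this, of v \<mu>] show ?case
    by (auto simp: uea.span_base)
next
  case (3 a N)
  note K = sym_stableD[OF 3(3)]
  define w where "w = es (Suc a) * v"
  let ?B1 = "{es_prod \<nu> * v | \<nu>. \<nu> \<in> box_lists a (Suc N)}"
  let ?B2 = "{es_prod \<nu> * w | \<nu>. \<nu> \<in> box_lists (Suc a) N}"
  let ?W = "{es_prod \<nu> * w | \<nu>. True}"
  have W: "sym_stable (uea.span (K \<union> ?W))"
  proof (rule sym_stable_span[OF 3(3)])
    fix k u assume "u \<in> ?W"
    then obtain \<nu> where "u = es_prod \<nu> * w" by auto
    then have "es k * u = es_prod (k # \<nu>) * w" by (simp add: mult.assoc)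
    then show "es k * u \<in> uea.span (K \<union> ?W)" by (blast intro: uea.span_base)
  qed
  \<comment> \<open>Adjoining all multiples of \<open>w\<close> to the subspace kills
    \<open>es (Suc a) * v\<close>, so the first induction hypothesis applies with the bound
    \<open>a\<close>.\<close>
  have 1: "es_prod \<mu> * v \<in> uea.span (uea.span (K \<union> ?W) \<union> ?B1)"
  proof (rule 3(1)[OF W])
    fix k assume k: "k > a"
    show "es k * v \<in> uea.span (K \<union> ?W)"
    proof (cases "k = Suc a")
      case True
      then have "es k * v = es_prod [] * w" by (simp add: w_def)
      then show ?thesis by (blast intro: uea.span_base)
    qed (use k 3(4)[of k] in \<open>auto intro: uea.span_base\<close>)
  qed (auto intro!: uea.span_base 3)
  have hN: "hs (Suc N) * w \<in> K"
  proof -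
    \<comment> \<open>In this total degree every pair of factors other than
      \<open>hs (Suc N)\<close> with \<open>es (Suc a)\<close> has one factor beyond its
      bound.\<close>
    define n where "n = Suc a + Suc N"
    let ?f = "\<lambda>i. sc ((- 1) ^ i) * (hs i * es (n - i)) * v"
    have "0 = (\<Sum>i\<le>n. ?f i)"
      using hs_es_convolution[of n] by (simp add: n_def flip: sum_distrib_right)
    also have "\<dots> = ?f (Suc N) + (\<Sum>i\<in>{..n} - {Suc N}. ?f i)"
      by (rule sum.remove) (auto simp: n_def)
    finally have "?f (Suc N) = - (\<Sum>i\<in>{..n} - {Suc N}. ?f i)"
      by (rule eq_neg_iff_add_eq_0[THEN iffD2, OF sym])
    also have "\<dots> \<in> K"
    proof (intro subspace_simps[OF K(1)])
      fix i assume i: "i \<in> {..n} - {Suc N}"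
      show "?f i \<in> K"
      proof (cases "i > Suc N")
        case True
        have "?f i = sc ((- 1) ^ i) * (es (n - i) * (hs i * v))"
          by (metis es_hs mult.assoc)
        then show ?thesis by (simp only:) (intro subspace_simps[OF K(1)] K(2) 3(5) True)
      next
        case False
        then have "n - i > Suc a" using i by (auto simp: n_def)
        then have "es (n - i) * v \<in> K" by (rule 3(4))
        then show ?thesis unfolding mult.assoc by (intro subspace_simps[OF K(1)] K(3))
      qed
    qed
    finally have "hs (Suc N) * (es (n - Suc N) * v) \<in> K"
      unfolding mult.assoc by (rule subspace_sign_cancel[OF K(1)])
    then show ?thesis by (simp add: n_def w_def)
  qed
  have 2: "es_prod \<nu> * w \<in> uea.span (K \<union> ?B2)" for \<nu>
  proof (rule 3(2)[OF 3(3)])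
    fix k assume "k > Suc a"
    then show "es k * w \<in> K" unfolding w_def
      using 3(4)[of k] K(2) by (metis es_es mult.assoc)
  next
    fix k assume "k > N"
    show "hs k * w \<in> K"
    proof (cases "k = Suc N")
      case False
      then have "hs k * v \<in> K" using 3(5)[of k] \<open>k > N\<close> by simp
      then show ?thesis unfolding w_def using K(2) by (metis es_hs mult.assoc)
    qed (use hN in simp)
  qed
  let ?B = "{es_prod \<nu> * v | \<nu>. \<nu> \<in> box_lists (Suc a) (Suc N)}"
  have B2: "?B2 \<subseteq> ?B"
  proof safe
    fix \<nu> assume "\<nu> \<in> box_lists (Suc a) N"
    moreover have "es_prod \<nu> * w = es_prod (Suc a # \<nu>) * v"
      by (simp add: w_def es_prod_es flip: mult.assoc)
    ultimately show "\<exists>\<nu>'. es_prod \<nu> * w = es_prod \<nu>' * v \<and> \<nu>' \<in> box_lists (Suc a) (Suc N)"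
      by (intro exI[of _ "Suc a # \<nu>"]) auto
  qed
  have B1: "?B1 \<subseteq> ?B" by auto
  have "uea.span (K \<union> ?B2) \<subseteq> uea.span (K \<union> ?B)"
    using B2 by (intro uea.span_mono) auto
  then have "?W \<subseteq> uea.span (K \<union> ?B)" using 2 by auto
  then have "uea.span (K \<union> ?W) \<subseteq> uea.span (K \<union> ?B)"
    by (intro uea.span_minimal) (auto intro: uea.span_base)
  then have "uea.span (uea.span (K \<union> ?W) \<union> ?B1) \<subseteq> uea.span (K \<union> ?B)"
    using B1 by (intro uea.span_minimal) (auto intro: uea.span_base)
  then show ?case using 1 by blast
qed

subsection \<open>Cyclic modules over the even part\<close>

text \<open>Modulo \<open>K\<close>, the vector \<open>v\<close> satisfies the relations of a lowest
  weight vector of weight \<open>-m\<close>. The exponent \<open>N\<close> is any witness of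
  nilpotency; \<open>power_vanish\<close> sharpens it to \<open>m + 1\<close>.\<close>

locale lowest_weight =
  fixes K :: "uea set" and v :: uea and m N :: nat
  assumes K: "ev_stable K" and ff_v: "\<And>i. ff i * v \<in> K" and hh_v: "\<And>i. hh (Suc i) * v \<in> K"
    and hh_0_v: "hh 0 * v + of_nat m * v \<in> K" and nilp: "ee 0 ^ N * v \<in> K"
begin

lemmas KD = ev_stableD[OF K]
lemmas KS = subspace_simps[OF KD(1)]

lemma pp_v: "pp (Suc i) * v \<in> K"
  unfolding pp_def mult.assoc by (intro KS hh_v)

lemma ff_power_v: "ff (Suc j) * (ee 0 ^ Suc b * v) + of_nat (Suc b) * (pp (Suc j) * (ee 0 ^ b * v)) \<in> K"
proof -
  have "ff (Suc j) * (ee 0 ^ Suc b * v) + of_nat (Suc b) * (pp (Suc j) * (ee 0 ^ b * v))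
      = ff (Suc j) * ee 0 ^ Suc b * v + of_nat (Suc b) * (pp (Suc j) * ee 0 ^ b) * v"
    by (simp only: mult.assoc)
  also have "\<dots> = ee 0 ^ Suc b * (ff (Suc j) * v) - of_nat (Suc b) * (ee 0 ^ b * (pp (Suc j) * v))"
    by (simp only: ff_ee_power left_diff_distrib distrib_left distrib_right mult.assoc)
      (simp only: algebra_simps)
  also have "\<dots> \<in> K" by (intro KS KD(7) ff_v pp_v)
  finally show ?thesis .
qed

lemma hh_0_power: "hh 0 * (ee 0 ^ b * v) + of_nat m * (ee 0 ^ b * v) - of_nat (2 * b) * (ee 0 ^ b * v) \<in> K"
proof -
  have "of_nat b * (ee 0 ^ (b - 1) * ee 0) = of_nat b * ee 0 ^ b"
    by (cases b) (simp_all add: power_commutes)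
  then have "hh 0 * ee 0 ^ b = ee 0 ^ b * hh 0 + of_nat (2 * b) * ee 0 ^ b"
    using pp_ee_power[of 0 b] by (simp only: hh_pp mult.assoc of_nat_mult distrib_left of_nat_numeral)
      (simp only: mult_2 distrib_left)
  then have "hh 0 * (ee 0 ^ b * v) = ee 0 ^ b * (hh 0 * v) + of_nat (2 * b) * (ee 0 ^ b * v)"
    by (simp only: distrib_right mult.assoc[symmetric])
  then have "hh 0 * (ee 0 ^ b * v) + of_nat m * (ee 0 ^ b * v) - of_nat (2 * b) * (ee 0 ^ b * v)
     = ee 0 ^ b * (hh 0 * v + of_nat m * v)"
    by (simp add: distrib_left of_nat_left_commute)
  then show ?thesis using KD(7)[OF hh_0_v] by simp
qed

lemma ff_0_power: "ff 0 * (ee 0 ^ Suc b * v) + of_nat (Suc b) * (sc (of_nat b - of_nat m) * (ee 0 ^ b * v)) \<in> K"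
proof -
  let ?u = "ee 0 ^ b * v"
  have "of_nat b * (ee 0 ^ (b - 1) * ee 0) = of_nat b * ee 0 ^ b"
    by (cases b) (simp_all add: power_commutes)
  then have "ee 0 ^ b * pp 0 = pp 0 * ee 0 ^ b - of_nat b * ee 0 ^ b"
    using pp_ee_power[of 0 b] by simp
  then have "ff 0 * ee 0 ^ Suc b = ee 0 ^ Suc b * ff 0 - of_nat (Suc b) * (hh 0 * ee 0 ^ b - of_nat b * ee 0 ^ b)"
    using ff_ee_power[of 0 b] by (simp only: hh_pp mult.assoc mult_2) (simp only: algebra_simps)
  from arg_cong[OF this, of "\<lambda>x. x * v"]
  have *: "ff 0 * (ee 0 ^ Suc b * v) = ee 0 ^ Suc b * (ff 0 * v) - of_nat (Suc b) * (hh 0 * ?u - of_nat b * ?u)"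
    by (simp only: left_diff_distrib mult.assoc)
  have s: "sc (of_nat b - of_nat m) = of_nat b - of_nat m"
    by (simp add: sc_diff sc_of_nat)
  have "ff 0 * (ee 0 ^ Suc b * v) + of_nat (Suc b) * (sc (of_nat b - of_nat m) * ?u)
     = ee 0 ^ Suc b * (ff 0 * v) - of_nat (Suc b) * (hh 0 * ?u + of_nat m * ?u - of_nat (2 * b) * ?u)"
    unfolding * s by (simp only: of_nat_mult of_nat_numeral of_nat_add mult_2 distrib_right) (simp only: algebra_simps)
  also have "\<dots> \<in> K" by (intro KS KD(7) ff_v hh_0_power)
  finally show ?thesis .
qed

text \<open>Modulo \<open>K\<close>, \<open>ff 0\<close> sends \<open>ee 0 ^ Suc b * v\<close> to
  \<open>- (b + 1) (b - m)\<close> times \<open>ee 0 ^ b * v\<close>. The factor is nonzero for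
  \<open>b > m\<close>, so vanishing descends to the exponent \<open>m + 1\<close>.\<close>

lemma power_vanish_aux: "ee 0 ^ (Suc m + i) * v \<in> K \<Longrightarrow> ee 0 ^ Suc m * v \<in> K"
proof (induction i)
  case (Suc i)
  let ?b = "Suc m + i"
  have "ff 0 * (ee 0 ^ Suc ?b * v) \<in> K"
    using Suc(2) by (intro KD(4)) simp
  then have "of_nat (Suc ?b) * (sc (of_nat ?b - of_nat m) * (ee 0 ^ ?b * v)) \<in> K"
    using ff_0_power[of ?b] by (metis KS(3) add_diff_cancel_left')
  then have "sc (of_nat ?b - of_nat m) * (ee 0 ^ ?b * v) \<in> K"
    by (rule subspace_of_nat_cancel[OF KD(1)])
  moreover have "of_nat ?b - of_nat m = (of_nat (Suc i) :: complex)" by simp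
  ultimately have "of_nat (Suc i) * (ee 0 ^ ?b * v) \<in> K"
    by (simp only: sc_of_nat)
  then show ?case using Suc.IH subspace_of_nat_cancel[OF KD(1)] by blast
qed simp

lemma power_vanish: "a > m \<Longrightarrow> ee 0 ^ a * v \<in> K"
proof -
  assume "a > m"
  have mono: "ee 0 ^ j * v \<in> K" if "ee 0 ^ i * v \<in> K" "i \<le> j" for i j
  proof -
    have "ee 0 ^ j * v = ee 0 ^ (j - i) * (ee 0 ^ i * v)"
      using that by (simp flip: power_add mult.assoc)
    then show ?thesis using KD(7)[OF that(1)] by metis
  qed
  have "ee 0 ^ (Suc m + N) * v \<in> K" by (rule mono[OF nilp]) simp
  then have "ee 0 ^ Suc m * v \<in> K" by (rule power_vanish_aux)
  then show ?thesis by (rule mono) (use \<open>a > m\<close> in simp)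
qed

text \<open>Apply \<open>ff 1\<close> to the relation for \<open>s\<close> and \<open>Suc a\<close>.
  Moving it past \<open>hs s\<close> by \<open>ff_hs\<close> and into the power of
  \<open>ee 0\<close> by \<open>ff_power_v\<close> leaves \<open>Suc a\<close> times Newton's sum
  for \<open>Suc s\<close>. Starting with \<open>ff 1\<close> makes every power sum in it have
  positive index.\<close>

lemma hs_vanish: "a + s > m \<Longrightarrow> hs s * (ee 0 ^ a * v) \<in> K"
proof (induction s arbitrary: a)
  case 0
  then show ?case by (simp add: power_vanish)
next
  case (Suc s)
  let ?u = "ee 0 ^ a * v"
  have S: "sym_stable K" by (rule KD)
  have "hs s * (ee 0 ^ Suc a * v) \<in> K" by (rule Suc.IH) (use Suc.prems in simp)
  then have "ff 1 * (hs s * (ee 0 ^ Suc a * v)) \<in> K" by (rule KD)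
  also have "ff 1 * (hs s * (ee 0 ^ Suc a * v)) = (\<Sum>i\<le>s. hs (s - i) * (ff (Suc i) * (ee 0 ^ Suc a * v)))"
    by (simp only: ff_hs sum_distrib_right mult.assoc plus_1_eq_Suc flip: mult.assoc[of "ff 1"])
  finally have 1: "(\<Sum>i\<le>s. hs (s - i) * (ff (Suc i) * (ee 0 ^ Suc a * v))) \<in> K" .
  have "(\<Sum>i\<le>s. hs (s - i) * (ff (Suc i) * (ee 0 ^ Suc a * v) + of_nat (Suc a) * (pp (Suc i) * ?u))) \<in> K"
    by (intro KS sym_stableD(3)[OF S] ff_power_v)
  then have "(\<Sum>i\<le>s. hs (s - i) * (ff (Suc i) * (ee 0 ^ Suc a * v)))
      + (\<Sum>i\<le>s. hs (s - i) * (of_nat (Suc a) * (pp (Suc i) * ?u))) \<in> K"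
    by (simp only: distrib_left sum.distrib)
  from KS(3)[OF this 1] have "(\<Sum>i\<le>s. hs (s - i) * (of_nat (Suc a) * (pp (Suc i) * ?u))) \<in> K"
    by simp
  also have "(\<Sum>i\<le>s. hs (s - i) * (of_nat (Suc a) * (pp (Suc i) * ?u)))
      = of_nat (Suc a) * ((\<Sum>i<Suc s. pp (Suc i) * hs (Suc s - Suc i)) * ?u)"
    unfolding sum_distrib_left sum_distrib_right lessThan_Suc_atMost diff_Suc_Suc
    by (intro sum.cong refl) (metis mult.assoc of_nat_left_commute pp_hs)
  also have "\<dots> = of_nat (Suc a) * (of_nat (Suc s) * (hs (Suc s) * ?u))"
    by (simp only: hs_newton[symmetric] mult.assoc)
  finally have "of_nat (Suc s) * (hs (Suc s) * ?u) \<in> K"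
    by (rule subspace_of_nat_cancel[OF KD(1)])
  then show ?case by (rule subspace_of_nat_cancel[OF KD(1)])
qed

text \<open>On \<open>ee 0 ^ a * v\<close> the power sums act in \<open>a\<close> variables, so
  elementary functions of larger degree vanish. Formally, \<open>es_ee\<close> lowers the index of
  \<open>es\<close> by at most 1 for each \<open>ee 0\<close> that it passes.\<close>

lemma es_vanish: "k > a \<Longrightarrow> es k * (ee 0 ^ a * v) \<in> K"
proof (induction a arbitrary: k)
  case 0
  then obtain j where "k = Suc j" by (cases k) auto
  have "of_nat k * (es k * v) = (\<Sum>i<k. sc ((- 1) ^ i) * (es (k - Suc i) * (pp (Suc i) * v)))"
    by (simp only: mult.assoc[symmetric] es_newton sum_distrib_right)
      (intro sum.cong refl, simp add: mult.assoc pp_es)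
  also have "\<dots> \<in> K" by (intro KS sym_stableD(2)[OF KD(6)] pp_v)
  finally show ?case using subspace_of_nat_cancel[OF KD(1), of j] \<open>k = Suc j\<close> by simp
next
  case (Suc a)
  then obtain j where j: "k = Suc j" "j > a" by (cases k) auto
  have "es k * (ee 0 ^ Suc a * v) = es (Suc j) * ee 0 * (ee 0 ^ a * v)"
    by (simp add: j mult.assoc)
  also have "\<dots> = ee 0 * (es (Suc j) * (ee 0 ^ a * v)) + ee 1 * (es j * (ee 0 ^ a * v))"
    by (simp add: es_ee distrib_right mult.assoc)
  also have "\<dots> \<in> K" using j by (intro KS KD Suc.IH) auto
  finally show ?case .
qed

text \<open>A candidate for the \<open>sl_2\<close> current module generated by \<open>v\<close>
  modulo \<open>K\<close>: polynomials in the positive power sums applied to powers of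
  \<open>ee 0\<close>. It contains \<open>v\<close> and \<open>K\<close>, and the next lemma shows
  that it is stable.\<close>

inductive_set R :: "uea set" where
  base: "x \<in> K \<Longrightarrow> x \<in> R"
| power: "ee 0 ^ a * v \<in> R"
| pp: "x \<in> R \<Longrightarrow> pp (Suc k) * x \<in> R"
| add: "x \<in> R \<Longrightarrow> y \<in> R \<Longrightarrow> x + y \<in> R"
| scale: "x \<in> R \<Longrightarrow> sc c * x \<in> R"

lemma R_subspace: "uea.subspace R"
  by (auto simp: uea.subspace_def intro: R.intros KS(1))

lemmas RS = subspace_simps[OF R_subspace]

lemma R_ev_stable: "ev_stable R"
proof -
  have "(\<forall>i. ee i * x \<in> R) \<and> (\<forall>i. hh i * x \<in> R) \<and> (\<forall>i. ff i * x \<in> R)" if "x \<in> R" for x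
    using that
  proof induction
    case (base x)
    then show ?case by (auto intro: R.base KD)
  next
    case (power a)
    have e: "ee i * (ee 0 ^ a * v) \<in> R" for i
    proof (cases i)
      case 0
      then show ?thesis using R.power[of "Suc a"] by (simp add: mult.assoc)
    next
      case (Suc j)
      have "ee 0 ^ a * ee i = ee i * ee 0 ^ a"
        by (metis bracket_eqs(1) power_commuting_commutes)
      \<comment> \<open>A letter \<open>ee i\<close> need not be adjoined separately: it arises by
        differentiating one more power of \<open>ee 0\<close> with \<open>pp i\<close>, and
        \<open>pp i * v\<close> lies in \<open>K\<close>.\<close>
      then have "of_nat (Suc a) * (ee i * (ee 0 ^ a * v))
          = pp i * (ee 0 ^ Suc a * v) - ee 0 ^ Suc a * (pp i * v)"
        using pp_ee_power[of i "Suc a"] by (simp add: distrib_right del: power_Suc of_nat_Suc flip: mult.assoc)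
      also have "\<dots> \<in> R"
        unfolding Suc by (intro RS R.pp R.power R.base KD(7) pp_v)
      finally show ?thesis by (rule subspace_of_nat_cancel[OF R_subspace])
    qed
    have h: "hh i * (ee 0 ^ a * v) \<in> R" for i
    proof (cases i)
      case 0
      have "hh 0 * (ee 0 ^ a * v) = (hh 0 * (ee 0 ^ a * v) + of_nat m * (ee 0 ^ a * v) - of_nat (2 * a) * (ee 0 ^ a * v))
          - of_nat m * (ee 0 ^ a * v) + of_nat (2 * a) * (ee 0 ^ a * v)"
        by (simp only: algebra_simps)
      also have "\<dots> \<in> R" by (intro RS R.power R.base[OF hh_0_power])
      finally show ?thesis using 0 by simp
    next
      case (Suc j)
      then show ?thesis by (simp add: hh_pp mult.assoc) (intro RS R.pp R.power)
    qed
    have f: "ff i * (ee 0 ^ a * v) \<in> R" for i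
    proof (cases a)
      case 0
      then show ?thesis using ff_v R.base by simp
    next
      case (Suc b)
      show ?thesis
      proof (cases i)
        case 0
        from R.base[OF ff_0_power[of b]]
        have "ff 0 * (ee 0 ^ Suc b * v) + of_nat (Suc b) * (sc (of_nat b - of_nat m) * (ee 0 ^ b * v))
          - of_nat (Suc b) * (sc (of_nat b - of_nat m) * (ee 0 ^ b * v)) \<in> R"
          by (rule RS(3)) (intro RS R.power)
        then show ?thesis using 0 Suc by (simp only: add_diff_cancel_right')
      next
        case (Suc j)
        from R.base[OF ff_power_v[of j b]]
        have "ff (Suc j) * (ee 0 ^ Suc b * v) + of_nat (Suc b) * (pp (Suc j) * (ee 0 ^ b * v))
          - of_nat (Suc b) * (pp (Suc j) * (ee 0 ^ b * v)) \<in> R"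
          by (rule RS(3)) (intro RS R.pp R.power)
        then show ?thesis using Suc \<open>a = Suc b\<close> by (simp only: add_diff_cancel_right')
      qed
    qed
    show ?case using e h f by blast
  next
    case (pp x k)
    have "ee i * (pp (Suc k) * x) = pp (Suc k) * (ee i * x) - ee (Suc k + i) * x" for i
      using arg_cong[OF pp_ee[of "Suc k" i], of "\<lambda>y. y * x"]
      by (simp add: distrib_right mult.assoc)
    moreover have "ff i * (pp (Suc k) * x) = pp (Suc k) * (ff i * x) + ff (Suc k + i) * x" for i
      using arg_cong[OF ff_pp[of i "Suc k"], of "\<lambda>y. y * x"]
      by (simp add: distrib_right mult.assoc)
    moreover have "hh i * (pp (Suc k) * x) = pp (Suc k) * (hh i * x)" for i
      using arg_cong[OF pp_commute[of i "Suc k"], of "\<lambda>y. y * x"]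
      by (simp add: hh_pp mult_2 distrib_right distrib_left mult.assoc)
    ultimately show ?case using pp(2) by (simp add: RS(2,3) R.pp)
  next
    case (add x y)
    then show ?case by (auto simp: distrib_left intro: R.add)
  next
    case (scale x c)
    then show ?case by (auto simp: sc_left_commute intro: R.scale)
  qed
  then show ?thesis using R_subspace by (auto simp: ev_stable_def)
qed

text \<open>For \<open>a \<le> m\<close> the bounds \<open>es_vanish\<close> and
  \<open>hs_vanish\<close> put the symmetric operators into an \<open>a\<close> by
  \<open>m - a\<close> box; larger powers lie in \<open>K\<close>. The family has \<open>2^m\<close>
  indices in all, the dimension of the \<open>sl_2\<close> Weyl module.\<close>

lemma R_subset: "R \<subseteq> uea.span (K \<union> {es_prod \<mu> * (ee 0 ^ a * v) | a \<mu>. a \<le> m \<and> \<mu> \<in> box_lists a (m - a)})"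
proof -
  let ?B = "{es_prod \<mu> * (ee 0 ^ a * v) | a \<mu>. a \<le> m \<and> \<mu> \<in> box_lists a (m - a)}"
  let ?A = "{es_prod \<mu> * (ee 0 ^ a * v) | a \<mu>. True}"
  have S: "sym_stable (uea.span (K \<union> ?A))"
  proof (rule sym_stable_span[OF KD(6)])
    fix k u assume "u \<in> ?A"
    then obtain a \<mu> where "u = es_prod \<mu> * (ee 0 ^ a * v)" by auto
    then have "es k * u = es_prod (k # \<mu>) * (ee 0 ^ a * v)" by (simp add: mult.assoc)
    then show "es k * u \<in> uea.span (K \<union> ?A)" by (blast intro: uea.span_base)
  qed
  have "x \<in> uea.span (K \<union> ?A)" if "x \<in> R" for x
    using that
  proof induction
    case (power a)
    have "ee 0 ^ a * v = es_prod [] * (ee 0 ^ a * v)" by simp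
    then show ?case by (blast intro: uea.span_base)
  next
    case (pp x k)
    from pp(2) show ?case by (rule sym_stableD(4)[OF S])
  qed (auto intro: uea.span_base uea.span_add uea.span_scale)
  moreover have "?A \<subseteq> uea.span (K \<union> ?B)"
  proof safe
    fix a \<mu>
    show "es_prod \<mu> * (ee 0 ^ a * v) \<in> uea.span (K \<union> ?B)"
    proof (cases "a \<le> m")
      case True
      have "es_prod \<mu> * (ee 0 ^ a * v) \<in> uea.span (K \<union> {es_prod \<nu> * (ee 0 ^ a * v) | \<nu>. \<nu> \<in> box_lists a (m - a)})"
        using True by (intro es_prod_box KD es_vanish hs_vanish) auto
      moreover have "K \<union> {es_prod \<nu> * (ee 0 ^ a * v) | \<nu>. \<nu> \<in> box_lists a (m - a)} \<subseteq> K \<union> ?B"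
        using True by blast
      ultimately show ?thesis using uea.span_mono by blast
    next
      case False
      then have "es_prod \<mu> * (ee 0 ^ a * v) \<in> K"
        using power_vanish sym_stable_es_prod[OF KD(6)] by simp
      then show ?thesis by (blast intro: uea.span_base)
    qed
  qed
  then have "uea.span (K \<union> ?A) \<subseteq> uea.span (K \<union> ?B)"
    by (intro uea.span_minimal) (auto intro: uea.span_base)
  ultimately show ?thesis by blast
qed

end

lemma single_word: "Poly_Mapping.single (Word ls) c = scal c * prod_list (map gen ls)"
proof -
  have "prod_list (map gen ls) = Poly_Mapping.single (Word ls) 1"
    by (induction ls) (simp_all add: gen_def mult_single plus_osp_word_def flip: zero_osp_word_def)
  then show ?thesis by (simp add: scal_def mult_single)
qed

lemma uea_induct [case_names one ee hh ff gp gm add scale]: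
  assumes "P 1" and "\<And>i x. P x \<Longrightarrow> P (ee i * x)" "\<And>i x. P x \<Longrightarrow> P (hh i * x)" "\<And>i x. P x \<Longrightarrow> P (ff i * x)"
    "\<And>i x. P x \<Longrightarrow> P (gp i * x)" "\<And>i x. P x \<Longrightarrow> P (gm i * x)"
    "\<And>x y. P x \<Longrightarrow> P y \<Longrightarrow> P (x + y)" "\<And>c x. P x \<Longrightarrow> P (sc c * x)"
  shows "P x"
proof -
  obtain p where p: "p \<in> tensors" "x = cls p" by (rule cls_cases)
  have "P (cls p)"
    using p(1)
  proof (induction rule: tensors_induct)
    case zero
    then show ?case using assms(8)[OF assms(1), of 0] by simp
  next
    case (single w c)
    have "P (prod_list (map lt ls))" if "set ls \<subseteq> twisted" for ls
      using that
    proof (induction ls)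
      case (Cons l ls)
      then have "P (lt l * y)" if "P y" for y
        using twisted_cases[of l] assms that by auto metis+
      then show ?case using Cons by simp
    qed (simp add: assms)
    moreover have "cls (Poly_Mapping.single w c) = sc c * prod_list (map lt (letters w))"
    proof -
      have *: "\<And>x. x \<in> set (map gen (letters w)) \<Longrightarrow> x \<in> tensors" using single by auto
      have "cls (Poly_Mapping.single w c) = sc c * cls (prod_list (map gen (letters w)))"
        using single_word[of "letters w" c] tensors_prod_list[of "map gen (letters w)"] *
          cls_mult[OF tensors_scal, of "prod_list (map gen (letters w))" c]
        by (metis osp_word.collapse sc_def)
      moreover have "cls (prod_list (map gen (letters w))) = prod_list (map cls (map gen (letters w)))"
        using * by (rule cls_prod_list)
      moreover have "map cls (map gen (letters w)) = map lt (letters w)" by (simp add: lt_def)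
      ultimately show ?thesis by (simp only:)
    qed
    ultimately show ?case using assms single by simp
  next
    case (add p q)
    then show ?case using assms by (simp add: cls_add)
  qed
  then show ?thesis by (simp add: p)
qed

subsection \<open>Filtration by the number of odd letters\<close>

definition gp_prod :: "nat list \<Rightarrow> uea" where "gp_prod J = prod_list (map gp J)"

lemma gp_prod_simps [simp]: "gp_prod [] = 1" "gp_prod (j # J) = gp j * gp_prod J"
  by (simp_all add: gp_prod_def)

lemma ee_gp_prod: "ee i * gp_prod J = gp_prod J * ee i"
proof (induction J)
  case (Cons j J)
  then show ?case by simp (metis bracket_eqs(15) mult.assoc)
qed simp

lemma hh_0_gp_prod: "hh 0 * gp_prod J = gp_prod J * hh 0 + of_nat (length J) * gp_prod J"
proof (induction J)
  case (Cons j J)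
  have "hh 0 * (gp j * x) = gp j * (hh 0 * x) + gp j * x" for x
    using arg_cong[OF bracket_eqs(7)[of 0 j], of "\<lambda>y. y * x"] by (simp add: distrib_right mult.assoc)
  then show ?case
    by (simp add: Cons.IH distrib_left distrib_right of_nat_left_commute mult.assoc)
qed simp

text \<open>Commuting with \<open>hh i\<close> raises one index of the product by \<open>i\<close>.
  Only length and index sum are recorded, because these two numbers define the layers of the
  filtration.\<close>

lemma hh_gp_prod:
  "hh i * gp_prod J - gp_prod J * hh i \<in>
    uea.span {gp_prod J' | J'. length J' = length J \<and> sum_list J' = sum_list J + i}"
proof (induction J)
  case (Cons j J)
  let ?A = "{gp_prod J' | J'. length J' = length J \<and> sum_list J' = sum_list J + i}"
  let ?B = "{gp_prod J' | J'. length J' = length (j # J) \<and> sum_list J' = sum_list (j # J) + i}"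
  have *: "gp j * x \<in> uea.span ?B" if "x \<in> uea.span ?A" for x
    using that
  proof (induction rule: uea.span_induct_alt)
    case (step c x y)
    then obtain J' where "x = gp_prod J'" "length J' = length J" "sum_list J' = sum_list J + i" by auto
    then have "gp j * x = gp_prod (j # J')" "length (j # J') = length (j # J)" "sum_list (j # J') = sum_list (j # J) + i"
      by auto
    then have "gp j * x \<in> ?B" by blast
    then show ?case using step
      by (simp add: distrib_left sc_left_commute uea.span_add uea.span_scale uea.span_base)
  qed (simp add: uea.span_zero)
  have "gp (i + j) * gp_prod J = gp_prod ((i + j) # J)" by simp
  then have "gp (i + j) * gp_prod J \<in> ?B"
    by (intro CollectI exI[of _ "(i + j) # J"]) simp
  moreover have "hh i * gp_prod (j # J) - gp_prod (j # J) * hh i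
      = gp j * (hh i * gp_prod J - gp_prod J * hh i) + gp (i + j) * gp_prod J"
    using arg_cong[OF bracket_eqs(7)[of i j], of "\<lambda>y. y * gp_prod J"]
    by (simp add: distrib_right right_diff_distrib mult.assoc)
  ultimately show ?case using *[OF Cons.IH] by (metis (no_types, lifting) uea.span_add uea.span_base)
qed (simp add: uea.span_zero)

lemma gp_square: "gp i * (gp i * x) = ee (2 * i + 1) * x"
proof -
  have "2 * (gp i * gp i) = 2 * ee (2 * i + 1)"
    using bracket_eqs(10)[of i i] by (simp add: mult_2 eq_diff_eq)
  then have "gp i * gp i = ee (2 * i + 1)"
    by (metis half_two(1))
  then show ?thesis by (simp flip: mult.assoc)
qed

lemma ev_stable_span_Union:
  assumes "\<And>X. X \<in> A \<Longrightarrow> ev_stable X"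
  shows "ev_stable (uea.span (\<Union>A))"
  unfolding ev_stable_def
proof (intro conjI allI ballI)
  fix i x assume "x \<in> uea.span (\<Union>A)"
  then show "ee i * x \<in> uea.span (\<Union>A)" and "hh i * x \<in> uea.span (\<Union>A)" and "ff i * x \<in> uea.span (\<Union>A)"
  proof (induction rule: uea.span_induct_alt)
    case (step c x y)
    then obtain X where X: "X \<in> A" "x \<in> X" by auto
    then have "ee i * x \<in> \<Union>A" "hh i * x \<in> \<Union>A" "ff i * x \<in> \<Union>A"
      using ev_stableD[OF assms] by blast+
    then have "sc c * (ee i * x) + ee i * y \<in> uea.span (\<Union>A)"
      "sc c * (hh i * x) + hh i * y \<in> uea.span (\<Union>A)" "sc c * (ff i * x) + ff i * y \<in> uea.span (\<Union>A)"
      using step by (simp_all add: uea.span_add uea.span_scale uea.span_base)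
    then show "ee i * (sc c * x + y) \<in> uea.span (\<Union>A)" "hh i * (sc c * x + y) \<in> uea.span (\<Union>A)"
      "ff i * (sc c * x + y) \<in> uea.span (\<Union>A)"
      by (simp_all only: distrib_left sc_left_commute[of "ee i"] sc_left_commute[of "hh i"] sc_left_commute[of "ff i"])
  qed (simp_all add: uea.span_zero)
qed simp

section \<open>Left ideals of the enveloping algebra that contain the Weyl relations\<close>

locale weyl_left_ideal =
  fixes I :: "uea set" and n :: nat
  assumes subspace_I: "uea.subspace I" and mult_I: "\<And>x y. y \<in> I \<Longrightarrow> x * y \<in> I"
    and ff_I: "\<And>i. ff i \<in> I" and gm_I: "\<And>i. gm i \<in> I" and hh_I: "\<And>i. hh (Suc i) \<in> I"
    and hh_0_I: "hh 0 + of_nat n \<in> I" and ee_I: "ee 0 ^ (n + 1) \<in> I"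
begin

lemmas SI = subspace_simps[OF subspace_I]

lemma ev_stable_I: "ev_stable I"
  by (simp add: ev_stable_def subspace_I mult_I)

sublocale base: lowest_weight I 1 n "n + 1"
  using ev_stable_I ff_I hh_I hh_0_I ee_I by unfold_locales auto

lemma es_I: "k > 0 \<Longrightarrow> es k \<in> I"
  using base.es_vanish[of 0 k] by simp

lemma es_ee_I: "k > 1 \<Longrightarrow> es k * ee i \<in> I"
proof -
  assume "k > 1"
  then obtain j where j: "k = Suc j" "j > 0" by (cases k) auto
  show ?thesis unfolding j es_ee using j by (intro SI mult_I es_I) auto
qed

lemma es_1_ee: "es 1 * ee i - ee (Suc i) \<in> I"
  using es_ee[of 0 i] mult_I[OF es_I[of 1]] by simp

text \<open>Modulo \<open>I\<close>, a single letter \<open>ee i\<close> is the monomial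
  \<open>x^i\<close> in one variable, where the complete function of degree \<open>k\<close> is
  \<open>x^k\<close>.\<close>

lemma hs_ee: "hs k * ee i - ee (i + k) \<in> I"
proof (induction k arbitrary: i)
  case 0
  then show ?case by (simp add: SI)
next
  case (Suc k)
  let ?f = "\<lambda>j. sc ((- 1) ^ j) * (hs j * (es (Suc k - j) * ee i))"
  have "0 = (\<Sum>j\<le>Suc k. sc ((- 1) ^ j) * (hs j * es (Suc k - j))) * ee i"
    using hs_es_convolution[of "Suc k"] by simp
  also have "\<dots> = (\<Sum>j<k. ?f j) + (?f k + ?f (Suc k))"
    by (simp add: sum_distrib_right distrib_right left_diff_distrib mult.assoc flip: lessThan_Suc_atMost)
  also have "?f k + ?f (Suc k) = sc ((- 1) ^ k) * (hs k * (es 1 * ee i) - hs (Suc k) * ee i)"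
    by (simp add: sc_minus right_diff_distrib)
  finally have "sc ((- 1) ^ k) * (hs k * (es 1 * ee i) - hs (Suc k) * ee i) = - (\<Sum>j<k. ?f j)"
    by (rule minus_unique[OF sym, symmetric])
  also have "\<dots> \<in> I" by (intro SI mult_I es_ee_I) auto
  finally have 1: "hs k * (es 1 * ee i) - hs (Suc k) * ee i \<in> I"
    by (rule subspace_sign_cancel[OF subspace_I])
  have 2: "hs k * (es 1 * ee i - ee (Suc i)) \<in> I" by (intro mult_I es_1_ee)
  have "hs (Suc k) * ee i - ee (i + Suc k) = hs k * (es 1 * ee i - ee (Suc i))
      - (hs k * (es 1 * ee i) - hs (Suc k) * ee i) + (hs k * ee (Suc i) - ee (Suc i + k))"
    by (simp add: right_diff_distrib)
  also have "\<dots> \<in> I" by (intro SI(2) SI(3) 1 2 Suc)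
  finally show ?case .
qed

text \<open>By \<open>hs_vanish\<close> and \<open>hs_ee\<close> the letter \<open>ee j\<close> lies
  in \<open>I\<close> for \<open>j \<ge> n\<close>, and \<open>gp j\<close> is its commutator with
  \<open>gm 0\<close>. So only the \<open>n\<close> odd letters with index below \<open>n\<close>
  matter.\<close>

lemma gp_I: "j \<ge> n \<Longrightarrow> gp j \<in> I"
proof -
  assume "j \<ge> n"
  then have "hs j * ee 0 \<in> I" using base.hs_vanish[of 1 j] by simp
  then have e: "ee j \<in> I"
    using SI(3)[OF _ hs_ee[of j 0]] by fastforce
  have "gp j = gm 0 * ee j - ee j * gm 0"
    using bracket_eqs(14)[of j 0] by simp
  also have "\<dots> \<in> I" by (intro SI(3) mult_I e gm_I)
  finally show ?thesis .
qed

text \<open>The predicate selects the odd products that generate. Leaving it open lets one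
  definition serve both the filtration \<open>L\<close> by length and its refinement by the index
  sum in \<open>lev_step\<close>.\<close>

inductive_set lev :: "(nat list \<Rightarrow> bool) \<Rightarrow> uea set" for Q where
  base: "x \<in> I \<Longrightarrow> x \<in> lev Q"
| gen: "Q J \<Longrightarrow> gp_prod J \<in> lev Q"
| ee: "x \<in> lev Q \<Longrightarrow> ee i * x \<in> lev Q"
| hh: "x \<in> lev Q \<Longrightarrow> hh i * x \<in> lev Q"
| ff: "x \<in> lev Q \<Longrightarrow> ff i * x \<in> lev Q"
| add: "x \<in> lev Q \<Longrightarrow> y \<in> lev Q \<Longrightarrow> x + y \<in> lev Q"
| scale: "x \<in> lev Q \<Longrightarrow> sc c * x \<in> lev Q"

lemma lev_subspace: "uea.subspace (lev Q)"
  by (auto simp: uea.subspace_def intro: lev.intros SI(1))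

lemma lev_stable: "ev_stable (lev Q)"
  by (simp add: ev_stable_def lev_subspace lev.intros)

lemmas LS = subspace_simps[OF lev_subspace]

lemma lev_least:
  assumes "ev_stable X" "I \<subseteq> X" "\<And>J. Q J \<Longrightarrow> gp_prod J \<in> X"
  shows "lev Q \<subseteq> X"
proof
  fix x assume "x \<in> lev Q"
  then show "x \<in> X"
  proof induction
    case (base x) then show ?case using assms(2) by blast
  next
    case (gen J) then show ?case by (rule assms(3))
  qed (auto intro: ev_stableD(2-4)[OF assms(1)] subspace_simps(2,4)[OF ev_stableD(1)[OF assms(1)]])
qed

lemma lev_mono: "(\<And>J. Q J \<Longrightarrow> Q' J) \<Longrightarrow> lev Q \<subseteq> lev Q'"
  by (intro lev_least lev_stable) (auto intro: lev.intros)

abbreviation "L c \<equiv> lev (\<lambda>J. length J < c)"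

lemma L_mono: "c \<le> d \<Longrightarrow> x \<in> L c \<Longrightarrow> x \<in> L d"
  using lev_mono[of "\<lambda>J. length J < c" "\<lambda>J. length J < d"] by auto

lemma L_0: "L 0 = I"
proof
  show "L 0 \<subseteq> I" by (rule lev_least) (auto simp: ev_stable_I)
qed (auto intro: lev.base)

text \<open>The claim about \<open>gm\<close> is a hypothesis because \<open>gm_gp_prod\<close> is
  proved by induction on the length and invokes this lemma for shorter products; \<open>gp_L\<close>
  and \<open>gm_L\<close> discharge it afterwards.\<close>

lemma odd_L:
  assumes "\<And>J i. length J < c \<Longrightarrow> gm i * gp_prod J \<in> L (length J)" "x \<in> L c"
  shows "gp j * x \<in> L (Suc c) \<and> gm j * x \<in> L (Suc c)"
  using assms(2)
proof (induction arbitrary: j)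
  case (base x)
  then show ?case by (auto intro: lev.base mult_I)
next
  case (gen J)
  have "gp_prod (j # J) \<in> L (Suc c)" using gen by (intro lev.gen) auto
  moreover have "gm j * gp_prod J \<in> L (Suc c)"
    using assms(1)[OF gen, of j] gen by (elim L_mono[rotated]) auto
  ultimately show ?case by simp
next
  case (ee x i)
  have "gp j * (ee i * x) = ee i * (gp j * x)" "gm j * (ee i * x) = ee i * (gm j * x) + gp (i + j) * x"
    using arg_cong[OF bracket_eqs(15)[of i j], of "\<lambda>y. y * x"] arg_cong[OF bracket_eqs(14)[of i j], of "\<lambda>y. y * x"]
    by (simp_all add: left_diff_distrib mult.assoc)
  then show ?case using ee by (simp add: lev.ee LS)
next
  case (hh x i)
  have "gp j * (hh i * x) = hh i * (gp j * x) - gp (i + j) * x" "gm j * (hh i * x) = hh i * (gm j * x) + gm (i + j) * x"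
    using arg_cong[OF bracket_eqs(7)[of i j], of "\<lambda>y. y * x"] arg_cong[OF bracket_eqs(8)[of i j], of "\<lambda>y. y * x"]
    by (simp_all add: left_diff_distrib distrib_right mult.assoc)
  then show ?case using hh by (simp add: lev.hh LS)
next
  case (ff x i)
  have "gm j * (ff i * x) = ff i * (gm j * x)" "gp j * (ff i * x) = ff i * (gp j * x) + gm (i + j) * x"
    using arg_cong[OF bracket_eqs(13)[of i j], of "\<lambda>y. y * x"] arg_cong[OF bracket_eqs(12)[of i j], of "\<lambda>y. y * x"]
    by (simp_all add: left_diff_distrib mult.assoc)
  then show ?case using ff by (simp add: lev.ff LS)
next
  case (add x y)
  then show ?case by (auto simp: distrib_left intro: lev.add)
next
  case (scale x c)
  then show ?case by (simp add: sc_left_commute lev.scale)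
qed

text \<open>Pulling \<open>gm i\<close> through the product turns one \<open>gp\<close> at a time
  into an \<open>hh\<close>, and at the end it hits the generator and falls into \<open>I\<close>.
  Every surviving term has strictly fewer odd letters.\<close>

lemma gm_gp_prod: "gm i * gp_prod J \<in> L (length J)"
proof (induction "length J" arbitrary: J i rule: less_induct)
  case less
  show ?case
  proof (cases J)
    case Nil
    then show ?thesis using L_0 gm_I by simp
  next
    case (Cons j J')
    have "gm i * gp_prod J' \<in> L (length J')" using less[of J'] Cons by simp
    then have 1: "gp j * (gm i * gp_prod J') \<in> L (length J)"
      using odd_L[of "length J'"] less Cons by simp
    have 2: "hh (i + j + 1) * gp_prod J' \<in> L (length J)"
      using Cons by (intro lev.hh lev.gen) simp
    have "gm i * gp_prod J = hh (i + j + 1) * gp_prod J' - gp j * (gm i * gp_prod J')"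
      using arg_cong[OF bracket_eqs(9)[of i j], of "\<lambda>y. y * gp_prod J'"] Cons
      by (simp add: left_diff_distrib mult.assoc)
    then show ?thesis using LS(3)[OF 2 1] by simp
  qed
qed

lemma gp_L: "x \<in> L c \<Longrightarrow> gp j * x \<in> L (Suc c)" and gm_L: "x \<in> L c \<Longrightarrow> gm j * x \<in> L (Suc c)"
  using odd_L[OF gm_gp_prod] by auto

lemma ff_gp_prod: "ff i * gp_prod J \<in> L (length J)"
proof (induction J)
  case Nil
  then show ?case using L_0 ff_I by simp
next
  case (Cons j J)
  have "ff i * gp_prod (j # J) = gp j * (ff i * gp_prod J) - gm (i + j) * gp_prod J"
    using arg_cong[OF bracket_eqs(12)[of i j], of "\<lambda>y. y * gp_prod J"]
    by (simp add: left_diff_distrib mult.assoc)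
  moreover have "gm (i + j) * gp_prod J \<in> L (Suc (length J))"
    using gm_gp_prod by (rule L_mono[rotated]) simp
  ultimately show ?case using LS(3)[OF gp_L[OF Cons]] by simp
qed

lemma L_exhaust: "\<exists>c. x \<in> L c"
proof (induction x rule: uea_induct)
  case one
  have "gp_prod [] \<in> L 1" by (intro lev.gen) simp
  then show ?case by (metis gp_prod_simps(1))
next
  case (add x y)
  then obtain c d where "x \<in> L c" "y \<in> L d" by auto
  then have "x \<in> L (max c d)" "y \<in> L (max c d)"
    by (auto elim: L_mono[rotated])
  then show ?case by (blast intro: lev.add)
qed (blast intro: lev.intros gp_L gm_L)+

text \<open>Anticommutators and squares of the \<open>gp\<close> are even letters \<open>ee\<close>.
  Hence, up to fewer odd letters, the \<open>gp\<close> anticommute and square to zero, and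
  insertion into a sorted product costs only a sign.\<close>

lemma gp_insort:
  assumes "sorted_wrt (<) J" "set J \<subseteq> {..<n}"
  shows "gp j * gp_prod J \<in> L (Suc (length J)) \<or>
    (j < n \<and> j \<notin> set J \<and> (\<exists>s. gp j * gp_prod J - sc s * gp_prod (insort j J) \<in> L (Suc (length J))))"
  using assms
proof (induction J)
  case Nil
  then show ?case
  proof (cases "j < n")
    case True
    have "gp j * gp_prod [] - sc 1 * gp_prod (insort j []) = 0" by simp
    then show ?thesis using True LS(1) by (metis list.set(1) empty_iff)
  next
    case False
    then have "gp j * gp_prod [] \<in> I" using gp_I by simp
    then show ?thesis by (blast intro: lev.base)
  qed
next
  case (Cons i X)
  consider "j < i" | "j = i" | "j > i" by linarith
  then show ?case
  proof cases
    case 1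
    then have "gp j * gp_prod (i # X) - sc 1 * gp_prod (insort j (i # X)) = 0" by simp
    moreover have "j < n" "j \<notin> set (i # X)" using 1 Cons.prems by auto
    ultimately show ?thesis using LS(1) by metis
  next
    case 2
    have "ee (2 * i + 1) * gp_prod X \<in> L (Suc (length (i # X)))" by (intro lev.ee lev.gen) simp
    then show ?thesis using 2 gp_square by simp
  next
    case 3
    have e: "gp j * gp_prod (i # X) = 2 * (ee (j + i + 1) * gp_prod X) - gp i * (gp j * gp_prod X)"
      using arg_cong[OF bracket_eqs(10)[of j i], of "\<lambda>y. y * gp_prod X"]
      by (simp add: left_diff_distrib mult.assoc)
    have e2: "2 * (ee (j + i + 1) * gp_prod X) \<in> L (Suc (length (i # X)))"
      by (intro LS(6) lev.ee lev.gen) simp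
    have "sorted_wrt (<) X" "set X \<subseteq> {..<n}" using Cons.prems by auto
    from Cons.IH[OF this] show ?thesis
    proof (elim disjE conjE exE)
      assume "gp j * gp_prod X \<in> L (Suc (length X))"
      from LS(3)[OF e2] gp_L[OF this, of i] show ?thesis unfolding e by simp
    next
      fix s assume j: "j < n" "j \<notin> set X"
        and s: "gp j * gp_prod X - sc s * gp_prod (insort j X) \<in> L (Suc (length X))"
      have "gp j * gp_prod (i # X) - sc (- s) * gp_prod (insort j (i # X))
          = 2 * (ee (j + i + 1) * gp_prod X) - gp i * (gp j * gp_prod X - sc s * gp_prod (insort j X))"
        using 3 unfolding e by (simp add: right_diff_distrib sc_minus sc_left_commute)
      also have "\<dots> \<in> L (Suc (length (i # X)))"
        using LS(3)[OF e2] gp_L[OF s, of i] by simp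
      finally have "gp j * gp_prod (i # X) - sc (- s) * gp_prod (insort j (i # X)) \<in> L (Suc (length (i # X)))" .
      moreover have "j \<notin> set (i # X)" using j 3 by auto
      ultimately show ?thesis using j(1) by blast
    qed
  qed
qed

text \<open>The index sum is unchanged by sorting, so that the sorted product stays in the same
  layer of \<open>lev_step\<close>.\<close>

lemma gp_prod_sort:
  "gp_prod J \<in> L (length J) \<or> (\<exists>J' s. sorted_wrt (<) J' \<and> set J' \<subseteq> {..<n} \<and> length J' = length J \<and>
     sum_list J' = sum_list J \<and> gp_prod J - sc s * gp_prod J' \<in> L (length J))"
proof (induction J)
  case Nil
  have "gp_prod [] - sc 1 * gp_prod [] = 0" by simp
  then show ?case using LS(1) by (metis empty_subsetI list.set(1) sorted_wrt.simps(1))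
next
  case (Cons j J)
  from Cons show ?case
  proof (elim disjE exE conjE)
    assume "gp_prod J \<in> L (length J)"
    then show ?thesis using gp_L by simp
  next
    fix J' s assume J': "sorted_wrt (<) J'" "set J' \<subseteq> {..<n}" "length J' = length J"
      "sum_list J' = sum_list J" and s: "gp_prod J - sc s * gp_prod J' \<in> L (length J)"
    have 1: "gp_prod (j # J) - sc s * (gp j * gp_prod J') \<in> L (length (j # J))"
      using gp_L[OF s, of j] by (simp add: right_diff_distrib sc_left_commute)
    from gp_insort[OF J'(1,2), of j] show ?thesis
    proof (elim disjE conjE exE)
      assume "gp j * gp_prod J' \<in> L (Suc (length J'))"
      then have "sc s * (gp j * gp_prod J') \<in> L (length (j # J))" using J' LS(4) by simp
      from LS(2)[OF 1 this] have "gp_prod (j # J) \<in> L (length (j # J))"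
        by (simp only: diff_add_cancel)
      then show ?thesis by (rule disjI1)
    next
      fix s' assume j: "j < n" "j \<notin> set J'"
        and s': "gp j * gp_prod J' - sc s' * gp_prod (insort j J') \<in> L (Suc (length J'))"
      have "gp_prod (j # J) - sc (s * s') * gp_prod (insort j J')
        = (gp_prod (j # J) - sc s * (gp j * gp_prod J')) + sc s * (gp j * gp_prod J' - sc s' * gp_prod (insort j J'))"
        unfolding right_diff_distrib sc_mult mult.assoc by (simp only: diff_add_cancel add_diff_eq)
      also have "\<dots> \<in> L (length (j # J))"
        by (intro LS(2) 1 LS(4)) (use s' J' in simp)
      finally have "gp_prod (j # J) - sc (s * s') * gp_prod (insort j J') \<in> L (length (j # J))" .
      moreover have "sorted_wrt (<) (insort j J')"
        using J'(1) j(2) by (metis distinct_insort sorted_insort strict_sorted_iff)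
      moreover have "set (insort j J') \<subseteq> {..<n}" using J' j by (auto simp: set_insort_key)
      moreover have "length (insort j J') = length (j # J)" using J' by simp
      moreover have "sum_list (insort j J') = sum_list (j # J)"
        using J'(4) by (metis mset_insort sum_list.Cons sum_mset_sum_list mset.simps(2))
      ultimately show ?thesis by blast
    qed
  qed
qed

definition basis_vectors :: "uea set" where
  "basis_vectors = {es_prod \<mu> * (ee 0 ^ a * gp_prod J) | \<mu> a J.
     sorted_wrt (<) J \<and> set J \<subseteq> {..<n} \<and> a \<le> n - length J \<and> \<mu> \<in> box_lists a (n - length J - a)}"

lemma strict_length:
  assumes "sorted_wrt (<) J" "set J \<subseteq> {..<n}"
  shows "length J \<le> n"
proof -
  have "distinct J" using assms(1) by (simp add: strict_sorted_iff)
  then show ?thesis using card_mono[OF _ assms(2)] by (simp add: distinct_card)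
qed

text \<open>Let \<open>K\<close> consist of fewer odd letters and of larger index sums. Modulo
  \<open>K\<close> a sorted product of \<open>c\<close> letters with index sum \<open>D\<close> is a
  lowest weight vector of weight \<open>-(n - c)\<close>: \<open>ff\<close> drops odd letters,
  positive \<open>hh\<close> raise the index sum. \<open>R_subset\<close> then spans this
  layer.\<close>

lemma lev_step:
  assumes "lev (\<lambda>J. length J < c \<or> length J = c \<and> Suc D \<le> sum_list J) \<subseteq> uea.span (I \<union> basis_vectors)"
  shows "lev (\<lambda>J. length J < c \<or> length J = c \<and> D \<le> sum_list J) \<subseteq> uea.span (I \<union> basis_vectors)"
proof -
  let ?S = "uea.span (I \<union> basis_vectors)"
  define K where "K = lev (\<lambda>J. length J < c \<or> length J = c \<and> Suc D \<le> sum_list J)"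
  define T where "T = {J. sorted_wrt (<) J \<and> set J \<subseteq> {..<n} \<and> length J = c \<and> sum_list J = D}"
  have KsubS: "K \<subseteq> ?S" using assms by (simp add: K_def)
  have LK: "L c \<subseteq> K" unfolding K_def by (intro lev_mono) auto
  have IK: "I \<subseteq> K" by (auto simp: K_def intro: lev.base)
  have lw: "lowest_weight K (gp_prod J) (n - c) (n + 1)" if "J \<in> T" for J
  proof
    show "ev_stable K" unfolding K_def by (rule lev_stable)
    show "ff i * gp_prod J \<in> K" for i
      using ff_gp_prod[of i J] that LK by (auto simp: T_def)
    show "hh (Suc i) * gp_prod J \<in> K" for i
    proof -
      have "{gp_prod J' | J'. length J' = length J \<and> sum_list J' = sum_list J + Suc i} \<subseteq> K"
        using that by (auto simp: K_def T_def intro!: lev.gen)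
      then have "uea.span {gp_prod J' | J'. length J' = length J \<and> sum_list J' = sum_list J + Suc i} \<subseteq> K"
        by (rule uea.span_minimal) (simp add: K_def lev_subspace)
      then have "hh (Suc i) * gp_prod J - gp_prod J * hh (Suc i) \<in> K"
        using hh_gp_prod by blast
      moreover have "gp_prod J * hh (Suc i) \<in> K" using IK mult_I hh_I by blast
      ultimately have "(hh (Suc i) * gp_prod J - gp_prod J * hh (Suc i)) + gp_prod J * hh (Suc i) \<in> K"
        unfolding K_def by (rule LS(2))
      then show ?thesis by simp
    qed
    \<comment> \<open>Guarantees that \<open>n - c\<close> is not truncated.\<close>
    have "c \<le> n" using strict_length that by (auto simp: T_def)
    then have "hh 0 * gp_prod J + of_nat (n - c) * gp_prod J = gp_prod J * (hh 0 + of_nat n)"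
      using that by (simp add: T_def hh_0_gp_prod distrib_left left_diff_distrib mult_of_nat_commute)
    then show "hh 0 * gp_prod J + of_nat (n - c) * gp_prod J \<in> K"
      using IK mult_I hh_0_I by auto
    have "ee 0 ^ (n + 1) * gp_prod J = gp_prod J * ee 0 ^ (n + 1)"
      using ee_gp_prod by (metis power_commuting_commutes)
    then show "ee 0 ^ (n + 1) * gp_prod J \<in> K" using IK mult_I[OF ee_I] by auto
  qed
  define RR where "RR J = lowest_weight.R K (gp_prod J)" for J
  have RR: "ev_stable (RR J)" "gp_prod J \<in> RR J" "RR J \<subseteq> ?S" if "J \<in> T" for J
  proof -
    interpret lowest_weight K "gp_prod J" "n - c" "n + 1" by (rule lw[OF that])
    show "ev_stable (RR J)" unfolding RR_def by (rule R_ev_stable)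
    show "gp_prod J \<in> RR J" unfolding RR_def using R.power[of 0] by simp
    let ?C = "{es_prod \<mu> * (ee 0 ^ a * gp_prod J) | a \<mu>. a \<le> n - c \<and> \<mu> \<in> box_lists a (n - c - a)}"
    have "?C \<subseteq> basis_vectors"
      using that by (auto simp: T_def basis_vectors_def)
    also have "basis_vectors \<subseteq> ?S"
      by (rule order_trans[OF Un_upper2 uea.span_superset])
    finally have "K \<union> ?C \<subseteq> ?S" by (rule Un_least[OF KsubS])
    then have "uea.span (K \<union> ?C) \<subseteq> ?S"
      by (rule uea.span_minimal) simp
    then show "RR J \<subseteq> ?S" unfolding RR_def using R_subset by blast
  qed
  \<comment> \<open>After sorting, the products of this layer are multiples of those indexed by
    \<open>T\<close> modulo \<open>K\<close>, so \<open>K\<close> and the stable spaces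
    \<open>RR J\<close> exhaust it.\<close>
  let ?X = "uea.span (\<Union>(insert K (RR ` T)))"
  have X: "ev_stable ?X"
    using RR(1) lev_stable by (intro ev_stable_span_Union) (auto simp: K_def)
  have KX: "K \<subseteq> ?X" by (auto intro: uea.span_base)
  have "lev (\<lambda>J. length J < c \<or> length J = c \<and> D \<le> sum_list J) \<subseteq> ?X"
  proof (rule lev_least[OF X])
    show "I \<subseteq> ?X" using IK KX by blast
    fix J assume J: "length J < c \<or> length J = c \<and> D \<le> sum_list J"
    show "gp_prod J \<in> ?X"
    proof (cases "length J = c \<and> sum_list J = D")
      case False
      then have "gp_prod J \<in> K" using J unfolding K_def by (intro lev.gen) auto
      then show ?thesis using KX by blast
    next
      case True
      from gp_prod_sort[of J] show ?thesis
      proof (elim disjE exE conjE)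
        assume "gp_prod J \<in> L (length J)"
        then show ?thesis using LK KX True by blast
      next
        fix J' s assume *: "sorted_wrt (<) J'" "set J' \<subseteq> {..<n}" "length J' = length J"
          "sum_list J' = sum_list J" "gp_prod J - sc s * gp_prod J' \<in> L (length J)"
        then have "J' \<in> T" using True by (simp add: T_def)
        then have "gp_prod J' \<in> ?X" using RR(2) by (auto intro: uea.span_base)
        moreover have "gp_prod J - sc s * gp_prod J' \<in> ?X" using * LK KX True by blast
        ultimately have "(gp_prod J - sc s * gp_prod J') + sc s * gp_prod J' \<in> ?X"
          by (intro uea.span_add uea.span_scale)
        then show ?thesis by simp
      qed
    qed
  qed
  also have "?X \<subseteq> ?S" using KsubS RR(3) by (intro uea.span_minimal) auto
  finally show ?thesis .
qed

lemma L_subset_span: "L c \<subseteq> uea.span (I \<union> basis_vectors)"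
proof (induction c)
  case 0
  show ?case unfolding L_0 by (rule order_trans[OF Un_upper1 uea.span_superset])
next
  case (Suc c)
  let ?P = "\<lambda>D. lev (\<lambda>J. length J < c \<or> length J = c \<and> D \<le> sum_list J) \<subseteq> uea.span (I \<union> basis_vectors)"
  \<comment> \<open>Sorted products use indices below \<open>n\<close>, so an index sum above
    \<open>c * n\<close> is possible only with fewer odd letters. This starts the descent on
    \<open>D\<close>.\<close>
  have "gp_prod J \<in> L c" if J: "length J = c" "Suc (c * n) \<le> sum_list J" for J
    using gp_prod_sort[of J]
  proof (elim disjE exE conjE)
    fix J' s assume *: "set J' \<subseteq> {..<n}" "length J' = length J" "sum_list J' = sum_list J"
    have "sum_list J' \<le> sum_list (map (\<lambda>_. n) J')"
      using *(1) sum_list_mono[of J' "\<lambda>x. x" "\<lambda>_. n"] by force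
    then show ?thesis using * J by (simp add: sum_list_triv)
  qed (use J in simp)
  then have "lev (\<lambda>J. length J < c \<or> length J = c \<and> Suc (c * n) \<le> sum_list J) \<subseteq> L c"
    by (intro lev_least lev_stable) (auto intro: lev.base lev.gen)
  then have start: "?P (Suc (c * n))" using Suc by (rule order_trans)
  have "?P D \<Longrightarrow> ?P 0" for D
  proof (induction D)
    case (Suc D)
    from lev_step[OF Suc.prems] show ?case by (rule Suc.IH)
  qed
  from this[OF start] have "?P 0" .
  moreover have "L (Suc c) \<subseteq> lev (\<lambda>J. length J < c \<or> length J = c \<and> 0 \<le> sum_list J)"
    by (rule lev_mono) auto
  ultimately show ?case by blast
qed

lemma spanning: "x \<in> uea.span (I \<union> basis_vectors)"
  using L_exhaust L_subset_span by blast

end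

subsection \<open>Tensor products of evaluation modules\<close>

text \<open>\<open>rep y a b\<close> is the coefficient of basis vector \<open>a\<close> in the
  image of basis vector \<open>b\<close>. The basis is normalised by letting \<open>g^+\<close> send
  0 to 1 and 1 to 2; then \<open>e\<close>, its square, sends 0 to 2.\<close>

definition rep :: "osp \<Rightarrow> nat \<Rightarrow> nat \<Rightarrow> complex" where
  "rep y a b = (case y of
     osp_e \<Rightarrow> if a = 2 \<and> b = 0 then 1 else 0
   | osp_h \<Rightarrow> if a = 0 \<and> b = 0 then - 1 else if a = 2 \<and> b = 2 then 1 else 0
   | osp_f \<Rightarrow> if a = 0 \<and> b = 2 then 1 else 0
   | osp_gp \<Rightarrow> if a = 1 \<and> b = 0 \<or> a = 2 \<and> b = 1 then 1 else 0
   | osp_gm \<Rightarrow> if a = 0 \<and> b = 1 then - 1 else if a = 1 \<and> b = 2 then 1 else 0)"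

lemma rep_bracket:
  "(\<Sum>b<3. rep y a b * (\<Sum>c<3. rep y' b c * v c)) =
   koszul y y' * (\<Sum>b<3. rep y' a b * (\<Sum>c<3. rep y b c * v c)) +
   (\<Sum>u\<in>UNIV. superbracket y y' u * (\<Sum>c<3. rep u a c * v c))"
proof -
  have s: "(\<Sum>b<3. f b) = f 0 + f 1 + f (2 :: nat)" for f :: "nat \<Rightarrow> complex"
    by (simp add: eval_nat_numeral)
  consider "a = 0" | "a = 1" | "a = 2" | "a > 2" by linarith
  then show ?thesis
    unfolding UNIV_osp s
    by cases (cases y; cases y'; simp add: rep_def koszul_def term_of_def)+
qed

text \<open>The index of a basis vector modulo 2 is its parity, and a nonzero entry of
  \<open>rep y\<close> changes it by the parity of \<open>y\<close>. This yields the sign when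
  operators on different factors are exchanged.\<close>

lemma rep_parity: "rep y a b * (- 1) ^ (parity y' * b) = koszul y y' * ((- 1) ^ (parity y' * a) * rep y a b)"
  by (cases y; cases y') (auto simp: rep_def koszul_def)

text \<open>Lists over \<open>{0, 1, 2}\<close> index the basis of a tensor power of the three-dimensional module
  spanned by a lowest vector 0, the odd vector 1 and a highest vector 2; \<open>site j\<close> acts on the
  \<open>j\<close>-th factor, with the sign from passing the earlier factors.\<close>

fun site :: "nat \<Rightarrow> osp \<Rightarrow> (nat list \<Rightarrow> complex) \<Rightarrow> nat list \<Rightarrow> complex" where
  "site j y v [] = 0"
| "site 0 y v (a # x) = (\<Sum>b<3. rep y a b * v (b # x))"
| "site (Suc j) y v (a # x) = (- 1) ^ (parity y * a) * site j y (\<lambda>x. v (a # x)) x"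

lemma site_sum: "site j y (\<lambda>x. \<Sum>i\<in>A. c i * v i x) x = (\<Sum>i\<in>A. c i * site j y (v i) x)"
proof (induction x arbitrary: j v)
  case (Cons a x)
  show ?case
  proof (cases j)
    case 0
    have "(\<Sum>b<3. rep y a b * (\<Sum>i\<in>A. c i * v i (b # x))) = (\<Sum>i\<in>A. c i * (\<Sum>b<3. rep y a b * v i (b # x)))"
      unfolding sum_distrib_left by (subst sum.swap) (simp add: algebra_simps)
    then show ?thesis using 0 by simp
  next
    case (Suc k)
    then show ?thesis by (simp add: Cons sum_distrib_left algebra_simps)
  qed
qed simp

lemma site_scale: "site j y (\<lambda>x. c * v x) x = c * site j y v x"
  using site_sum[of j y "\<lambda>_. c" "\<lambda>_. v" "{()}" x] by simp

lemma site_add: "site j y (\<lambda>x. v x + w x) x = site j y v x + site j y w x"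
  using site_sum[of j y "\<lambda>_. 1" "\<lambda>i. if i then v else w" "UNIV :: bool set" x]
  by (simp add: UNIV_bool add.commute)

lemma site_commute: "j \<noteq> k \<Longrightarrow> site j y (site k y' v) x = koszul y y' * site k y' (site j y v) x"
proof (induction x arbitrary: j k v)
  case (Cons a x)
  have 0: "site 0 y (site (Suc k) y' v) (a # x) = koszul y y' * site (Suc k) y' (site 0 y v) (a # x)" for y y' k
  proof -
    have "site 0 y (site (Suc k) y' v) (a # x)
        = (\<Sum>b<3. (rep y a b * (- 1) ^ (parity y' * b)) * site k y' (\<lambda>x. v (b # x)) x)"
      by (simp add: mult.assoc)
    also have "\<dots> = koszul y y' * ((- 1) ^ (parity y' * a) * (\<Sum>b<3. rep y a b * site k y' (\<lambda>x. v (b # x)) x))"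
      unfolding rep_parity by (simp add: sum_distrib_left mult.assoc)
    finally show ?thesis by (simp add: site_sum)
  qed
  have kk: "koszul y y' * (koszul y' y * z) = z" for z
    by (cases y; cases y') (simp_all add: koszul_def)
  consider k' where "j = 0" "k = Suc k'" | j' where "k = 0" "j = Suc j'"
    | j' k' where "j = Suc j'" "k = Suc k'"
    using Cons.prems by (cases j; cases k) auto
  then show ?case
  proof cases
    case 1
    then show ?thesis using 0 by simp
  next
    case 2
    then show ?thesis using 0[of y' j' y] kk by simp
  next
    case 3
    then show ?thesis using Cons.IH[of j' k'] Cons.prems by (simp add: site_scale)
  qed
qed simp

lemma superbracket_parity:
  "superbracket y y' u * (- 1) ^ (parity u * a) =
   ((- 1) ^ (parity y * a) * (- 1) ^ (parity y' * a)) * superbracket y y' u"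
  by (cases y; cases y') (auto simp: term_of_def simp flip: power_add mult_2)

lemma site_bracket:
  "site j y (site j y' v) x = koszul y y' * site j y' (site j y v) x +
     (\<Sum>u\<in>UNIV. superbracket y y' u * site j u v x)"
proof (induction x arbitrary: j v)
  case (Cons a x)
  show ?case
  proof (cases j)
    case 0
    then show ?thesis using rep_bracket[of y a y' "\<lambda>c. v (c # x)"] by simp
  next
    case (Suc k)
    have "(\<Sum>u\<in>UNIV. superbracket y y' u * site (Suc k) u v (a # x))
      = (\<Sum>u\<in>UNIV. (superbracket y y' u * (- 1) ^ (parity u * a)) * site k u (\<lambda>x. v (a # x)) x)"
      by (simp add: mult.assoc)
    also have "\<dots> = ((- 1) ^ (parity y * a) * (- 1) ^ (parity y' * a)) *
        (\<Sum>u\<in>UNIV. superbracket y y' u * site k u (\<lambda>x. v (a # x)) x)"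
      unfolding superbracket_parity by (simp add: sum_distrib_left mult.assoc)
    finally show ?thesis unfolding Suc
      by (simp add: site_scale Cons.IH[of k "\<lambda>x. v (a # x)"] distrib_left mult.left_commute)
  qed
qed simp

text \<open>The letter \<open>y_i\<close> is evaluated at the point \<open>j + 1\<close> on the \<open>j\<close>-th factor; any choice of
  nonzero points with distinct squares would do.\<close>

definition model_act :: "nat \<Rightarrow> letter \<Rightarrow> (nat list \<Rightarrow> complex) \<Rightarrow> nat list \<Rightarrow> complex" where
  "model_act n l v x = (\<Sum>j<n. of_nat (Suc j) ^ snd l * site j (fst l) v x)"

lemma model_act_bracket:
  "model_act n k (model_act n l v) x = koszul (fst k) (fst l) * model_act n l (model_act n k v) x +
     (\<Sum>u\<in>UNIV. superbracket (fst k) (fst l) u * model_act n (u, snd k + snd l) v x)"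
proof -
  let ?z = "\<lambda>j. of_nat (Suc j) :: complex" and ?K = "koszul (fst k) (fst l)"
  let ?y = "fst k" and ?y' = "fst l"
  let ?S = "\<lambda>j. \<Sum>u\<in>UNIV. superbracket ?y ?y' u * site j u v x"
  have exp: "model_act n k (model_act n l v) x
      = (\<Sum>i<n. \<Sum>j<n. ?z i ^ snd k * ?z j ^ snd l * site i (fst k) (site j (fst l) v) x)" for k l
    unfolding model_act_def[abs_def] site_sum by (simp add: sum_distrib_left mult.assoc)
  have "model_act n k (model_act n l v) x = (\<Sum>i<n. \<Sum>j<n. ?z i ^ snd k * ?z j ^ snd l *
      (?K * site j ?y' (site i ?y v) x + (if i = j then ?S i else 0)))"
  proof -
    have "site i ?y (site j ?y' v) x = ?K * site j ?y' (site i ?y v) x + (if i = j then ?S i else 0)" for i j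
    proof (cases "i = j")
      case True
      then show ?thesis using site_bracket[of i ?y ?y' v x] by simp
    qed (simp add: site_commute[of i j ?y ?y' v x])
    then show ?thesis unfolding exp by (simp only:)
  qed
  also have "\<dots> = ?K * (\<Sum>i<n. \<Sum>j<n. ?z i ^ snd k * ?z j ^ snd l * site j ?y' (site i ?y v) x)
      + (\<Sum>i<n. ?z i ^ (snd k + snd l) * ?S i)"
  proof -
    have "?z i ^ snd k * ?z j ^ snd l * (?K * site j ?y' (site i ?y v) x + (if i = j then ?S i else 0))
        = ?K * (?z i ^ snd k * ?z j ^ snd l * site j ?y' (site i ?y v) x)
          + (if i = j then ?z i ^ (snd k + snd l) * ?S i else 0)" for i j
      by (simp only: distrib_left power_add mult.left_commute[of ?K] mult.assoc) auto
    then show ?thesis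
      by (simp only: sum.distrib sum_distrib_left[symmetric] sum.delta finite_lessThan lessThan_iff)
        (auto intro: sum.cong)
  qed
  also have "(\<Sum>i<n. \<Sum>j<n. ?z i ^ snd k * ?z j ^ snd l * site j ?y' (site i ?y v) x)
      = model_act n l (model_act n k v) x"
    unfolding exp by (subst sum.swap) (simp add: algebra_simps)
  also have "(\<Sum>i<n. ?z i ^ (snd k + snd l) * ?S i)
      = (\<Sum>u\<in>UNIV. superbracket ?y ?y' u * model_act n (u, snd k + snd l) v x)"
    unfolding model_act_def sum_distrib_left by (subst sum.swap) (simp add: algebra_simps)
  finally show ?thesis .
qed

section \<open>Evaluation of the free algebra on the vacuum, degree by degree\<close>

definition cs :: "complex \<Rightarrow> (nat list \<Rightarrow> complex) \<Rightarrow> nat list \<Rightarrow> complex" where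
  "cs c f = (\<lambda>x. c * f x)"

interpretation fv: vector_space cs
  by unfold_locales (auto simp: cs_def fun_eq_iff algebra_simps)

lemma cs_apply [simp]: "cs c f x = c * f x" by (simp add: cs_def)

lemma sum_fun_apply: "(sum f A) x = (\<Sum>i\<in>A. f i x)" for f :: "'i \<Rightarrow> 'b \<Rightarrow> complex"
  by (induction A rule: infinite_finite_induct) auto

lemma model_act_add: "model_act n l (v + w) = model_act n l v + model_act n l w"
  and model_act_cs: "model_act n l (cs c v) = cs c (model_act n l v)"
  by (auto simp: fun_eq_iff model_act_def cs_def plus_fun_def site_add site_scale sum.distrib distrib_left
      sum_distrib_left algebra_simps)

lemma model_act_0: "model_act n l 0 = 0"
  using model_act_cs[of n l 0 0] by (simp add: cs_def zero_fun_def)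

definition word_act :: "nat \<Rightarrow> letter list \<Rightarrow> (nat list \<Rightarrow> complex) \<Rightarrow> nat list \<Rightarrow> complex" where
  "word_act n ls v = foldr (model_act n) ls v"

lemma word_act_simps [simp]: "word_act n [] v = v" "word_act n (l # ls) v = model_act n l (word_act n ls v)"
  "word_act n (ls @ ks) v = word_act n ls (word_act n ks v)"
  by (simp_all add: word_act_def)

lemma word_act_add: "word_act n ls (v + w) = word_act n ls v + word_act n ls w"
  and word_act_cs: "word_act n ls (cs c v) = cs c (word_act n ls v)"
  and word_act_0: "word_act n ls 0 = 0"
  by (induction ls) (simp_all add: model_act_add model_act_cs model_act_0)

definition delta :: "nat list \<Rightarrow> nat list \<Rightarrow> complex" where
  "delta x0 = (\<lambda>x. if x = x0 then 1 else 0)"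

definition vac :: "nat \<Rightarrow> nat list \<Rightarrow> complex" where
  "vac n = delta (replicate n 0)"

text \<open>This applies only the part of \<open>p\<close> of t-degree \<open>s\<close> to the
  vacuum. The tensor product carries just the filtration \<open>filt\<close> by degree, so symbols
  have to be extracted before the evaluation.\<close>

definition ev :: "nat \<Rightarrow> int \<Rightarrow> tensor \<Rightarrow> nat list \<Rightarrow> complex" where
  "ev n s p = (\<Sum>w\<in>Poly_Mapping.keys p. if t_degree w = s
     then cs (Poly_Mapping.lookup p w) (word_act n (letters w) (vac n)) else 0)"

lemma ev_superset:
  assumes "finite A" "Poly_Mapping.keys p \<subseteq> A"
  shows "ev n s p = (\<Sum>w\<in>A. if t_degree w = s
     then cs (Poly_Mapping.lookup p w) (word_act n (letters w) (vac n)) else 0)"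
  unfolding ev_def using assms
  by (intro sum.mono_neutral_left) (auto simp: in_keys_iff cs_def zero_fun_def)

lemma ev_add: "ev n s (p + q) = ev n s p + ev n s q"
proof -
  let ?A = "Poly_Mapping.keys p \<union> Poly_Mapping.keys q"
  have "finite ?A" "Poly_Mapping.keys (p + q) \<subseteq> ?A" "Poly_Mapping.keys p \<subseteq> ?A" "Poly_Mapping.keys q \<subseteq> ?A"
    by (auto simp: keys_add)
  note e = this(2-4)[THEN ev_superset[OF this(1)]]
  show ?thesis unfolding e sum.distrib[symmetric]
    by (intro sum.cong refl) (simp add: lookup_add fv.scale_left_distrib)
qed

lemma ev_single: "ev n s (Poly_Mapping.single w c) =
    (if t_degree w = s then cs c (word_act n (letters w) (vac n)) else 0)"
  by (cases "c = 0") (auto simp: ev_def lookup_single)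

lemma ev_0 [simp]: "ev n s 0 = 0"
  by (simp add: ev_def)

lemma t_degree_plus: "t_degree (v + w) = t_degree v + t_degree w"
  by (simp add: t_degree_def)

lemma ev_single_mult:
  "ev n s (Poly_Mapping.single v c * q) = cs c (word_act n (letters v) (ev n (s - t_degree v) q))"
proof (induction q rule: tensor_induct)
  case (single w d)
  show ?case by (auto simp: mult_single ev_single t_degree_plus word_act_cs word_act_0)
next
  case (add p q)
  then show ?case by (simp only: distrib_left ev_add word_act_add fv.scale_right_distrib)
qed (simp only: mult_zero_right ev_0 word_act_0 fv.scale_zero_right)

lemma ev_scal_mult: "ev n s (scal c * q) = cs c (ev n s q)"
  by (simp add: scal_def ev_single_mult t_degree_def)

lemma ev_gen_mult: "ev n s (gen l * q) = model_act n l (ev n (s - int (snd l)) q)"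
  by (simp add: gen_def ev_single_mult t_degree_def)

lemma ev_gen: "ev n s (gen l) = (if s = int (snd l) then model_act n l (vac n) else 0)"
  by (simp add: gen_def ev_single t_degree_def)

lemma ev_diff: "ev n s (p - q) = ev n s p - ev n s q"
  using ev_add[of n s "p - q" q] by simp

lemma ev_sum: "ev n s (sum f A) = (\<Sum>i\<in>A. ev n s (f i))"
  by (induction A rule: infinite_finite_induct) (auto simp: ev_add)

lemma ev_homogeneous:
  assumes "\<forall>w\<in>Poly_Mapping.keys p. t_degree w = d" "s \<noteq> d"
  shows "ev n s p = 0"
  using assms by (auto simp: ev_def intro!: sum.neutral)

lemma ev_bracket: "ev n s (bracket_rel k l * q) = 0"
proof -
  let ?u = "ev n (s - int (snd k) - int (snd l)) q"
  have "ev n s (bracket_rel k l * q) = model_act n k (model_act n l ?u)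
      - cs (koszul (fst k) (fst l)) (model_act n l (model_act n k ?u))
      - (\<Sum>x\<in>UNIV. cs (superbracket (fst k) (fst l) x) (model_act n (x, snd k + snd l) ?u))"
    by (simp only: bracket_rel_def left_diff_distrib distrib_right ev_add sum_distrib_right mult.assoc ev_diff ev_sum ev_gen_mult
        ev_scal_mult diff_diff_eq snd_conv of_nat_add add.commute[of "int (snd l)"])
  also have "\<dots> = 0"
    by (rule ext) (simp add: model_act_bracket[of n k l] sum_fun_apply)
  finally show ?thesis .
qed

declare model_act_0[unfolded zero_fun_def, simp] word_act_0[unfolded zero_fun_def, simp]

definition filt :: "nat \<Rightarrow> int \<Rightarrow> (nat list \<Rightarrow> complex) set" where
  "filt n s = fv.span {word_act n ls (vac n) | ls. set ls \<subseteq> twisted \<and> t_degree (Word ls) \<le> s}"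

lemma model_act_vac:
  "model_act n (osp_f, i) (vac n) = 0" "model_act n (osp_gm, i) (vac n) = 0"
  "model_act n (osp_h, i) (vac n) = cs (- (\<Sum>j<n. of_nat (Suc j) ^ i)) (vac n)"
proof -
  have *: "site j y (cs c (delta (replicate n 0))) x = (if y = osp_h then - c * delta (replicate n 0) x else 0)"
    if "y \<in> {osp_f, osp_gm, osp_h}" "j < n" for j y x c
    using that(2)
  proof (induction n arbitrary: j x)
    case (Suc n)
    show ?case
    proof (cases x)
      case (Cons a x')
      show ?thesis
      proof (cases j)
        case 0
        then show ?thesis using that(1) Cons
          by (auto simp: eval_nat_numeral rep_def delta_def)
      next
        case (Suc k)
        have "(\<lambda>x'. cs c (delta (replicate (Suc n) 0)) (a # x')) = (if a = 0 then cs c (delta (replicate n 0)) else cs 0 (delta (replicate n 0)))"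
          by (auto simp: delta_def fun_eq_iff)
        then have "site j y (cs c (delta (replicate (Suc n) 0))) x
          = (- 1) ^ (parity y * a) * site k y (if a = 0 then cs c (delta (replicate n 0)) else cs 0 (delta (replicate n 0))) x'"
          using Suc Cons by simp
        moreover have "site k y (cs 0 (delta (replicate n 0))) x' = 0"
          using site_scale[of k y 0 "delta (replicate n 0)" x'] by (simp add: cs_def)
        ultimately show ?thesis using Suc.IH[of k x'] Suc.prems Suc Cons
          by (auto simp: delta_def)
      qed
    qed (simp add: delta_def)
  qed simp
  have **: "site j y (vac n) x = (if y = osp_h then - vac n x else 0)"
    if "y \<in> {osp_f, osp_gm, osp_h}" "j < n" for j y x
    using *[OF that, of 1 x] by (simp add: vac_def cs_def)
  show "model_act n (osp_f, i) (vac n) = 0" "model_act n (osp_gm, i) (vac n) = 0"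
    "model_act n (osp_h, i) (vac n) = cs (- (\<Sum>j<n. of_nat (Suc j) ^ i)) (vac n)"
    by (auto simp: fun_eq_iff model_act_def ** sum_negf sum_distrib_right)
qed

lemma model_act_e_support:
  assumes "\<And>x. v x \<noteq> 0 \<Longrightarrow> set x \<subseteq> {0, 1, 2} \<and> length x = n \<and> sum_list x = s"
  shows "model_act n (osp_e, i) v x \<noteq> 0 \<Longrightarrow> set x \<subseteq> {0, 1, 2} \<and> length x = n \<and> sum_list x = s + 2"
proof -
  assume "model_act n (osp_e, i) v x \<noteq> 0"
  then obtain j where "site j osp_e v x \<noteq> 0"
    unfolding model_act_def by (metis (no_types, lifting) fst_conv mult_zero_right sum.neutral)
  then show ?thesis using assms
  proof (induction x arbitrary: j v n s)
    case (Cons a x)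
    show ?case
    proof (cases j)
      case 0
      then have "a = 2" "v (0 # x) \<noteq> 0"
        using Cons.prems(1) by (auto simp: eval_nat_numeral rep_def split: if_splits)
      then show ?thesis using Cons.prems(2)[of "0 # x"] by auto
    next
      case (Suc k)
      then have k: "site k osp_e (\<lambda>x. v (a # x)) x \<noteq> 0" using Cons.prems(1) by simp
      show ?thesis
      proof (cases "\<exists>x. v (a # x) \<noteq> 0")
        case True
        then have a: "a \<in> {0, 1, 2}" "n > 0" "a \<le> s" using Cons.prems(2) by force+
        have "set x \<subseteq> {0, 1, 2} \<and> length x = n - 1 \<and> sum_list x = s - a + 2"
          by (rule Cons.IH[OF k]) (use Cons.prems(2) in force)
        then show ?thesis using a by auto
      next
        case False
        then have "(\<lambda>x. v (a # x)) = (\<lambda>x. 0 * v x)" by auto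
        then show ?thesis using k site_scale[of k osp_e 0 v x] by (metis mult_zero_left)
      qed
    qed
  qed simp
qed

text \<open>Each \<open>osp_e\<close> raises the sum of the list by 2, while \<open>n\<close>
  entries from \<open>{0, 1, 2}\<close> have sum at most \<open>2 * n\<close>.\<close>

lemma model_e_nilpotent: "word_act n (replicate (n + 1) (osp_e, 0)) (vac n) = 0"
proof -
  have s: "word_act n (replicate k (osp_e, 0)) (vac n) x \<noteq> 0 \<Longrightarrow>
      set x \<subseteq> {0, 1, 2} \<and> length x = n \<and> sum_list x = 2 * k" for k x
  proof (induction k arbitrary: x)
    case 0
    then show ?case by (auto simp: vac_def delta_def split: if_splits)
  next
    case (Suc k)
    then show ?case using model_act_e_support[of "word_act n (replicate k (osp_e, 0)) (vac n)" n "2 * k" 0 x] by simp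
  qed
  have "sum_list x \<le> 2 * length x" if "set x \<subseteq> {0, 1, 2}" for x :: "nat list"
    using that by (induction x) auto
  then have "word_act n (replicate (n + 1) (osp_e, 0)) (vac n) x = 0" for x
    using s[of "n + 1" x] by fastforce
  then show ?thesis by auto
qed

lemma ev_gen_power: "ev n s (gen l ^ k) = (if s = int k * int (snd l) then word_act n (replicate k l) (vac n) else 0)"
proof (induction k arbitrary: s)
  case 0
  show ?case using ev_single[of n s 0 1] by (simp add: t_degree_def)
next
  case (Suc k)
  then show ?case by (auto simp: ev_gen_mult model_act_0 algebra_simps)
qed

lemma ev_weyl_rels:
  assumes "r \<in> weyl_rels n"
  shows "ev n s r = 0 \<or> (s > 0 \<and> (\<exists>c. ev n s r = cs c (vac n)))"
proof -
  consider i where "r = gen (osp_f, 2 * i)" | i where "r = gen (osp_gm, 2 * i + 1)" | i where "r = gen (osp_h, 2 * i + 2)"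
    | "r = gen (osp_h, 0) + scal (of_nat n)" | "r = gen (osp_e, 0) ^ (n + 1)"
    using assms by (auto simp: weyl_rels_def)
  then show ?thesis
  proof cases
    case 4
    have "model_act n (osp_h, 0) (vac n) + cs (of_nat n) (vac n) = 0"
      unfolding model_act_vac by (auto simp: fun_eq_iff)
    moreover have "ev n s (scal (of_nat n)) = (if s = 0 then cs (of_nat n) (vac n) else 0)"
      unfolding scal_def ev_single by (simp add: t_degree_def)
    ultimately show ?thesis unfolding 4 ev_add ev_gen by simp
  next
    case (3 i)
    show ?thesis
    proof (cases "s = int (2 * i + 2)")
      case True
      have "ev n s r = cs (- (\<Sum>j<n. of_nat (Suc j) ^ (2 * i + 2))) (vac n)"
        unfolding 3 ev_gen model_act_vac using True by simp
      moreover have "s > 0" using True by simp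
      ultimately show ?thesis by blast
    qed (simp add: 3 ev_gen)
  next
    case 5
    show ?thesis unfolding 5 ev_gen_power model_e_nilpotent if_cancel by (rule disjI1) (rule refl)
  qed (auto simp: ev_gen model_act_vac)
qed

lemma ev_in_filt:
  assumes "p \<in> tensors" shows "ev n s p \<in> filt n s"
  using assms
proof (induction rule: tensors_induct)
  case (single w c)
  then have "word_act n (letters w) (vac n) \<in> filt n s" if "t_degree w = s"
    unfolding filt_def using that by (intro fv.span_base) (auto intro!: exI[of _ "letters w"])
  then show ?case unfolding ev_single by (auto simp only: filt_def intro: fv.span_scale fv.span_zero split: if_split)
next
  case (add p q)
  then show ?case unfolding ev_add filt_def by (intro fv.span_add)
qed (simp only: ev_0 filt_def fv.span_zero)

text \<open>In the tensor product \<open>h_{2i}\<close> with \<open>i > 0\<close> acts on the vacuum by a scalar instead of 0;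
  since it has positive degree, the relations of the Weyl module hold up to lower filtration.\<close>

lemma ev_weyl_ideal:
  assumes "p \<in> weyl_ideal n" shows "ev n s p \<in> filt n (s - 1)"
  using assms unfolding weyl_ideal_def
proof induction
  case (mult p r)
  from mult(1) show ?case
  proof (induction rule: tensors_induct)
    case (single w c)
    have "word_act n (letters w) (ev n (s - t_degree w) r) \<in> filt n (s - 1)"
    proof (cases "ev n (s - t_degree w) r = 0")
      case True
      then show ?thesis unfolding filt_def by (simp only: word_act_0 fv.span_zero)
    next
      case False
      moreover have "r \<notin> enveloping_rels"
        using False ev_bracket by (auto simp: enveloping_rels_def)
      ultimately obtain d where "s - t_degree w > 0" "ev n (s - t_degree w) r = cs d (vac n)"
        using mult(2) ev_weyl_rels by blast
      moreover from this have "word_act n (letters w) (vac n) \<in> filt n (s - 1)"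
        unfolding filt_def using single by (intro fv.span_base) (auto intro!: exI[of _ "letters w"])
      ultimately show ?thesis by (simp only: word_act_cs) (simp only: filt_def fv.span_scale)
    qed
    then show ?case unfolding ev_single_mult filt_def by (rule fv.span_scale)
  next
    case (add p q)
    then show ?case unfolding distrib_right ev_add filt_def by (intro fv.span_add)
  qed (simp only: mult_zero_left ev_0 filt_def fv.span_zero)
next
  case (add p q)
  then show ?case unfolding ev_add filt_def by (intro fv.span_add)
qed (simp only: ev_0 filt_def fv.span_zero)

subsection \<open>Cyclicity of the tensor product\<close>

definition cyc :: "nat \<Rightarrow> (nat list \<Rightarrow> complex) set" where
  "cyc n = fv.span {word_act n ls (vac n) | ls. set ls \<subseteq> twisted}"

lemma model_act_cyc: "v \<in> cyc n \<Longrightarrow> l \<in> twisted \<Longrightarrow> model_act n l v \<in> cyc n"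
  unfolding cyc_def
proof (induction rule: fv.span_induct_alt)
  case base
  then show ?case by (simp only: model_act_0 fv.span_zero)
next
  case (step c x y)
  then obtain ls where ls: "x = word_act n ls (vac n)" "set ls \<subseteq> twisted" by auto
  then have "model_act n l x \<in> fv.span {word_act n ls (vac n) | ls. set ls \<subseteq> twisted}"
    using step.prems by (intro fv.span_base) (auto intro!: exI[of _ "l # ls"])
  then show ?case unfolding model_act_add model_act_cs
    by (rule fv.span_add[OF fv.span_scale step.IH[OF step.prems]])
qed

text \<open>Lagrange interpolation at the squares of the points. The parity \<open>r\<close> of a
  letter contributes the factor \<open>z j ^ r\<close>, which is divided out. Thus suitable
  combinations of letters act on the \<open>j\<close>-th factor alone.\<close>

lemma interpolation:
  assumes "j < n"
  shows "\<exists>d c. \<forall>k<n. (\<Sum>i<d. c i * of_nat (Suc k) ^ (2 * i + r)) = (if k = j then 1 else 0 :: complex)"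
proof -
  define z where "z k = (of_nat (Suc k) :: complex)" for k
  define P where "P = (\<Prod>k\<in>{..<n} - {j}. [: - (z k ^ 2), 1 :])"
  have P: "poly P x = (\<Prod>k\<in>{..<n} - {j}. x - z k ^ 2)" for x
    by (simp add: P_def poly_prod)
  have inj: "z k ^ 2 = z j ^ 2 \<longleftrightarrow> k = j" for k
  proof -
    have "z k ^ 2 = of_nat ((Suc k)\<^sup>2)" for k by (simp only: z_def of_nat_power)
    then show ?thesis by (simp only: of_nat_eq_iff power2_eq_iff_nonneg) auto
  qed
  have nz: "poly P (z j ^ 2) \<noteq> 0" by (auto simp: P inj[symmetric])
  have zj: "z j ^ r \<noteq> 0" by (simp add: z_def del: of_nat_Suc)
  let ?c = "\<lambda>i. coeff P i / (poly P (z j ^ 2) * z j ^ r)"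
  have "(\<Sum>i<Suc (degree P). ?c i * z k ^ (2 * i + r)) = poly P (z k ^ 2) * z k ^ r / (poly P (z j ^ 2) * z j ^ r)" for k
    by (simp add: poly_altdef lessThan_Suc_atMost sum_distrib_right sum_divide_distrib power_add power_mult mult.assoc
        del: sum.lessThan_Suc)
  moreover have "poly P (z k ^ 2) = 0" if "k < n" "k \<noteq> j" for k
    using that by (auto simp: P intro!: prod_zero)
  ultimately show ?thesis
    using nz zj by (intro exI[of _ "Suc (degree P)"] exI[of _ ?c]) (auto simp: z_def)
qed

lemma site_cyc:
  assumes "j < n" "v \<in> cyc n"
  shows "site j y v \<in> cyc n"
proof -
  define r where "r = parity y"
  obtain d c where dc: "\<forall>k<n. (\<Sum>i<d. c i * of_nat (Suc k) ^ (2 * i + r)) = (if k = j then 1 else 0 :: complex)"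
    using interpolation[OF assms(1)] by blast
  have "(\<Sum>i<d. cs (c i) (model_act n (y, 2 * i + r) v)) x = site j y v x" for x
  proof -
    have "(\<Sum>i<d. cs (c i) (model_act n (y, 2 * i + r) v)) x
        = (\<Sum>k<n. (\<Sum>i<d. c i * of_nat (Suc k) ^ (2 * i + r)) * site k y v x)"
      unfolding sum_fun_apply cs_apply model_act_def sum_distrib_left sum_distrib_right fst_conv snd_conv
      by (subst sum.swap) (simp only: mult.assoc)
    also have "\<dots> = (\<Sum>k<n. if k = j then site k y v x else 0)"
      by (intro sum.cong refl) (simp only: dc lessThan_iff, simp)
    finally show ?thesis using assms(1) by simp
  qed
  then have "site j y v = (\<Sum>i<d. cs (c i) (model_act n (y, 2 * i + r) v))" by auto
  also have "\<dots> \<in> cyc n"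
  proof -
    have "(y, 2 * i + r) \<in> twisted" for i
      unfolding r_def twisted_def by (cases y) auto
    then show ?thesis using model_act_cyc[OF assms(2)]
      unfolding cyc_def by (intro fv.span_sum fv.span_scale) auto
  qed
  finally show ?thesis .
qed

lemma site_delta:
  assumes "(y, b) \<in> {(osp_gp, 1), (osp_e, 2)}"
  shows "\<exists>s. s \<noteq> 0 \<and> site (length u) y (delta (u @ 0 # t)) = cs s (delta (u @ b # t))"
proof (induction u)
  case Nil
  have "site 0 y (delta (0 # t)) x = delta (b # t) x" for x
    using assms by (cases x) (auto simp: delta_def rep_def eval_nat_numeral)
  then have "site 0 y (delta (0 # t)) = cs 1 (delta (b # t))" by auto
  then show ?case by (metis append_Nil list.size(3) one_neq_zero)
next
  case (Cons a u)
  then obtain s where s: "s \<noteq> 0" "site (length u) y (delta (u @ 0 # t)) = cs s (delta (u @ b # t))" by blast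
  have "site (Suc (length u)) y (delta (a # u @ 0 # t)) x
      = cs ((- 1) ^ (parity y * a) * s) (delta (a # u @ b # t)) x" for x
  proof (cases x)
    case (Cons a' x')
    show ?thesis
    proof (cases "a' = a")
      case True
      then have "(\<lambda>x. delta (a # u @ 0 # t) (a' # x)) = delta (u @ 0 # t)" by (auto simp: delta_def)
      then show ?thesis using s(2) True Cons by (simp add: delta_def)
    next
      case False
      then have "(\<lambda>x. delta (a # u @ 0 # t) (a' # x)) = (\<lambda>x. 0 * delta [] x)" by (auto simp: delta_def)
      then show ?thesis using False Cons site_scale[of "length u" y 0 "delta []" x']
        by (simp add: delta_def)
    qed
  qed (simp add: delta_def)
  then have "site (length (a # u)) y (delta ((a # u) @ 0 # t)) = cs ((- 1) ^ (parity y * a) * s) (delta ((a # u) @ b # t))"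
    by (simp only: fun_eq_iff length_Cons append_Cons simp_thms)
  moreover have "(- 1) ^ (parity y * a) * s \<noteq> 0" using s(1) by simp
  ultimately show ?case by blast
qed

text \<open>The zeros of the vacuum are replaced from left to right: acting at position
  \<open>length u\<close>, \<open>osp_gp\<close> makes a 1 and \<open>osp_e\<close> makes a 2, each
  up to a nonzero scalar.\<close>

lemma delta_cyc: "set u \<subseteq> {0, 1, 2} \<Longrightarrow> delta (u @ replicate k 0) \<in> cyc (length u + k)"
proof (induction u arbitrary: k rule: rev_induct)
  case Nil
  have "word_act k [] (vac k) \<in> cyc k"
    unfolding cyc_def by (intro fv.span_base) (auto intro!: exI[of _ "[]"])
  then show ?case by (simp add: vac_def)
next
  case (snoc a u)
  have IH: "delta (u @ 0 # replicate k 0) \<in> cyc (length u + Suc k)"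
    using snoc.IH[of "Suc k"] snoc.prems by simp
  consider "a = 0" | "a = 1" | "a = 2" using snoc.prems by auto
  then have "\<exists>s. s \<noteq> 0 \<and> cs s (delta (u @ a # replicate k 0)) \<in> cyc (length u + Suc k)"
  proof cases
    case 1
    then show ?thesis using IH by (metis fv.scale_one one_neq_zero)
  next
    case 2
    then show ?thesis using site_cyc[OF _ IH, of "length u" osp_gp] site_delta[of osp_gp 1 u "replicate k 0"]
      by (metis add_Suc_right insertI1 less_add_Suc1)
  next
    case 3
    then show ?thesis using site_cyc[OF _ IH, of "length u" osp_e] site_delta[of osp_e 2 u "replicate k 0"]
      by (metis add_Suc_right insertCI less_add_Suc1)
  qed
  then obtain s where s: "s \<noteq> 0" "cs s (delta (u @ a # replicate k 0)) \<in> cyc (length u + Suc k)" by blast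
  from s(2) have "cs (inverse s) (cs s (delta (u @ a # replicate k 0))) \<in> cyc (length u + Suc k)"
    unfolding cyc_def by (rule fv.span_scale)
  then have "cs 1 (delta (u @ a # replicate k 0)) \<in> cyc (length u + Suc k)"
    unfolding fv.scale_scale left_inverse[OF s(1)] .
  then show ?case unfolding fv.scale_one by simp
qed

definition model_basis :: "nat \<Rightarrow> (nat list \<Rightarrow> complex) set" where
  "model_basis n = delta ` {x. set x \<subseteq> {0, 1, 2} \<and> length x = n}"

lemma model_basis_cyc: "model_basis n \<subseteq> cyc n"
  using delta_cyc[of _ 0] by (auto simp: model_basis_def)

lemma inj_delta: "inj delta"
proof (rule injI)
  fix x y assume "delta x = delta y"
  then have "delta x x = delta y x" by simp
  then show "x = y" by (simp add: delta_def split: if_splits)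
qed

lemma card_model_basis: "card (model_basis n) = 3 ^ n" and finite_model_basis: "finite (model_basis n)"
proof -
  have "card {x :: nat list. set x \<subseteq> {0, 1, 2} \<and> length x = n} = 3 ^ n"
    using card_lists_length_eq[of "{0, 1, 2 :: nat}" n] by (simp add: numeral_3_eq_3)
  then show "card (model_basis n) = 3 ^ n"
    unfolding model_basis_def by (subst card_image[OF inj_on_subset[OF inj_delta subset_UNIV]])
  show "finite (model_basis n)"
    unfolding model_basis_def using finite_lists_length_eq[of "{0, 1, 2 :: nat}" n] by simp
qed

lemma independent_model_basis: "fv.independent (model_basis n)"
  unfolding fv.dependent_explicit
proof safe
  fix t u v assume t: "finite t" "t \<subseteq> model_basis n" and s: "(\<Sum>v\<in>t. cs (u v) v) = 0" and v: "v \<in> t" "u v \<noteq> 0"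
  obtain x where x: "v = delta x" using t v by (auto simp: model_basis_def)
  have "(\<Sum>v\<in>t. u v * v x) = 0"
    using fun_cong[OF s, of x] by (simp add: sum_fun_apply)
  also have "(\<Sum>v\<in>t. u v * v x) = (\<Sum>w\<in>t. if w = v then u v else 0)"
  proof (intro sum.cong refl)
    fix w assume "w \<in> t"
    then obtain y where "w = delta y" using t by (auto simp: model_basis_def)
    then show "u w * w x = (if w = v then u v else 0)"
      using inj_delta by (auto simp: x inj_eq) (auto simp: delta_def)
  qed
  finally show False using v t by simp
qed

section \<open>Independence of a spanning family from its leading parts\<close>

lemma fv_span_image:
  assumes "finite A" "x \<in> fv.span (f ` A)"
  shows "\<exists>c. x = (\<Sum>i\<in>A. cs (c i) (f i))"
  using assms(2)
proof (induction rule: fv.span_induct_alt)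
  case base
  have "(0 :: nat list \<Rightarrow> complex) = (\<Sum>i\<in>A. cs 0 (f i))" by (simp only: fv.scale_zero_left sum.neutral_const)
  then show ?case by (rule exI[of _ "\<lambda>_. 0"])
next
  case (step e u y)
  then obtain c k where c: "y = (\<Sum>i\<in>A. cs (c i) (f i))" and k: "k \<in> A" "u = f k" by blast
  have "cs e u = (\<Sum>i\<in>A. cs (if i = k then e else 0) (f i))"
  proof -
    have "(\<Sum>i\<in>A. cs (if i = k then e else 0) (f i)) = (\<Sum>i\<in>A. if i = k then cs e (f i) else 0)"
      by (intro sum.cong refl) (simp only: fv.scale_zero_left if_distrib[of "\<lambda>x. cs x _"])
    then show ?thesis using k assms(1) by (simp only: sum.delta if_True)
  qed
  then have "cs e u + y = (\<Sum>i\<in>A. cs ((if i = k then e else 0) + c i) (f i))"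
    by (simp only: c fv.scale_left_distrib sum.distrib)
  then show ?case by (rule exI[of _ "\<lambda>i. (if i = k then e else 0) + c i"])
qed

text \<open>The argument is pure counting: at most \<open>3^n\<close> homogeneous elements that span
  the Weyl module have leading parts that span a space of dimension \<open>3^n\<close>. The nature
  of the index set does not enter.\<close>

locale spanning_family =
  fixes n :: nat and Idx :: "'i set" and b :: "'i \<Rightarrow> tensor" and d :: "'i \<Rightarrow> int"
  assumes fin: "finite Idx" and card_Idx: "card Idx \<le> 3 ^ n"
    and b_tensors: "\<And>i. i \<in> Idx \<Longrightarrow> b i \<in> tensors"
    and b_homogeneous: "\<And>i w. i \<in> Idx \<Longrightarrow> w \<in> Poly_Mapping.keys (b i) \<Longrightarrow> t_degree w = d i"
    and b_spanning: "\<And>p. p \<in> tensors \<Longrightarrow> \<exists>c. p - (\<Sum>i\<in>Idx. scal (c i) * b i) \<in> weyl_ideal n"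
begin

definition leading_part :: "'i \<Rightarrow> nat list \<Rightarrow> complex" where "leading_part i = ev n (d i) (b i)"

lemma ev_comb: "ev n s (\<Sum>i\<in>Idx. scal (c i) * b i) = (\<Sum>i | i \<in> Idx \<and> d i = s. cs (c i) (leading_part i))"
proof -
  have "ev n s (scal (c i) * b i) = (if d i = s then cs (c i) (leading_part i) else 0)" if "i \<in> Idx" for i
  proof (cases "d i = s")
    case False
    then have "ev n s (b i) = 0"
      using ev_homogeneous[of "b i" "d i" s n] b_homogeneous[OF that] by blast
    then show ?thesis using False by (simp only: ev_scal_mult fv.scale_zero_right if_False)
  next
    case True
    show ?thesis unfolding True[symmetric] ev_scal_mult leading_part_def by (rule if_P[symmetric]) (rule refl)
  qed
  then have "(\<Sum>i\<in>Idx. ev n s (scal (c i) * b i)) = (\<Sum>i\<in>Idx. if d i = s then cs (c i) (leading_part i) else 0)"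
    by (intro sum.cong refl)
  then show ?thesis unfolding ev_sum using sum.inter_filter[OF fin, of "\<lambda>i. cs (c i) (leading_part i)" "\<lambda>i. d i = s"] by (simp only:)
qed

lemma t_degree_nonneg: "t_degree w \<ge> 0"
  unfolding t_degree_def by (rule sum_list_nonneg) auto

text \<open>A word of degree \<open>k\<close> is a combination of the \<open>b i\<close> modulo
  \<open>weyl_ideal n\<close>. In degree \<open>k\<close> only those with \<open>d i = k\<close>
  contribute, and the error lies in \<open>filt n (k - 1)\<close>, which is covered by
  induction.\<close>

lemma filt_subset_span: "filt n s \<subseteq> fv.span (leading_part ` {i \<in> Idx. d i \<le> s})"
proof -
  \<comment> \<open>The shift lets the induction start in degree -1, where the filtration is zero
    because t-degrees are nonnegative.\<close>
  have "filt n (int k - 1) \<subseteq> fv.span (leading_part ` {i \<in> Idx. d i \<le> int k - 1})" for k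
  proof (induction k)
    case 0
    have "\<not> t_degree w \<le> int 0 - 1" for w using t_degree_nonneg[of w] by linarith
    then have "filt n (int 0 - 1) = fv.span {}" unfolding filt_def by (intro arg_cong[of _ _ fv.span]) blast
    then show ?case by (simp only: fv.span_mono empty_subsetI)
  next
    case (Suc k)
    let ?S = "fv.span (leading_part ` {i \<in> Idx. d i \<le> int k})"
    have "fv.span (leading_part ` {i \<in> Idx. d i \<le> int k - 1}) \<subseteq> ?S"
      by (intro fv.span_mono) auto
    then have low: "filt n (int k - 1) \<subseteq> ?S" using Suc by (rule order_trans[rotated])
    have "word_act n ls (vac n) \<in> ?S" if ls: "set ls \<subseteq> twisted" "t_degree (Word ls) \<le> int k" for ls
    proof (cases "t_degree (Word ls) = int k")
      case False
      then have "word_act n ls (vac n) \<in> filt n (int k - 1)"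
        unfolding filt_def using ls by (intro fv.span_base) auto
      then show ?thesis using low by blast
    next
      case True
      let ?p = "Poly_Mapping.single (Word ls) 1 :: tensor"
      have "?p \<in> tensors" using ls by (intro tensors_single) simp
      then obtain c where "?p - (\<Sum>i\<in>Idx. scal (c i) * b i) \<in> weyl_ideal n" using b_spanning by blast
      from ev_weyl_ideal[OF this, of "int k"]
      have "word_act n ls (vac n) - (\<Sum>i | i \<in> Idx \<and> d i = int k. cs (c i) (leading_part i)) \<in> ?S"
        using low unfolding ev_diff ev_comb ev_single osp_word.sel if_P[OF True] fv.scale_one by blast
      moreover have "(\<Sum>i | i \<in> Idx \<and> d i = int k. cs (c i) (leading_part i)) \<in> ?S"
        by (intro fv.span_sum fv.span_scale fv.span_base) auto
      ultimately have "word_act n ls (vac n) - (\<Sum>i | i \<in> Idx \<and> d i = int k. cs (c i) (leading_part i))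
          + (\<Sum>i | i \<in> Idx \<and> d i = int k. cs (c i) (leading_part i)) \<in> ?S" by (rule fv.span_add)
      then show ?thesis unfolding diff_add_cancel .
    qed
    then have "filt n (int k) \<subseteq> ?S"
      unfolding filt_def by (intro fv.span_minimal fv.subspace_span) blast
    moreover have "int (Suc k) - 1 = int k" by simp
    ultimately show ?case by (simp only:)
  qed
  from this[of "nat (s + 1)"] show ?thesis
  proof (cases "s \<ge> - 1")
    case False
    then have "\<not> t_degree w \<le> s" for w using t_degree_nonneg[of w] by linarith
    then have "filt n s = fv.span {}" unfolding filt_def by (intro arg_cong[of _ _ fv.span]) blast
    then show ?thesis by (simp only: fv.span_mono empty_subsetI)
  next
    case True
    then have "int (nat (s + 1)) - 1 = s" by simp
    with \<open>filt n (int (nat (s + 1)) - 1) \<subseteq> _\<close> show ?thesis by (simp only:)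
  qed
qed

lemma cyc_subset_span: "cyc n \<subseteq> fv.span (leading_part ` Idx)"
  unfolding cyc_def
proof (intro fv.span_minimal fv.subspace_span subsetI)
  fix x assume "x \<in> {word_act n ls (vac n) | ls. set ls \<subseteq> twisted}"
  then obtain ls where ls: "x = word_act n ls (vac n)" "set ls \<subseteq> twisted" by auto
  then have "x \<in> filt n (t_degree (Word ls))"
    unfolding filt_def by (intro fv.span_base) auto
  then show "x \<in> fv.span (leading_part ` Idx)"
    using filt_subset_span fv.span_mono[of "leading_part ` {i \<in> Idx. d i \<le> t_degree (Word ls)}" "leading_part ` Idx"] by blast
qed

text \<open>A relation would make one leading part redundant, and then fewer than \<open>3^n\<close>
  vectors would span the independent set \<open>model_basis n\<close> of size
  \<open>3^n\<close>.\<close>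

lemma leading_part_independent:
  assumes "(\<Sum>i\<in>Idx. cs (c i) (leading_part i)) = 0" "k \<in> Idx"
  shows "c k = 0"
proof (rule ccontr)
  assume ck: "c k \<noteq> 0"
  let ?A = "leading_part ` (Idx - {k})"
  have "cs (c k) (leading_part k) + (\<Sum>i\<in>Idx - {k}. cs (c i) (leading_part i)) = 0"
    using assms(1) unfolding sum.remove[OF fin assms(2)] .
  then have "cs (c k) (leading_part k) = - (\<Sum>i\<in>Idx - {k}. cs (c i) (leading_part i))"
    by (rule eq_neg_iff_add_eq_0[THEN iffD2])
  also have "\<dots> \<in> fv.span ?A"
    by (intro fv.span_neg fv.span_sum fv.span_scale fv.span_base imageI)
  finally have "cs (inverse (c k)) (cs (c k) (leading_part k)) \<in> fv.span ?A" by (rule fv.span_scale)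
  then have "leading_part k \<in> fv.span ?A"
    unfolding fv.scale_scale left_inverse[OF ck] fv.scale_one .
  then have "leading_part ` Idx \<subseteq> fv.span ?A" by (auto intro: fv.span_base)
  then have "fv.span (leading_part ` Idx) \<subseteq> fv.span ?A" by (rule fv.span_minimal) (rule fv.subspace_span)
  then have "model_basis n \<subseteq> fv.span ?A"
    using cyc_subset_span model_basis_cyc by blast
  then have "card (model_basis n) \<le> card ?A"
    by (rule fv.independent_span_bound[OF finite_imageI[OF finite_Diff[OF fin]] independent_model_basis, THEN conjunct2])
  also have "\<dots> \<le> card (Idx - {k})" by (rule card_image_le) (use fin in simp)
  also have "\<dots> < card Idx" using fin assms(2) by (intro psubset_card_mono) auto
  finally show False using card_Idx by (simp add: card_model_basis)
qed

text \<open>Lower filtration is spanned by the leading parts of smaller degree, so a relation modulo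
  \<open>filt n (s - 1)\<close> completes to an honest relation among all leading parts.\<close>

lemma graded_independent:
  assumes "(\<Sum>i | i \<in> Idx \<and> d i = s. cs (c i) (leading_part i)) \<in> filt n (s - 1)" "k \<in> Idx" "d k = s"
  shows "c k = 0"
proof -
  have f: "finite {i \<in> Idx. d i \<le> s - 1}" using fin by simp
  obtain c' where c': "(\<Sum>i | i \<in> Idx \<and> d i = s. cs (c i) (leading_part i)) = (\<Sum>i\<in>{i \<in> Idx. d i \<le> s - 1}. cs (c' i) (leading_part i))"
    using fv_span_image[OF f] filt_subset_span[of "s - 1"] assms(1) by blast
  define e where "e i = (if d i = s then c i else if d i \<le> s - 1 then - c' i else 0)" for i
  have "(\<Sum>i\<in>Idx. cs (e i) (leading_part i)) = (\<Sum>i\<in>Idx. (if d i = s then cs (c i) (leading_part i) else 0))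
      - (\<Sum>i\<in>Idx. (if d i \<le> s - 1 then cs (c' i) (leading_part i) else 0))"
    unfolding sum_subtractf[symmetric]
  proof (intro sum.cong refl)
    fix i
    consider "d i = s" "\<not> d i \<le> s - 1" | "d i \<noteq> s" "d i \<le> s - 1" | "d i \<noteq> s" "\<not> d i \<le> s - 1" by linarith
    then show "cs (e i) (leading_part i) = (if d i = s then cs (c i) (leading_part i) else 0) - (if d i \<le> s - 1 then cs (c' i) (leading_part i) else 0)"
      by cases (simp_all only: e_def if_True if_False refl diff_0 diff_0_right fv.scale_minus_left fv.scale_zero_left)
  qed
  also have "\<dots> = 0"
    using c' sum.inter_filter[OF fin, of "\<lambda>i. cs (c i) (leading_part i)" "\<lambda>i. d i = s"]
      sum.inter_filter[OF fin, of "\<lambda>i. cs (c' i) (leading_part i)" "\<lambda>i. d i \<le> s - 1"]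
    by (simp only: diff_self)
  finally have "e k = 0" using leading_part_independent assms(2) by blast
  then show ?thesis using assms(3) by (simp add: e_def)
qed

lemma b_independent:
  assumes "(\<Sum>i\<in>Idx. scal (c i) * b i) \<in> weyl_ideal n" "k \<in> Idx"
  shows "c k = 0"
  using graded_independent[of c "d k" k] ev_weyl_ideal[OF assms(1), of "d k"] assms(2)
  by (simp only: ev_comb)

text \<open>In a degree other than \<open>s\<close> the element \<open>p\<close> evaluates to 0, so
  the coefficients of that degree satisfy a relation modulo lower filtration and vanish. This
  identifies the graded pieces of the Weyl module.\<close>

lemma b_homogeneous_spanning:
  assumes "p \<in> tensors" "\<forall>w\<in>Poly_Mapping.keys p. t_degree w = s"
  obtains c where "\<And>i. i \<in> Idx \<Longrightarrow> d i \<noteq> s \<Longrightarrow> c i = 0" "p - (\<Sum>i\<in>Idx. scal (c i) * b i) \<in> weyl_ideal n"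
proof -
  obtain c where c: "p - (\<Sum>i\<in>Idx. scal (c i) * b i) \<in> weyl_ideal n" using b_spanning assms by blast
  have "c i = 0" if i: "i \<in> Idx" "d i \<noteq> s" for i
  proof -
    have "ev n (d i) p = 0" using ev_homogeneous[OF assms(2)] i by blast
    then have "- (\<Sum>j | j \<in> Idx \<and> d j = d i. cs (c j) (leading_part j)) \<in> filt n (d i - 1)"
      using ev_weyl_ideal[OF c, of "d i"] by (simp only: ev_diff ev_comb diff_0)
    then have "- (- (\<Sum>j | j \<in> Idx \<and> d j = d i. cs (c j) (leading_part j))) \<in> filt n (d i - 1)"
      unfolding filt_def by (rule fv.span_neg)
    then show ?thesis using graded_independent[of c "d i" i] i by (simp only: minus_minus)
  qed
  with c show ?thesis using that by blast
qed

end

subsection \<open>Generating functions\<close>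

definition gf :: "'a set \<Rightarrow> ('a \<Rightarrow> nat) \<Rightarrow> int fps" where
  "gf A w = Abs_fps (\<lambda>j. int (card {x \<in> A. w x = j}))"

definition fibre_finite :: "'a set \<Rightarrow> ('a \<Rightarrow> nat) \<Rightarrow> bool" where
  "fibre_finite A w \<longleftrightarrow> (\<forall>j. finite {x \<in> A. w x = j})"

lemma gf_mult:
  assumes "fibre_finite A w" "fibre_finite B v"
  shows "gf A w * gf B v = gf (A \<times> B) (\<lambda>(x, y). w x + v y)"
proof (rule fps_ext)
  fix n
  have "{z \<in> A \<times> B. (\<lambda>(x, y). w x + v y) z = n} = (\<Union>i\<in>{0..n}. {x \<in> A. w x = i} \<times> {y \<in> B. v y = n - i})"
    by auto
  also have "card \<dots> = (\<Sum>i=0..n. card ({x \<in> A. w x = i} \<times> {y \<in> B. v y = n - i}))"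
    using assms by (intro card_UN_disjoint) (auto simp: fibre_finite_def)
  finally show "fps_nth (gf A w * gf B v) n = fps_nth (gf (A \<times> B) (\<lambda>(x, y). w x + v y)) n"
    by (simp add: gf_def fps_mult_nth card_cartesian_product)
qed

lemma gf_Un:
  assumes "fibre_finite A w" "fibre_finite B w" "A \<inter> B = {}"
  shows "gf (A \<union> B) w = gf A w + gf B w"
proof (rule fps_ext)
  fix n
  have "{x \<in> A \<union> B. w x = n} = {x \<in> A. w x = n} \<union> {x \<in> B. w x = n}" by auto
  moreover have "card ({x \<in> A. w x = n} \<union> {x \<in> B. w x = n}) = card {x \<in> A. w x = n} + card {x \<in> B. w x = n}"
    using assms by (intro card_Un_disjoint) (auto simp: fibre_finite_def)
  ultimately show "fps_nth (gf (A \<union> B) w) n = fps_nth (gf A w + gf B w) n"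
    by (simp add: gf_def)
qed

lemma gf_image:
  assumes "inj_on f A" "\<And>x. x \<in> A \<Longrightarrow> w (f x) = k + v x"
  shows "gf (f ` A) w = fps_X ^ k * gf A v"
proof (rule fps_ext)
  fix n
  have "{y \<in> f ` A. w y = n} = f ` {x \<in> A. k + v x = n}" using assms(2) by auto
  also have "card \<dots> = card {x \<in> A. k + v x = n}"
    by (rule card_image) (rule inj_on_subset[OF assms(1)], auto)
  also have "{x \<in> A. k + v x = n} = (if n < k then {} else {x \<in> A. v x = n - k})" by auto
  finally show "fps_nth (gf (f ` A) w) n = fps_nth (fps_X ^ k * gf A v) n"
    by (simp add: gf_def fps_X_power_mult_nth)
qed

definition osum :: "nat set \<Rightarrow> nat" where "osum S = (\<Sum>i\<in>S. 2 * i + 1)"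

lemma osum_ge: "finite S \<Longrightarrow> i \<in> S \<Longrightarrow> i < osum S"
  unfolding osum_def using member_le_sum[of i S "\<lambda>i. 2 * i + 1"] by force

lemma card_le_osum: "finite S \<Longrightarrow> card S \<le> osum S"
  unfolding osum_def using sum_mono[of S "\<lambda>_. 1" "\<lambda>i. 2 * i + 1"] by simp

lemma finite_osum: "finite {S. finite S \<and> osum S = j}"
proof (rule finite_subset)
  show "{S. finite S \<and> osum S = j} \<subseteq> Pow {..<j}" using osum_ge by auto
qed simp

definition ksets :: "nat \<Rightarrow> nat set set" where "ksets k = {S. finite S \<and> card S = k}"

lemma fibre_finite_ksets: "fibre_finite (ksets k) osum"
  unfolding fibre_finite_def
proof
  fix j
  show "finite {x \<in> ksets k. osum x = j}"
    by (rule finite_subset[OF _ finite_osum[of j]]) (auto simp: ksets_def)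
qed

lemma fibre_finite_subset: "fibre_finite A w \<Longrightarrow> B \<subseteq> A \<Longrightarrow> fibre_finite B w"
  unfolding fibre_finite_def
proof (intro allI)
  fix j assume "\<forall>j. finite {x \<in> A. w x = j}" "B \<subseteq> A"
  then show "finite {x \<in> B. w x = j}" by (elim allE[of _ j] rev_finite_subset) auto
qed

definition ksets_gf :: "nat \<Rightarrow> int fps" where "ksets_gf k = gf (ksets k) osum"

lemma ksets_gf_0: "ksets_gf 0 = 1"
proof -
  have "ksets 0 = {{}}" by (auto simp: ksets_def)
  then show ?thesis by (auto simp: ksets_gf_def gf_def fps_eq_iff osum_def Collect_conv_if)
qed

lemma osum_Suc_image: "osum (Suc ` S) = 2 * card S + osum S"
proof -
  have "osum (Suc ` S) = (\<Sum>i\<in>S. 2 + (2 * i + 1))"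
    unfolding osum_def by (subst sum.reindex) (simp_all add: comp_def)
  also have "\<dots> = 2 * card S + osum S"
    unfolding osum_def by (subst sum.distrib) simp
  finally show ?thesis .
qed

text \<open>Split by whether 0 belongs to the set and shift the other elements down by 1, which
  lowers each odd number by 2. Solved for \<open>ksets_gf\<close>, this is
  \<open>q^(k^2) / ((1 - q^2) (1 - q^4) ... (1 - q^(2k)))\<close>.\<close>

lemma ksets_gf_Suc: "ksets_gf (Suc k) = fps_X ^ (2 * Suc k) * ksets_gf (Suc k) + fps_X ^ (2 * k + 1) * ksets_gf k"
proof -
  let ?f = "\<lambda>S. Suc ` S" and ?g = "\<lambda>S. insert 0 (Suc ` S)"
  have f: "inj_on ?f A" for A by (auto intro!: inj_onI simp: inj_image_eq_iff)
  have g: "inj_on ?g A" for A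
  proof (rule inj_onI)
    fix S T assume "?g S = ?g T"
    then have "?g S - {0} = ?g T - {0}" by simp
    then have "Suc ` S = Suc ` T" by (simp add: insert_Diff_if)
    then show "S = T" by (simp add: inj_image_eq_iff)
  qed
  note inj = f g
  have split: "ksets (Suc k) = ?f ` ksets (Suc k) \<union> ?g ` ksets k"
  proof (intro equalityI subsetI)
    fix S assume S: "S \<in> ksets (Suc k)"
    define S' where "S' = (\<lambda>i. i - 1) ` (S - {0})"
    have im: "Suc ` S' = S - {0}" by (force simp: S'_def image_image)
    have c: "card S' = card (S - {0})"
      using card_image[of Suc S'] im by simp
    show "S \<in> ?f ` ksets (Suc k) \<union> ?g ` ksets k"
    proof (cases "0 \<in> S")
      case True
      then have "S = ?g S'" "S' \<in> ksets k" using im c S by (auto simp: ksets_def S'_def)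
      then show ?thesis by blast
    next
      case False
      then have "S = ?f S'" "S' \<in> ksets (Suc k)" using im c S by (auto simp: ksets_def S'_def)
      then show ?thesis by blast
    qed
  next
    fix S assume "S \<in> ?f ` ksets (Suc k) \<union> ?g ` ksets k"
    then show "S \<in> ksets (Suc k)"
      by (auto simp: ksets_def card_image)
  qed
  have ff: "fibre_finite A osum" if "A \<subseteq> ksets (Suc k)" for A
    using fibre_finite_subset[OF fibre_finite_ksets that] .
  have "ksets_gf (Suc k) = gf (?f ` ksets (Suc k)) osum + gf (?g ` ksets k) osum"
    unfolding ksets_gf_def
    by (subst split, rule gf_Un) (use split in \<open>blast intro: ff\<close>, use split in \<open>blast intro: ff\<close>, blast)
  also have "gf (?f ` ksets (Suc k)) osum = fps_X ^ (2 * Suc k) * gf (ksets (Suc k)) osum"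
    by (rule gf_image) (auto simp: inj osum_Suc_image ksets_def)
  also have "gf (?g ` ksets k) osum = fps_X ^ (2 * k + 1) * gf (ksets k) osum"
  proof (rule gf_image)
    fix S assume "S \<in> ksets k"
    then have "osum (?g S) = 1 + osum (Suc ` S)" by (simp add: osum_def ksets_def)
    then show "osum (?g S) = 2 * k + 1 + osum S" using \<open>S \<in> ksets k\<close> by (simp add: osum_Suc_image ksets_def)
  qed (rule inj)
  finally show ?thesis unfolding ksets_gf_def .
qed

lemma box_lists_bounds: "\<mu> \<in> box_lists a N \<Longrightarrow> set \<mu> \<subseteq> {..a} \<and> sum_list \<mu> \<le> a * N"
proof (induction a N arbitrary: \<mu> rule: box_lists.induct)
  case (3 a N)
  then show ?case by fastforce
qed auto

lemma finite_box_lists [simp]: "finite (box_lists a N)"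
  by (induction a N rule: box_lists.induct) auto

lemma box_lists_disjoint: "box_lists a (Suc N) \<inter> (#) (Suc a) ` box_lists (Suc a) N = {}"
  using box_lists_bounds[of _ a "Suc N"] by fastforce

lemma card_box_lists: "card (box_lists a N) = (a + N) choose a"
  by (induction a N rule: box_lists.induct)
    (simp_all add: card_Un_disjoint box_lists_disjoint card_image)

text \<open>The Gaussian binomial in \<open>q^2\<close>. Since the degree of an index subtracts
  twice the size of the partition, the size of the complement in the box is counted, which keeps the
  exponents natural.\<close>

definition box_gf :: "nat \<Rightarrow> nat \<Rightarrow> int fps" where
  "box_gf a N = gf (box_lists a N) (\<lambda>\<mu>. 2 * a * N - 2 * sum_list \<mu>)"

lemma fibre_finite_finite: "finite A \<Longrightarrow> fibre_finite A w"
  by (simp add: fibre_finite_def)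

lemma box_gf_simps: "box_gf 0 N = 1" "box_gf a 0 = 1"
  "box_gf (Suc a) (Suc N) = fps_X ^ (2 * Suc N) * box_gf a (Suc N) + box_gf (Suc a) N"
proof -
  show "box_gf 0 N = 1" "box_gf a 0 = 1"
    by (cases a; auto simp: box_gf_def gf_def fps_eq_iff Collect_conv_if)+
  let ?w = "\<lambda>\<mu>. 2 * Suc a * Suc N - 2 * sum_list \<mu>"
  have "box_gf (Suc a) (Suc N) = gf ((\<lambda>\<mu>. \<mu>) ` box_lists a (Suc N)) ?w + gf ((#) (Suc a) ` box_lists (Suc a) N) ?w"
    unfolding box_gf_def box_lists.simps image_ident
    by (rule gf_Un) (auto simp: box_lists_disjoint intro: fibre_finite_finite)
  also have "gf ((\<lambda>\<mu>. \<mu>) ` box_lists a (Suc N)) ?w = fps_X ^ (2 * Suc N) * box_gf a (Suc N)"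
    unfolding box_gf_def
  proof (rule gf_image)
    fix \<mu> assume "\<mu> \<in> box_lists a (Suc N)"
    then have "sum_list \<mu> \<le> a * Suc N" using box_lists_bounds by blast
    then show "2 * Suc a * Suc N - 2 * sum_list \<mu> = 2 * Suc N + (2 * a * Suc N - 2 * sum_list \<mu>)" by simp
  qed simp
  also have "gf ((#) (Suc a) ` box_lists (Suc a) N) ?w = fps_X ^ 0 * box_gf (Suc a) N"
    unfolding box_gf_def by (rule gf_image) (auto simp: algebra_simps)
  finally show "box_gf (Suc a) (Suc N) = fps_X ^ (2 * Suc N) * box_gf a (Suc N) + box_gf (Suc a) N" by simp
qed

text \<open>In closed form, \<open>ksets_gf k\<close> is \<open>q^(k^2)\<close> over a q-factorial
  in \<open>q^2\<close>; the factorials form the Gaussian binomial and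
  \<open>(a + N)^2 - a^2 - N^2 = 2 a N\<close>. The proof replaces division by cancelling
  \<open>1 - q^(2 (a + N + 2))\<close>.\<close>

lemma ksets_box_gf: "ksets_gf (a + N) * box_gf a N = fps_X ^ (2 * a * N) * (ksets_gf a * ksets_gf N)"
proof (induction a N rule: box_lists.induct)
  case (3 a N)
  define X where "X = (fps_X :: int fps)"
  let ?k = "Suc (a + N)"
  have r: "(1 - X ^ (2 * Suc k)) * ksets_gf (Suc k) = X ^ (2 * k + 1) * ksets_gf k" for k
    using ksets_gf_Suc[of k] by (simp add: X_def algebra_simps)
  have IH1: "ksets_gf ?k * box_gf a (Suc N) = X ^ (2 * a * Suc N) * (ksets_gf a * ksets_gf (Suc N))"
    and IH2: "ksets_gf ?k * box_gf (Suc a) N = X ^ (2 * Suc a * N) * (ksets_gf (Suc a) * ksets_gf N)"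
    using 3 by (simp_all add: X_def)
  have "(1 - X ^ (2 * Suc ?k)) * (ksets_gf (Suc ?k) * box_gf (Suc a) (Suc N))
      = X ^ (2 * ?k + 1) * (X ^ (2 * Suc N) * (ksets_gf ?k * box_gf a (Suc N)) + ksets_gf ?k * box_gf (Suc a) N)"
    using r[of ?k] unfolding box_gf_simps X_def[symmetric] by (simp only: mult.assoc[symmetric]; simp only: algebra_simps)
  also have "\<dots> = X ^ (2 * Suc a * Suc N) * ((X ^ (2 * N + 1) * ksets_gf N) * ksets_gf (Suc a)
      + X ^ (2 * Suc N) * (X ^ (2 * a + 1) * ksets_gf a) * ksets_gf (Suc N))"
    unfolding IH1 IH2 by (simp add: algebra_simps power_add power_mult_distrib power2_eq_square; simp add: add.commute)
  \<comment> \<open>With \<open>u = X ^ (2 * Suc N)\<close> and \<open>w = X ^ (2 * Suc a)\<close>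
    this uses \<open>1 - u w = (1 - u) + u (1 - w)\<close>.\<close>
  also have "\<dots> = X ^ (2 * Suc a * Suc N) * ((1 - X ^ (2 * Suc ?k)) * (ksets_gf (Suc a) * ksets_gf (Suc N)))"
  proof -
    have "X ^ (2 * Suc ?k) = X ^ (2 * Suc N + 2 * Suc a)" by (intro arg_cong[of _ _ "power X"]) simp
    then show ?thesis unfolding r[symmetric] by (simp add: power_add algebra_simps)
  qed
  finally have "(1 - X ^ (2 * Suc ?k)) * (ksets_gf (Suc ?k) * box_gf (Suc a) (Suc N))
      = (1 - X ^ (2 * Suc ?k)) * (X ^ (2 * Suc a * Suc N) * (ksets_gf (Suc a) * ksets_gf (Suc N)))"
    by (simp only: mult.left_commute)
  moreover have "1 - X ^ (2 * Suc ?k) \<noteq> 0"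
  proof
    assume "1 - X ^ (2 * Suc ?k) = 0"
    then have "fps_nth (1 - X ^ (2 * Suc ?k)) 0 = 0" by (simp only: fps_zero_nth)
    then show False by (simp add: X_def)
  qed
  ultimately show ?case by (simp add: X_def)
qed (simp_all add: box_gf_simps ksets_gf_0)

text \<open>The factor \<open>q^(2 a N)\<close> of \<open>ksets_box_gf\<close> undoes the complement
  taken in \<open>box_gf\<close>. That no negative degree occurs comes from the same count: there
  the coefficient lies below the power \<open>2 a N\<close> and is 0.\<close>

lemma pair_count:
  "{(S, \<mu>). S \<in> ksets (a + N) \<and> \<mu> \<in> box_lists a N \<and> int (osum S) - 2 * int (sum_list \<mu>) = b} \<noteq> {} \<Longrightarrow> b \<ge> 0"
  "card {(S, \<mu>). S \<in> ksets (a + N) \<and> \<mu> \<in> box_lists a N \<and> int (osum S) - 2 * int (sum_list \<mu>) = b}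
   = card {(S, S'). S \<in> ksets a \<and> S' \<in> ksets N \<and> int (osum S + osum S') = b}"
  "finite {(S, \<mu>). S \<in> ksets (a + N) \<and> \<mu> \<in> box_lists a N \<and> int (osum S) - 2 * int (sum_list \<mu>) = b}"
proof -
  let ?A = "{(S, \<mu>). S \<in> ksets (a + N) \<and> \<mu> \<in> box_lists a N \<and> int (osum S) - 2 * int (sum_list \<mu>) = b}"
  let ?C = "{(S, S'). S \<in> ksets a \<and> S' \<in> ksets N \<and> int (osum S + osum S') = b}"
  let ?w = "\<lambda>(S, \<mu>). osum S + (2 * a * N - 2 * sum_list \<mu>)"
  let ?j = "nat (b + int (2 * a * N))"
  have bd: "2 * sum_list \<mu> \<le> 2 * a * N" if "\<mu> \<in> box_lists a N" for \<mu>
    using box_lists_bounds[OF that] by simp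
  have eq: "int (osum S) - 2 * int (sum_list \<mu>) = b \<longleftrightarrow>
      0 \<le> b + int (2 * a * N) \<and> osum S + (2 * a * N - 2 * sum_list \<mu>) = ?j"
    if "\<mu> \<in> box_lists a N" for S \<mu>
  proof -
    define M where "M = 2 * a * N"
    show ?thesis using bd[OF that] unfolding M_def[symmetric] by arith
  qed
  have A: "?A = {z \<in> ksets (a + N) \<times> box_lists a N. ?w z = ?j}" if "b + int (2 * a * N) \<ge> 0"
  proof -
    have "z \<in> ?A \<longleftrightarrow> z \<in> {z \<in> ksets (a + N) \<times> box_lists a N. ?w z = ?j}" for z
    proof (cases z)
      case (Pair S \<mu>)
      show ?thesis unfolding Pair mem_Collect_eq case_prod_conv mem_Times_iff fst_conv snd_conv
        using eq[of \<mu> S] that by blast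
    qed
    then show ?thesis by (rule Set.set_eqI)
  qed
  have A': "?A = {}" if "b + int (2 * a * N) < 0"
  proof -
    have "z \<notin> ?A" for z
    proof (cases z)
      case (Pair S \<mu>)
      show ?thesis unfolding Pair mem_Collect_eq case_prod_conv
        using eq[of \<mu> S] that by linarith
    qed
    then show ?thesis by (rule equals0I[OF notE])
  qed
  have gA: "gf (ksets (a + N) \<times> box_lists a N) ?w = fps_X ^ (2 * a * N) * gf (ksets a \<times> ksets N) (\<lambda>(S, S'). osum S + osum S')"
    using ksets_box_gf[of a N] unfolding ksets_gf_def box_gf_def
    by (simp add: gf_mult fibre_finite_ksets fibre_finite_finite)
  have cA: "int (card ?A) = fps_nth (fps_X ^ (2 * a * N) * gf (ksets a \<times> ksets N) (\<lambda>(S, S'). osum S + osum S')) ?j"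
    if "b + int (2 * a * N) \<ge> 0"
    unfolding gA[symmetric] A[OF that] by (simp add: gf_def)
  show fin: "finite ?A"
  proof (rule finite_subset)
    show "?A \<subseteq> {S. finite S \<and> osum S \<in> {..nat (b + int (2 * a * N))}} \<times> box_lists a N"
    proof
      fix z assume z: "z \<in> ?A"
      obtain S \<mu> where e: "z = (S, \<mu>)" by (cases z)
      have m: "S \<in> ksets (a + N)" "\<mu> \<in> box_lists a N" "int (osum S) - 2 * int (sum_list \<mu>) = b"
        using z unfolding e mem_Collect_eq case_prod_conv by blast+
      have "int (osum S) \<le> b + int (2 * a * N)" using bd[OF m(2)] m(3) by linarith
      then have "osum S \<le> nat (b + int (2 * a * N))" by linarith
      then show "z \<in> {S. finite S \<and> osum S \<in> {..nat (b + int (2 * a * N))}} \<times> box_lists a N"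
        using m(1,2) unfolding e by (simp only: mem_Times_iff fst_conv snd_conv mem_Collect_eq atMost_iff ksets_def simp_thms)
    qed
    have "{S. finite S \<and> osum S \<in> {..nat (b + int (2 * a * N))}} = (\<Union>j\<in>{..nat (b + int (2 * a * N))}. {S. finite S \<and> osum S = j})"
      by auto
    then show "finite ({S. finite S \<and> osum S \<in> {..nat (b + int (2 * a * N))}} \<times> box_lists a N)"
      using finite_osum by simp
  qed
  show card: "card ?A = card ?C"
  proof (cases "b \<ge> 0")
    case True
    then have j: "?j = 2 * a * N + nat b" by linarith
    have "int (card ?A) = fps_nth (fps_X ^ (2 * a * N) * gf (ksets a \<times> ksets N) (\<lambda>(S, S'). osum S + osum S')) ?j"
      by (rule cA) (use True in simp)
    also have "\<dots> = fps_nth (gf (ksets a \<times> ksets N) (\<lambda>(S, S'). osum S + osum S')) (nat b)"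
      unfolding j fps_X_power_mult_nth by simp
    also have "\<dots> = int (card ?C)"
      unfolding gf_def fps_nth_Abs_fps
      by (intro arg_cong[of _ _ card] arg_cong[of _ _ int]) (use True in auto)
    finally show ?thesis by (simp only: of_nat_eq_iff)
  next
    case False
    have "z \<notin> ?C" for z
      using False by auto
    then have "?C = {}" by (rule equals0I[OF notE])
    moreover have "card ?A = 0"
    proof (cases "b + int (2 * a * N) \<ge> 0")
      case True
      then have "?j < 2 * a * N" using False by linarith
      then have "int (card ?A) = 0"
        unfolding cA[OF True] fps_X_power_mult_nth by (rule if_P)
      then show ?thesis by (simp only: of_nat_eq_0_iff)
    next
      case False
      then have "?A = {}" by (intro A') linarith
      then show ?thesis by (simp only: card.empty)
    qed
    ultimately show ?thesis by (simp only: card.empty)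
  qed
  show "b \<ge> 0" if ne: "?A \<noteq> {}"
  proof (rule ccontr)
    assume "\<not> b \<ge> 0"
    then have "z \<notin> ?C" for z by auto
    then have "?C = {}" by (rule equals0I[OF notE])
    then have "card ?A = 0" using card by (simp only: card.empty)
    then show False using fin ne by (simp only: card_0_eq)
  qed
qed

section \<open>The infinite product as a sum over finite sets\<close>

definition set_series :: "int fls \<Rightarrow> int fls fps" where
  "set_series c = Abs_fps (\<lambda>j. \<Sum>S | finite S \<and> osum S = j. c ^ card S)"

text \<open>Expanding a finite product chooses a set of factors. A set with
  \<open>osum S = j\<close> has only elements below \<open>j\<close>, so the coefficient of
  \<open>q^j\<close> is constant once \<open>N \<ge> j\<close>.\<close>

lemma prodinf_set_series:
  "prodinf (\<lambda>i. 1 + fps_X ^ (2 * i + 1) * fps_const c) = set_series c"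
proof -
  let ?f = "\<lambda>i. 1 + fps_X ^ (2 * i + 1) * fps_const c"
  have prod: "(\<Prod>i\<le>N. ?f i) = (\<Sum>S\<in>Pow {..N}. fps_X ^ osum S * fps_const (c ^ card S))" for N
  proof -
    have "(\<Prod>i\<le>N. ?f i) = (\<Prod>i\<le>N. fps_X ^ (2 * i + 1) * fps_const c + 1)"
      by (simp only: add.commute)
    also have "\<dots> = (\<Sum>S\<in>Pow {..N}. \<Prod>i\<in>S. fps_X ^ (2 * i + 1) * fps_const c)"
      by (subst prod_add) simp_all
    finally show ?thesis
      by (simp only: prod.distrib power_sum[symmetric] osum_def prod_constant fps_const_power)
  qed
  have "fps_nth (\<Prod>i\<le>N. ?f i) j = fps_nth (set_series c) j" if "N \<ge> j" for N j
  proof -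
    have "fps_nth (\<Prod>i\<le>N. ?f i) j = (\<Sum>S\<in>Pow {..N}. if osum S = j then c ^ card S else 0)"
      unfolding prod fps_sum_nth by (intro sum.cong refl) (auto simp: fps_X_power_mult_nth)
    also have "\<dots> = (\<Sum>S | S \<in> Pow {..N} \<and> osum S = j. c ^ card S)"
      by (rule sum.inter_filter[symmetric]) simp
    also have "{S. S \<in> Pow {..N} \<and> osum S = j} = {S. finite S \<and> osum S = j}"
    proof (intro equalityI subsetI CollectI conjI)
      fix S assume "S \<in> {S. finite S \<and> osum S = j}"
      then show "S \<in> Pow {..N}" "osum S = j" using osum_ge[of S] that by fastforce+
    qed (auto intro: finite_subset)
    finally show ?thesis by (simp add: set_series_def)
  qed
  then have lim: "(\<lambda>N. \<Prod>i\<le>N. ?f (i + 0)) \<longlonglongrightarrow> set_series c"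
    by (intro tendsto_fpsI) (auto simp: eventually_at_top_linorder)
  \<comment> \<open>\<open>raw_has_prod\<close> demands a nonzero limit; here the constant
    coefficient is 1, contributed by the empty set.\<close>
  have "{S. finite S \<and> osum S = 0} = {{}}"
    using card_le_osum by (fastforce simp: osum_def)
  then have "fps_nth (set_series c) 0 \<noteq> 0" by (simp add: set_series_def)
  then have "set_series c \<noteq> 0" by auto
  with lim have "?f has_prod set_series c"
    by (simp add: has_prod_def raw_has_prod_def)
  then show ?thesis by (rule has_prod_unique[symmetric])
qed

text \<open>\<open>S\<close> is the set of factors in which the term with \<open>x\<close> is
  chosen, and \<open>S'\<close> the same for the inverse of \<open>x\<close>.\<close>

lemma product_coeff_card:
  "product_coeff a b = int (card {(S, S'). finite S \<and> finite S' \<and> int (card S) - int (card S') = a \<and> int (osum S + osum S') = b})"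
proof (cases "b \<ge> 0")
  case False
  then have "{(S, S'). finite S \<and> finite S' \<and> int (card S) - int (card S') = a \<and> int (osum S + osum S') = b} = {}"
    by auto
  then show ?thesis using False by (simp only: product_coeff_def) simp
next
  case True
  define n where "n = nat b"
  have b: "b = int n" using True by (simp add: n_def)
  let ?D = "\<lambda>j. {S :: nat set. finite S \<and> osum S = j}"
  have fD: "finite (?D j)" for j by (rule finite_osum)
  have coeff: "fls_nth (fls_X ^ k * fls_X_inv ^ l :: int fls) a = (if int k - int l = a then 1 else 0)" for k l
    by (simp add: fls_X_power_times_conv_shift; auto)
  have sum_nth: "fls_nth (sum f A) a = (\<Sum>x\<in>A. fls_nth (f x) a)" for f :: "'x \<Rightarrow> int fls" and A
    by (induction A rule: infinite_finite_induct) auto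
  have "product_coeff a b = fls_nth (fps_nth (set_series fls_X * set_series fls_X_inv) n) a"
    unfolding product_coeff_def product_side_def prodinf_set_series b by simp
  also have "\<dots> = (\<Sum>i=0..n. \<Sum>S\<in>?D i. \<Sum>S'\<in>?D (n - i). if int (card S) - int (card S') = a then 1 else 0)"
    by (simp add: fps_mult_nth set_series_def sum_product sum_nth coeff)
  also have "\<dots> = (\<Sum>i=0..n. \<Sum>z\<in>?D i \<times> ?D (n - i). if int (card (fst z)) - int (card (snd z)) = a then 1 else 0)"
    by (simp add: sum.cartesian_product case_prod_beta)
  also have "\<dots> = (\<Sum>z\<in>(\<Union>i\<in>{0..n}. ?D i \<times> ?D (n - i)). if int (card (fst z)) - int (card (snd z)) = a then 1 else 0)"
    by (rule sum.UNION_disjoint[symmetric]) (use fD in auto)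
  also have "\<dots> = int (card {z \<in> (\<Union>i\<in>{0..n}. ?D i \<times> ?D (n - i)). int (card (fst z)) - int (card (snd z)) = a})"
    by (subst sum.inter_filter[symmetric]) (use fD in auto)
  also have "{z \<in> (\<Union>i\<in>{0..n}. ?D i \<times> ?D (n - i)). int (card (fst z)) - int (card (snd z)) = a}
    = {(S, S'). finite S \<and> finite S' \<and> int (card S) - int (card S') = a \<and> int (osum S + osum S') = b}"
    by (auto simp: b)
  finally show ?thesis .
qed

subsection \<open>The basis of the Weyl module\<close>

text \<open>An index \<open>(S, k, \<mu>)\<close> stands for the basis vector with \<open>k\<close> letters \<open>e_0\<close>, the odd letters
  \<open>g^+_{2j+1}\<close> for \<open>j < n\<close> outside \<open>S\<close>, and the symmetric operators listed in \<open>\<mu>\<close>. Recording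
  the complement \<open>S\<close> makes the embeddings preserve indices, weights and regraded degrees.\<close>

type_synonym index = "nat set \<times> nat \<times> nat list"

definition all_idx :: "index set" where
  "all_idx = {(S, k, \<mu>). finite S \<and> k \<le> card S \<and> \<mu> \<in> box_lists k (card S - k)}"

definition idx_weight :: "index \<Rightarrow> int" where
  "idx_weight = (\<lambda>(S, k, \<mu>). 2 * int k - int (card S))"

definition idx_degree :: "index \<Rightarrow> int" where
  "idx_degree = (\<lambda>(S, k, \<mu>). int (osum S) - 2 * int (sum_list \<mu>))"

text \<open>With \<open>l = card S - k\<close> the weight \<open>2 k - card S\<close> becomes
  \<open>k - l\<close>. For each pair \<open>(k, l)\<close>, \<open>pair_count\<close> trades a set
  with a partition for two sets of sizes \<open>k\<close> and \<open>l\<close>, the exponents of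
  \<open>x\<close> and of its inverse.\<close>

lemma idx_count:
  "finite {i \<in> all_idx. idx_weight i = a \<and> idx_degree i = b}"
  "int (card {i \<in> all_idx. idx_weight i = a \<and> idx_degree i = b}) = product_coeff a b"
proof -
  define P where "P = {z \<in> {..nat b} \<times> {..nat b}. int (fst z) - int (snd z) = a}"
  define A where "A z = {(S, \<mu>). S \<in> ksets (fst z + snd z) \<and> \<mu> \<in> box_lists (fst z) (snd z) \<and>
    int (osum S) - 2 * int (sum_list \<mu>) = b}" for z
  define C where "C z = {(S, S'). S \<in> ksets (fst z) \<and> S' \<in> ksets (snd z) \<and> int (osum S + osum S') = b}" for z
  define h where "h z = (\<lambda>(S, \<mu>). (S, fst z :: nat, \<mu>)) ` A z" for z
  have memA: "(S, \<mu>) \<in> A (k, l) \<longleftrightarrow> finite S \<and> card S = k + l \<and> \<mu> \<in> box_lists k l \<and>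
      int (osum S) - 2 * int (sum_list \<mu>) = b" for S \<mu> k l
    by (auto simp: A_def ksets_def)
  have memC: "(S, S') \<in> C (k, l) \<longleftrightarrow> finite S \<and> finite S' \<and> card S = k \<and> card S' = l \<and>
      int (osum S) + int (osum S') = b" for S S' k l
    by (auto simp: C_def ksets_def)
  have memh: "(S, j, \<mu>) \<in> h (k, l) \<longleftrightarrow> j = k \<and> (S, \<mu>) \<in> A (k, l)" for S j \<mu> k l
    by (auto simp: h_def)
  have memP: "(k, l) \<in> P \<longleftrightarrow> k \<le> nat b \<and> l \<le> nat b \<and> int k - int l = a" for k l
    by (auto simp: P_def)
  have bC: "k \<le> nat b \<and> l \<le> nat b" if w: "(S, S') \<in> C (k, l)" for S S' k l
  proof -
    have "k \<le> osum S" "l \<le> osum S'" "int (osum S) + int (osum S') = b"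
      using w card_le_osum[of S] card_le_osum[of S'] unfolding memC by auto
    then show ?thesis by linarith
  qed
  have finC: "finite (C z)" for z
  proof (rule finite_subset)
    let ?D = "\<Union>j\<in>{..nat b}. {S. finite S \<and> osum S = j}"
    show "C z \<subseteq> ?D \<times> ?D"
    proof
      fix w assume w: "w \<in> C z"
      obtain S S' where e: "w = (S, S')" by (cases w)
      obtain k l where z: "z = (k, l)" by (cases z)
      have "finite S" "finite S'" "osum S \<le> nat b" "osum S' \<le> nat b"
        using w unfolding e z memC by linarith+
      then show "w \<in> ?D \<times> ?D" by (simp add: e)
    qed
    show "finite (?D \<times> ?D)" using finite_osum by (intro finite_cartesian_product finite_UN_I) auto
  qed
  have AC: "card (A z) = card (C z)" and finA: "finite (A z)" for z
    unfolding A_def C_def by (rule pair_count)+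
  \<comment> \<open>For \<open>A\<close> the bound is not visible term by term, because the
    partition lowers the degree; it is inherited from \<open>C\<close> through the equal
    cardinalities.\<close>
  have bA: "k \<le> nat b \<and> l \<le> nat b" if w: "(S, \<mu>) \<in> A (k, l)" for S \<mu> k l
  proof -
    have "card (A (k, l)) \<noteq> 0" using finA w by (auto simp: card_eq_0_iff)
    then have "C (k, l) \<noteq> {}" unfolding AC by auto
    then show ?thesis using bC by auto
  qed
  have U: "{i \<in> all_idx. idx_weight i = a \<and> idx_degree i = b} = (\<Union>z\<in>P. h z)"
  proof (rule Set.set_eqI)
    fix i :: index
    obtain S k \<mu> where e: "i = (S, k, \<mu>)" by (cases i)
    have "i \<in> {i \<in> all_idx. idx_weight i = a \<and> idx_degree i = b} \<longleftrightarrow>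
        (\<exists>l. int k - int l = a \<and> (S, \<mu>) \<in> A (k, l))"
    proof
      assume "i \<in> {i \<in> all_idx. idx_weight i = a \<and> idx_degree i = b}"
      then have "int k - int (card S - k) = a \<and> (S, \<mu>) \<in> A (k, card S - k)"
        unfolding memA by (auto simp: e all_idx_def idx_weight_def idx_degree_def)
      then show "\<exists>l. int k - int l = a \<and> (S, \<mu>) \<in> A (k, l)" by blast
    next
      assume "\<exists>l. int k - int l = a \<and> (S, \<mu>) \<in> A (k, l)"
      then show "i \<in> {i \<in> all_idx. idx_weight i = a \<and> idx_degree i = b}"
        unfolding memA by (auto simp: e all_idx_def idx_weight_def idx_degree_def)
    qed
    also have "\<dots> \<longleftrightarrow> (\<exists>l. (k, l) \<in> P \<and> (S, k, \<mu>) \<in> h (k, l))"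
      unfolding memP memh using bA by blast
    also have "\<dots> \<longleftrightarrow> i \<in> (\<Union>z\<in>P. h z)"
    proof
      assume "i \<in> (\<Union>z\<in>P. h z)"
      then obtain z where z: "z \<in> P" "(S, k, \<mu>) \<in> h z" unfolding e by (rule UN_E)
      obtain k' l where kl: "z = (k', l)" by (cases z)
      have "k' = k" using z(2) unfolding kl memh by (rule conjunct1[THEN sym])
      then show "\<exists>l. (k, l) \<in> P \<and> (S, k, \<mu>) \<in> h (k, l)" using z unfolding kl by blast
    qed (use e in blast)
    finally show "i \<in> {i \<in> all_idx. idx_weight i = a \<and> idx_degree i = b} \<longleftrightarrow> i \<in> (\<Union>z\<in>P. h z)" .
  qed
  have finP: "finite P" by (simp add: P_def)
  have finh: "finite (h z)" for z unfolding h_def by (intro finite_imageI finA)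
  show "finite {i \<in> all_idx. idx_weight i = a \<and> idx_degree i = b}"
    unfolding U by (intro finite_UN_I finP finh)
  have "card {i \<in> all_idx. idx_weight i = a \<and> idx_degree i = b} = (\<Sum>z\<in>P. card (h z))"
    unfolding U
  proof (rule card_UN_disjoint[OF finP])
    show "\<forall>z\<in>P. finite (h z)" using finh by blast
    have "h (k, l) \<inter> h (k', l') = {}" if "(k, l) \<noteq> (k', l')" for k l k' l'
    proof -
      have "i \<notin> h (k, l) \<inter> h (k', l')" for i :: index
      proof (cases i)
        case (fields S j \<mu>)
        show ?thesis using that unfolding fields Int_iff memh memA by auto
      qed
      then show ?thesis by blast
    qed
    then show "\<forall>z\<in>P. \<forall>z'\<in>P. z \<noteq> z' \<longrightarrow> h z \<inter> h z' = {}"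
      by (metis surj_pair)
  qed
  also have "\<dots> = (\<Sum>z\<in>P. card (C z))"
  proof (intro sum.cong refl)
    fix z
    have "card (h z) = card (A z)" unfolding h_def by (rule card_image) (auto intro: inj_onI)
    then show "card (h z) = card (C z)" unfolding AC .
  qed
  also have "\<dots> = card (\<Union>z\<in>P. C z)"
  proof (rule card_UN_disjoint[symmetric, OF finP])
    show "\<forall>z\<in>P. finite (C z)" using finC by blast
    show "\<forall>z\<in>P. \<forall>z'\<in>P. z \<noteq> z' \<longrightarrow> C z \<inter> C z' = {}"
      by (auto simp: C_def ksets_def)
  qed
  also have "(\<Union>z\<in>P. C z) = {(S, S'). finite S \<and> finite S' \<and> int (card S) - int (card S') = a \<and> int (osum S + osum S') = b}"
  proof (rule Set.set_eqI)
    fix w :: "nat set \<times> nat set"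
    obtain S S' where e: "w = (S, S')" by (cases w)
    have "w \<in> (\<Union>z\<in>P. C z) \<longleftrightarrow> (\<exists>k l. int k - int l = a \<and> (S, S') \<in> C (k, l))"
    proof
      assume "w \<in> (\<Union>z\<in>P. C z)"
      then obtain z where z: "z \<in> P" "(S, S') \<in> C z" unfolding e by (rule UN_E)
      obtain k l where kl: "z = (k, l)" by (cases z)
      show "\<exists>k l. int k - int l = a \<and> (S, S') \<in> C (k, l)" using z unfolding kl memP by blast
    next
      assume "\<exists>k l. int k - int l = a \<and> (S, S') \<in> C (k, l)"
      then obtain k l where kl: "int k - int l = a" "(S, S') \<in> C (k, l)" by blast
      then have "(k, l) \<in> P" unfolding memP using bC by blast
      then show "w \<in> (\<Union>z\<in>P. C z)" using kl(2) unfolding e by (rule UN_I)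
    qed
    then show "w \<in> (\<Union>z\<in>P. C z) \<longleftrightarrow> w \<in> {(S, S'). finite S \<and> finite S' \<and> int (card S) - int (card S') = a \<and> int (osum S + osum S') = b}"
      unfolding memC by (auto simp: e)
  qed
  finally show "int (card {i \<in> all_idx. idx_weight i = a \<and> idx_degree i = b}) = product_coeff a b"
    unfolding product_coeff_card by (simp only:)
qed

text \<open>The character is defined by \<open>vectorspace.dim\<close>, so an explicit isomorphism
  with a coordinate space is required. A parametrisation \<open>\<phi>\<close> by functions
  supported on \<open>B\<close> supplies both the vector space axioms and this isomorphism, for
  cosets and limit classes alike.\<close>

lemma dim_coord:
  fixes V :: "(complex, 'v, 'm) module_scheme" and \<phi> :: "('i \<Rightarrow> complex) \<Rightarrow> 'v"
  assumes B: "finite B" and car: "carrier V = \<phi> ` {c. \<forall>i. i \<notin> B \<longrightarrow> c i = 0}"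
    and inj: "inj_on \<phi> {c. \<forall>i. i \<notin> B \<longrightarrow> c i = 0}"
    and add: "\<And>c d. (\<forall>i. i \<notin> B \<longrightarrow> c i = 0) \<Longrightarrow> (\<forall>i. i \<notin> B \<longrightarrow> d i = 0) \<Longrightarrow>
      \<phi> c \<oplus>\<^bsub>V\<^esub> \<phi> d = \<phi> (\<lambda>i. c i + d i)"
    and smult: "\<And>k c. (\<forall>i. i \<notin> B \<longrightarrow> c i = 0) \<Longrightarrow> k \<odot>\<^bsub>V\<^esub> \<phi> c = \<phi> (\<lambda>i. k * c i)"
    and zero: "\<zero>\<^bsub>V\<^esub> = \<phi> (\<lambda>_. 0)"
  shows "vectorspace class_ring V" "vectorspace.dim class_ring V = card B"
proof -
  let ?F = "{c. \<forall>i. i \<notin> B \<longrightarrow> c i = (0 :: complex)}"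
  have carE: "\<exists>c. v = \<phi> c \<and> (\<forall>i. i \<notin> B \<longrightarrow> c i = 0)" if "v \<in> carrier V" for v
    using that car by auto
  have carI: "\<phi> c \<in> carrier V" if "\<forall>i. i \<notin> B \<longrightarrow> c i = 0" for c
    using that car by auto
  show vs: "vectorspace class_ring V"
  proof (rule vs_criteria)
    show "field (class_ring :: complex ring)" by (rule class_field)
    show "\<zero>\<^bsub>V\<^esub> \<in> carrier V" unfolding zero by (rule carI) simp
    show "\<forall>v w. v \<in> carrier V \<and> w \<in> carrier V \<longrightarrow> v \<oplus>\<^bsub>V\<^esub> w \<in> carrier V"
      by (auto dest!: carE simp: add intro!: carI)
    show "\<forall>v\<in>carrier V. \<exists>neg_v\<in>carrier V. v \<oplus>\<^bsub>V\<^esub> neg_v = \<zero>\<^bsub>V\<^esub>"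
    proof
      fix v assume "v \<in> carrier V"
      then obtain c where c: "v = \<phi> c" "\<forall>i. i \<notin> B \<longrightarrow> c i = 0" using carE by blast
      then have "v \<oplus>\<^bsub>V\<^esub> \<phi> (\<lambda>i. - c i) = \<zero>\<^bsub>V\<^esub>" by (simp add: add zero)
      moreover have "\<phi> (\<lambda>i. - c i) \<in> carrier V" using c by (intro carI) simp
      ultimately show "\<exists>neg_v\<in>carrier V. v \<oplus>\<^bsub>V\<^esub> neg_v = \<zero>\<^bsub>V\<^esub>" by blast
    qed
    show "\<forall>c v. c \<in> carrier class_ring \<and> v \<in> carrier V \<longrightarrow> c \<odot>\<^bsub>V\<^esub> v \<in> carrier V"
      by (auto dest!: carE simp: smult intro!: carI)
    show "\<forall>v w. v \<in> carrier V \<and> w \<in> carrier V \<longrightarrow> v \<oplus>\<^bsub>V\<^esub> w = w \<oplus>\<^bsub>V\<^esub> v"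
      by (auto dest!: carE simp: add add.commute)
    show "\<forall>v w x. v \<in> carrier V \<and> w \<in> carrier V \<and> x \<in> carrier V \<longrightarrow>
        v \<oplus>\<^bsub>V\<^esub> w \<oplus>\<^bsub>V\<^esub> x = v \<oplus>\<^bsub>V\<^esub> (w \<oplus>\<^bsub>V\<^esub> x)"
      by (auto dest!: carE simp: add add.assoc)
    show "\<forall>v\<in>carrier V. v \<oplus>\<^bsub>V\<^esub> \<zero>\<^bsub>V\<^esub> = v"
      by (auto dest!: carE simp: add zero)
    show "\<forall>a b v. a \<in> carrier class_ring \<and> b \<in> carrier class_ring \<and> v \<in> carrier V \<longrightarrow>
        a \<otimes>\<^bsub>class_ring\<^esub> b \<odot>\<^bsub>V\<^esub> v = a \<odot>\<^bsub>V\<^esub> (b \<odot>\<^bsub>V\<^esub> v)"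
      by (auto dest!: carE simp: smult mult.assoc)
    show "\<forall>v\<in>carrier V. \<one>\<^bsub>class_ring\<^esub> \<odot>\<^bsub>V\<^esub> v = v"
      by (auto dest!: carE simp: smult)
    show "\<forall>a b v. a \<in> carrier class_ring \<and> b \<in> carrier class_ring \<and> v \<in> carrier V \<longrightarrow>
        (a \<oplus>\<^bsub>class_ring\<^esub> b) \<odot>\<^bsub>V\<^esub> v = a \<odot>\<^bsub>V\<^esub> v \<oplus>\<^bsub>V\<^esub> b \<odot>\<^bsub>V\<^esub> v"
      by (auto dest!: carE simp: smult add distrib_right)
    show "\<forall>a v w. a \<in> carrier class_ring \<and> v \<in> carrier V \<and> w \<in> carrier V \<longrightarrow>
        a \<odot>\<^bsub>V\<^esub> (v \<oplus>\<^bsub>V\<^esub> w) = a \<odot>\<^bsub>V\<^esub> v \<oplus>\<^bsub>V\<^esub> a \<odot>\<^bsub>V\<^esub> w"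
      by (auto dest!: carE simp: smult add distrib_left)
  qed
  interpret V: vectorspace class_ring V by (rule vs)
  interpret vec: vec_space "TYPE(complex)" "card B" .
  obtain e where e: "bij_betw e {0..<card B} B" using ex_bij_betw_nat_finite[OF B] by blast
  define g where "g = inv_into {0..<card B} e"
  have ge: "g (e j) = j" "e j \<in> B" if "j < card B" for j
    using that e by (auto simp: g_def bij_betw_def inv_into_f_f)
  have eg: "e (g i) = i" "g i < card B" if "i \<in> B" for i
    using that e f_inv_into_f[of i e "{0..<card B}"] inv_into_into[of i e "{0..<card B}"]
    by (auto simp: g_def bij_betw_def)
  define x where "x v = (\<lambda>i. if i \<in> B then vec_index v (g i) else (0 :: complex))" for v
  define T where "T v = \<phi> (x v)" for v
  have x0: "\<forall>i. i \<notin> B \<longrightarrow> x v i = 0" for v by (simp add: x_def)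
  have lin: "linear_map class_ring (module_vec TYPE(complex) (card B)) V T"
  proof unfold_locales
    have xa: "x (v + w) = (\<lambda>i. x v i + x w i)" if "v \<in> carrier_vec (card B)" "w \<in> carrier_vec (card B)" for v w
      using that eg(2) by (auto simp: x_def fun_eq_iff)
    have xs: "x (k \<cdot>\<^sub>v v) = (\<lambda>i. k * x v i)" if "v \<in> carrier_vec (card B)" for k v
      using that eg(2) by (auto simp: x_def fun_eq_iff)
    show "T \<in> LinearCombinations.module_hom class_ring (module_vec TYPE(complex) (card B)) V"
      unfolding LinearCombinations.module_hom_def module_vec_simps
      using carI[OF x0] add[OF x0 x0] smult[OF x0] by (auto simp: T_def xa xs)
  qed
  have injT: "inj_on T (carrier (module_vec TYPE(complex) (card B)))"
  proof (rule inj_onI)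
    fix v w assume vw: "v \<in> carrier (module_vec TYPE(complex) (card B))" "w \<in> carrier (module_vec TYPE(complex) (card B))" "T v = T w"
    then have "x v = x w" using inj x0 unfolding T_def by (auto dest: inj_onD)
    then have xe: "x v (e j) = x w (e j)" for j by (rule fun_cong)
    have "vec_index v j = vec_index w j" if "j < card B" for j
      using xe[of j] ge[OF that] by (simp add: x_def)
    then show "v = w" using vw by (intro eq_vecI) (auto simp: module_vec_simps)
  qed
  have surjT: "T ` carrier (module_vec TYPE(complex) (card B)) = carrier V"
  proof
    show "T ` carrier (module_vec TYPE(complex) (card B)) \<subseteq> carrier V" using carI[OF x0] by (auto simp: T_def)
    show "carrier V \<subseteq> T ` carrier (module_vec TYPE(complex) (card B))"
    proof
      fix v assume "v \<in> carrier V"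
      then obtain c where c: "v = \<phi> c" "\<forall>i. i \<notin> B \<longrightarrow> c i = 0" using carE by blast
      have "x (Matrix.vec (card B) (\<lambda>j. c (e j))) = c"
        using c(2) eg by (auto simp: x_def fun_eq_iff)
      then show "v \<in> T ` carrier (module_vec TYPE(complex) (card B))"
        using c(1) by (intro image_eqI[of _ _ "Matrix.vec (card B) (\<lambda>j. c (e j))"]) (auto simp: T_def module_vec_simps)
    qed
  qed
  have "vec.dim = V.dim"
    by (rule linear_map.dim_eq[OF lin _ injT surjT]) (rule vec.fin_dim)
  then show "vectorspace.dim class_ring V = card B" by (simp only: vec.dim_is_n)
qed

section \<open>Homogeneous lifts of the basis vectors to the free algebra\<close>

definition hom_deg :: "tensor \<Rightarrow> int \<Rightarrow> bool" where
  "hom_deg p d \<longleftrightarrow> p \<in> tensors \<and> (\<forall>w\<in>Poly_Mapping.keys p. t_degree w = d)"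

lemma hom_deg_mult: "hom_deg p d \<Longrightarrow> hom_deg q e \<Longrightarrow> hom_deg (p * q) (d + e)"
  using keys_mult[of p q] by (fastforce simp: hom_deg_def t_degree_plus)

lemma hom_deg_sum: "(\<And>i. i \<in> A \<Longrightarrow> hom_deg (f i) d) \<Longrightarrow> hom_deg (sum f A) d"
proof (induction A rule: infinite_finite_induct)
  case (insert x A)
  then show ?case using keys_add[of "f x" "sum f A"] by (fastforce simp: hom_deg_def)
qed (auto simp: hom_deg_def)

lemma hom_deg_scal: "hom_deg (scal c) 0" and hom_deg_gen: "l \<in> twisted \<Longrightarrow> hom_deg (gen l) (int (snd l))"
  and hom_deg_1: "hom_deg 1 0"
  by (auto simp: hom_deg_def scal_def gen_def t_degree_def zero_osp_word_def tensors_single split: if_splits)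

lemma hom_deg_scal_mult: "hom_deg p d \<Longrightarrow> hom_deg (scal c * p) d"
  using hom_deg_mult[OF hom_deg_scal] by fastforce

lemma hom_deg_power: "hom_deg p d \<Longrightarrow> hom_deg (p ^ k) (int k * d)"
proof (induction k)
  case (Suc k)
  have "d + int k * d = int (Suc k) * d" by (simp add: algebra_simps)
  then show ?case using hom_deg_mult[OF Suc.prems Suc.IH[OF Suc.prems]] by (simp only: power_Suc)
qed (simp add: hom_deg_1)

lemma hom_deg_prod_list:
  "(\<And>x. x \<in> set xs \<Longrightarrow> hom_deg (f x) (d x)) \<Longrightarrow> hom_deg (prod_list (map f xs)) (sum_list (map d xs))"
  by (induction xs) (auto intro: hom_deg_1 hom_deg_mult)

text \<open>The lift of \<open>es\<close> along \<open>cls\<close>. It is needed because t-degree is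
  defined on words, whereas \<open>uea\<close> carries no grading.\<close>

fun tes :: "nat \<Rightarrow> tensor" where
  "tes 0 = 1"
| "tes (Suc s) = scal (1 / of_nat (Suc s)) *
     (\<Sum>k\<le>s. scal ((- 1) ^ k) * (scal (1 / 2) * gen (osp_h, 2 * Suc k)) * tes (s - k))"

declare tes.simps(2) [simp del]

lemma twisted_mem [simp]:
  "(osp_e, i) \<in> twisted \<longleftrightarrow> even i" "(osp_h, i) \<in> twisted \<longleftrightarrow> even i" "(osp_f, i) \<in> twisted \<longleftrightarrow> even i"
  "(osp_gp, i) \<in> twisted \<longleftrightarrow> odd i" "(osp_gm, i) \<in> twisted \<longleftrightarrow> odd i"
  by (auto simp: twisted_def)

lemma tes_hom_cls: "hom_deg (tes s) (2 * int s) \<and> cls (tes s) = es s"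
proof (induction s rule: less_induct)
  case (less s)
  show ?case
  proof (cases s)
    case 0
    then show ?thesis by (simp add: hom_deg_1)
  next
    case (Suc t)
    let ?f = "\<lambda>k. scal ((- 1) ^ k) * (scal (1 / 2) * gen (osp_h, 2 * Suc k)) * tes (t - k)"
    have IH: "hom_deg (tes (t - k)) (2 * int (t - k))" "cls (tes (t - k)) = es (t - k)" if "k \<le> t" for k
      using less[of "t - k"] Suc that by auto
    have f: "hom_deg (?f k) (2 * int s)" if "k \<le> t" for k
    proof -
      have "hom_deg (?f k) (int (2 * Suc k) + 2 * int (t - k))"
        using hom_deg_gen[of "(osp_h, 2 * Suc k)"]
        by (intro hom_deg_mult hom_deg_scal_mult IH[OF that]) simp
      moreover have "int (2 * Suc k) + 2 * int (t - k) = 2 * int s" using that Suc by (simp add: of_nat_diff)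
      ultimately show ?thesis by (simp only:)
    qed
    have c: "cls (?f k) = sc ((- 1) ^ k) * pp (Suc k) * es (t - k)" if "k \<le> t" for k
      using IH[OF that] by (simp add: cls_mult hom_deg_def sc_def pp_def hh_def lt_def mult.assoc)
    have "hom_deg (tes s) (2 * int s)"
      unfolding Suc tes.simps using f by (intro hom_deg_scal_mult hom_deg_sum) (simp add: Suc)
    moreover have "cls (tes s) = sc (1 / of_nat (Suc t)) * cls (\<Sum>k\<le>t. ?f k)"
      unfolding Suc tes.simps sc_def using f by (intro cls_mult tensors_scal tensors_sum) (auto simp: hom_deg_def)
    moreover have "cls (\<Sum>k\<le>t. ?f k) = (\<Sum>k\<le>t. sc ((- 1) ^ k) * pp (Suc k) * es (t - k))"
      using f c by (subst cls_sum) (auto simp: hom_deg_def)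
    ultimately show ?thesis unfolding Suc es.simps by simp
  qed
qed

definition basis_tensor :: "nat \<Rightarrow> index \<Rightarrow> tensor" where
  "basis_tensor n = (\<lambda>(S, k, \<mu>). prod_list (map tes \<mu>) * (gen (osp_e, 0) ^ k *
     prod_list (map (\<lambda>j. gen (osp_gp, 2 * j + 1)) (sorted_list_of_set ({..<n} - S)))))"

definition idx :: "nat \<Rightarrow> index set" where "idx n = {i \<in> all_idx. fst i \<subseteq> {..<n}}"

text \<open>All \<open>n\<close> odd letters together have t-degree
  \<open>1 + 3 + ... + (2n - 1) = n^2\<close>. Those in \<open>S\<close> are absent and the
  symmetric operators contribute twice the size of the partition.\<close>

definition tdeg :: "nat \<Rightarrow> index \<Rightarrow> int" where "tdeg n i = int (n\<^sup>2) - idx_degree i"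

lemma cls_basis_tensor: "cls (basis_tensor n (S, k, \<mu>)) = es_prod \<mu> * (ee 0 ^ k * gp_prod (sorted_list_of_set ({..<n} - S)))"
  and hom_deg_basis_tensor: "S \<subseteq> {..<n} \<Longrightarrow> hom_deg (basis_tensor n (S, k, \<mu>)) (tdeg n (S, k, \<mu>))"
proof -
  let ?J = "sorted_list_of_set ({..<n} - S)"
  let ?g = "\<lambda>j. gen (osp_gp, 2 * j + 1)"
  have h1: "hom_deg (prod_list (map tes \<mu>)) (sum_list (map (\<lambda>s. 2 * int s) \<mu>))"
    by (rule hom_deg_prod_list) (simp add: tes_hom_cls)
  have h2: "hom_deg (gen (osp_e, 0) ^ k) (int k * 0)"
    using hom_deg_gen[of "(osp_e, 0)"] by (intro hom_deg_power) simp
  have h3: "hom_deg (prod_list (map ?g ?J)) (sum_list (map (\<lambda>j. int (2 * j + 1)) ?J))"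
  proof (rule hom_deg_prod_list)
    fix j
    show "hom_deg (?g j) (int (2 * j + 1))" using hom_deg_gen[of "(osp_gp, 2 * j + 1)"] by simp
  qed
  have c1: "cls (prod_list (map tes \<mu>)) = es_prod \<mu>"
    using tes_hom_cls by (subst cls_prod_list) (auto simp: hom_deg_def es_prod_def comp_def)
  have c3: "cls (prod_list (map ?g ?J)) = gp_prod ?J"
    by (subst cls_prod_list) (auto simp: gp_prod_def comp_def gp_def[abs_def] lt_def)
  show "cls (basis_tensor n (S, k, \<mu>)) = es_prod \<mu> * (ee 0 ^ k * gp_prod ?J)"
    using h1 h2 h3 c1 c3 by (simp add: basis_tensor_def hom_deg_def cls_mult cls_power ee_def lt_def)
  have m2: "sum_list (map (\<lambda>s. 2 * int s) \<mu>) = 2 * int (sum_list \<mu>)" by (induction \<mu>) auto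
  assume S: "S \<subseteq> {..<n}"
  have "sum_list (map (\<lambda>j. int (2 * j + 1)) ?J) = (\<Sum>j\<in>{..<n} - S. int (2 * j + 1))"
    by (subst sum_list_distinct_conv_sum_set) auto
  also have "\<dots> = (\<Sum>j<n. int (2 * j + 1)) - int (osum S)"
    using S by (subst sum_diff) (auto simp: osum_def intro: finite_subset)
  also have "(\<Sum>j<n. int (2 * j + 1)) = int (n\<^sup>2)"
    by (induction n) (auto simp: power2_eq_square algebra_simps)
  finally have "sum_list (map (\<lambda>s. 2 * int s) \<mu>) + (int k * 0 + sum_list (map (\<lambda>j. int (2 * j + 1)) ?J)) = tdeg n (S, k, \<mu>)"
    by (simp add: tdeg_def idx_degree_def m2)
  then show "hom_deg (basis_tensor n (S, k, \<mu>)) (tdeg n (S, k, \<mu>))"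
    using hom_deg_mult[OF h1 hom_deg_mult[OF h2 h3]] by (simp add: basis_tensor_def)
qed

lemma idx_Sigma: "idx n = (SIGMA S:Pow {..<n}. SIGMA k:{..card S}. box_lists k (card S - k))"
  by (auto simp: idx_def all_idx_def intro: finite_subset)

lemma finite_idx: "finite (idx n)"
  unfolding idx_Sigma by (intro finite_SigmaI) auto

text \<open>For fixed \<open>S\<close> the binomials sum to \<open>2^|S|\<close>, and summing over
  \<open>S\<close> gives \<open>(2 + 1)^n\<close>, which matches the dimension of the tensor
  product.\<close>

lemma card_idx: "card (idx n) = 3 ^ n"
proof -
  have "card (SIGMA k:{..m}. box_lists k (m - k)) = 2 ^ m" for m
    by (simp add: card_SigmaI card_box_lists choose_row_sum)
  then have "card (idx n) = (\<Sum>S\<in>Pow {..<n}. 2 ^ card S)"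
    unfolding idx_Sigma by (subst card_SigmaI) (auto intro: finite_subset)
  also have "\<dots> = (\<Prod>i<n. 2 + (1 :: nat))"
    by (subst prod_add) auto
  finally show ?thesis by simp
qed

section \<open>The ideal of relations and its image in the enveloping algebra\<close>

lemma weyl_rels_tensors: "weyl_rels n \<subseteq> tensors"
  by (auto simp: weyl_rels_def simp del: power_Suc)

lemma weyl_ideal_tensors: "p \<in> weyl_ideal n \<Longrightarrow> p \<in> tensors"
  unfolding weyl_ideal_def
  by (rule left_ideal_tensors[OF Un_least[OF enveloping_rels_tensors weyl_rels_tensors]])

lemma weyl_ideal_closed:
  "0 \<in> weyl_ideal n" "p \<in> weyl_ideal n \<Longrightarrow> q \<in> weyl_ideal n \<Longrightarrow> p + q \<in> weyl_ideal n"
  "p \<in> weyl_ideal n \<Longrightarrow> q \<in> weyl_ideal n \<Longrightarrow> p - q \<in> weyl_ideal n"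
  "p \<in> weyl_ideal n \<Longrightarrow> q \<in> tensors \<Longrightarrow> q * p \<in> weyl_ideal n"
  "p \<in> weyl_ideal n \<Longrightarrow> - p \<in> weyl_ideal n"
  unfolding weyl_ideal_def
  by (auto intro: left_ideal.zero left_ideal.add left_ideal_diff left_ideal_mult left_ideal_uminus)

definition weyl_cls :: "nat \<Rightarrow> uea set" where "weyl_cls n = cls ` weyl_ideal n"

text \<open>The ideal of relations contains the enveloping ideal, so membership can be tested after
  passing to \<open>uea\<close>.\<close>

lemma cls_mem_weyl_cls:
  assumes "p \<in> tensors" shows "cls p \<in> weyl_cls n \<longleftrightarrow> p \<in> weyl_ideal n"
proof
  assume "cls p \<in> weyl_cls n"
  then obtain q where q: "q \<in> weyl_ideal n" "cls p = cls q" by (auto simp: weyl_cls_def)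
  then have "p - q \<in> left_ideal enveloping_rels"
    using cls_eq_iff[OF assms] weyl_ideal_tensors by blast
  then have "p - q \<in> weyl_ideal n"
    unfolding weyl_ideal_def by (rule left_ideal_mono) auto
  from weyl_ideal_closed(2)[OF this q(1)] show "p \<in> weyl_ideal n" by simp
qed (simp add: weyl_cls_def)

interpretation W: weyl_left_ideal "weyl_cls n" n for n
proof
  have r: "cls r \<in> weyl_cls n" if "r \<in> weyl_rels n" for r
    using that by (auto simp: weyl_cls_def weyl_ideal_def intro!: imageI left_ideal_gen)
  have m: "x * y \<in> weyl_cls n" if y: "y \<in> weyl_cls n" for x y
  proof -
    obtain p where "p \<in> tensors" "x = cls p" by (rule cls_cases)
    moreover obtain q where "q \<in> weyl_ideal n" "y = cls q" using y by (auto simp: weyl_cls_def)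
    ultimately show ?thesis
      using cls_mem_weyl_cls[of "p * q" n] weyl_ideal_closed(4) weyl_ideal_tensors by (simp add: cls_mult)
  qed
  then show "\<And>x y. y \<in> weyl_cls n \<Longrightarrow> x * y \<in> weyl_cls n" .
  show "uea.subspace (weyl_cls n)"
    unfolding uea.subspace_def
  proof (intro conjI ballI allI)
    show "0 \<in> weyl_cls n" using weyl_ideal_closed(1) cls_mem_weyl_cls[of 0 n] by simp
    fix x y assume "x \<in> weyl_cls n" "y \<in> weyl_cls n"
    then obtain p q where "p \<in> weyl_ideal n" "q \<in> weyl_ideal n" "x = cls p" "y = cls q"
      by (auto simp: weyl_cls_def)
    then show "x + y \<in> weyl_cls n"
      using cls_mem_weyl_cls[of "p + q" n] weyl_ideal_closed(2) weyl_ideal_tensors by (simp add: cls_add)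
  qed (rule m)
  show "ff i \<in> weyl_cls n" for i using r[of "gen (osp_f, 2 * i)"] by (auto simp: ff_def lt_def weyl_rels_def)
  show "gm i \<in> weyl_cls n" for i using r[of "gen (osp_gm, 2 * i + 1)"] by (auto simp: gm_def lt_def weyl_rels_def)
  show "hh (Suc i) \<in> weyl_cls n" for i using r[of "gen (osp_h, 2 * i + 2)"] by (auto simp: hh_def lt_def weyl_rels_def)
  have "cls (gen (osp_h, 0) + scal (of_nat n)) \<in> weyl_cls n" by (rule r) (simp add: weyl_rels_def)
  then show "hh 0 + of_nat n \<in> weyl_cls n"
    by (simp add: cls_add hh_def lt_def flip: sc_def sc_of_nat)
  have "cls (gen (osp_e, 0) ^ (n + 1)) \<in> weyl_cls n" by (rule r) (simp add: weyl_rels_def)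
  then show "ee 0 ^ (n + 1) \<in> weyl_cls n"
    using cls_power[of "gen (osp_e, 0)" "n + 1"] by (simp add: ee_def lt_def del: power_Suc)
qed

lemma basis_tensor_tensors: "i \<in> idx n \<Longrightarrow> basis_tensor n i \<in> tensors"
  using hom_deg_basis_tensor by (cases i) (auto simp: idx_def hom_deg_def)

lemma comb_tensors [simp]: "(\<Sum>i\<in>idx n. scal (c i) * basis_tensor n i) \<in> tensors"
  by (intro tensors_sum tensors_mult tensors_scal basis_tensor_tensors)

lemma basis_tensor_spanning:
  assumes "p \<in> tensors"
  shows "\<exists>c. p - (\<Sum>i\<in>idx n. scal (c i) * basis_tensor n i) \<in> weyl_ideal n"
proof -
  have "cls p \<in> uea.span (weyl_cls n \<union> W.basis_vectors n)" by (rule W.spanning)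
  then have "\<exists>c. cls p - (\<Sum>i\<in>idx n. sc (c i) * cls (basis_tensor n i)) \<in> weyl_cls n"
  proof (induction rule: uea.span_induct_alt)
    case base
    have "0 - (\<Sum>i\<in>idx n. sc 0 * cls (basis_tensor n i)) \<in> weyl_cls n" by (simp add: W.SI)
    then show ?case by (rule exI[of _ "\<lambda>_. 0"])
  next
    case (step e x y)
    then obtain c where c: "y - (\<Sum>i\<in>idx n. sc (c i) * cls (basis_tensor n i)) \<in> weyl_cls n" by blast
    from step(1) show ?case
    proof
      assume x: "x \<in> weyl_cls n"
      have "sc e * x + y - (\<Sum>i\<in>idx n. sc (c i) * cls (basis_tensor n i)) = sc e * x + (y - (\<Sum>i\<in>idx n. sc (c i) * cls (basis_tensor n i)))"
        by simp
      also have "\<dots> \<in> weyl_cls n" by (intro W.SI(2) W.SI(4) x c)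
      finally show ?thesis by (rule exI[of _ c])
    next
      assume "x \<in> W.basis_vectors n"
      then obtain \<mu> a J where J: "x = es_prod \<mu> * (ee 0 ^ a * gp_prod J)" "sorted_wrt (<) J" "set J \<subseteq> {..<n}"
        "a \<le> n - length J" "\<mu> \<in> box_lists a (n - length J - a)" by (auto simp: W.basis_vectors_def)
      \<comment> \<open>\<open>S\<close> records the absent odd letters, so sorting its complement
        gives back \<open>J\<close>.\<close>
      define S where "S = {..<n} - set J"
      have "card (set J) = length J" using J(2) by (simp add: strict_sorted_iff distinct_card)
      then have card: "card S = n - length J" using J(3) by (simp add: S_def card_Diff_subset finite_subset[OF J(3)])
      have "{..<n} - S = set J" using J(3) by (auto simp: S_def)
      then have l: "sorted_list_of_set ({..<n} - S) = J"
        using J(2) by (simp add: strict_sorted_iff sorted_list_of_set.idem_if_sorted_distinct)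
      have k: "(S, a, \<mu>) \<in> idx n" using J card by (auto simp: idx_def all_idx_def S_def)
      have x: "x = cls (basis_tensor n (S, a, \<mu>))" by (simp add: cls_basis_tensor l J(1))
      define d where "d i = (if i = (S, a, \<mu>) then e else 0) + c i" for i
      have "(\<Sum>i\<in>idx n. sc (d i) * cls (basis_tensor n i)) = (\<Sum>i\<in>idx n. if i = (S, a, \<mu>) then sc e * cls (basis_tensor n i) else 0)
          + (\<Sum>i\<in>idx n. sc (c i) * cls (basis_tensor n i))"
        unfolding sum.distrib[symmetric] by (intro sum.cong refl) (auto simp: d_def sc_add distrib_right)
      also have "(\<Sum>i\<in>idx n. if i = (S, a, \<mu>) then sc e * cls (basis_tensor n i) else 0) = sc e * x"
        using k finite_idx x by simp
      finally have "sc e * x + y - (\<Sum>i\<in>idx n. sc (d i) * cls (basis_tensor n i)) \<in> weyl_cls n"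
        using c by simp
      then show ?thesis by (rule exI[of _ d])
    qed
  qed
  then obtain c where "cls p - (\<Sum>i\<in>idx n. sc (c i) * cls (basis_tensor n i)) \<in> weyl_cls n" by blast
  also have "cls p - (\<Sum>i\<in>idx n. sc (c i) * cls (basis_tensor n i)) = cls (p - (\<Sum>i\<in>idx n. scal (c i) * basis_tensor n i))"
    using assms basis_tensor_tensors by (simp add: cls_diff cls_sum cls_mult sc_def)
  finally have "p - (\<Sum>i\<in>idx n. scal (c i) * basis_tensor n i) \<in> weyl_ideal n"
    using assms by (subst (asm) cls_mem_weyl_cls) auto
  then show ?thesis by blast
qed

interpretation B: spanning_family n "idx n" "basis_tensor n" "tdeg n" for n
proof
  show "card (idx n) \<le> 3 ^ n" by (simp add: card_idx)
  show "t_degree w = tdeg n i" if "i \<in> idx n" "w \<in> Poly_Mapping.keys (basis_tensor n i)" for i w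
    using that hom_deg_basis_tensor by (cases i) (auto simp: idx_def hom_deg_def)
qed (auto simp: finite_idx basis_tensor_tensors basis_tensor_spanning)

text \<open>The generator has weight \<open>-n\<close>, each \<open>ee 0\<close> adds 2, each of the
  \<open>n - card S\<close> odd letters adds 1, and the \<open>es\<close> commute with
  \<open>hh 0\<close>. The total \<open>2 k - card S\<close> is independent of
  \<open>n\<close>.\<close>

lemma hh_0_basis_tensor:
  assumes "i \<in> idx n"
  shows "gen (osp_h, 0) * basis_tensor n i - scal (of_int (idx_weight i)) * basis_tensor n i \<in> weyl_ideal n"
proof -
  obtain S k \<mu> where i: "i = (S, k, \<mu>)" by (cases i)
  let ?J = "sorted_list_of_set ({..<n} - S)"
  have S: "S \<subseteq> {..<n}" using assms by (simp add: idx_def i)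
  have len: "int (length ?J) = int n - int (card S)"
    using S card_mono[OF _ S] by (simp add: card_Diff_subset finite_subset[OF S] of_nat_diff)
  have "hh 0 * es_prod \<mu> = es_prod \<mu> * hh 0"
  proof (induction \<mu>)
    case (Cons s \<mu>)
    have "hh 0 * es s = es s * hh 0" by (rule es_commute) (rule hh_0_pp)
    then show ?case using Cons by simp (metis mult.assoc)
  qed simp
  then have h1: "hh 0 * (es_prod \<mu> * x) = es_prod \<mu> * (hh 0 * x)" for x by (metis mult.assoc)
  have "of_nat k * (ee 0 ^ (k - 1) * ee 0) = of_nat k * ee 0 ^ k"
    by (cases k) (simp_all add: power_commutes)
  then have "hh 0 * ee 0 ^ k = ee 0 ^ k * hh 0 + of_nat (2 * k) * ee 0 ^ k"
    using pp_ee_power[of 0 k] by (simp only: hh_pp mult.assoc of_nat_mult distrib_left of_nat_numeral)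
      (simp only: mult_2 distrib_left)
  from arg_cong[OF this, of "\<lambda>y. y * x" for x]
  have h2: "hh 0 * (ee 0 ^ k * x) = ee 0 ^ k * (hh 0 * x) + of_nat (2 * k) * (ee 0 ^ k * x)" for x
    by (simp only: distrib_right mult.assoc)
  let ?b = "es_prod \<mu> * (ee 0 ^ k * gp_prod ?J)"
  have "hh 0 * ?b = ?b * hh 0 + of_nat (2 * k + length ?J) * ?b"
    unfolding h1 h2 hh_0_gp_prod
    by (simp only: distrib_left distrib_right of_nat_left_commute of_nat_add mult.assoc) (simp only: add_ac)
  moreover have "sc (of_int (idx_weight i)) = of_nat (2 * k + length ?J) - of_nat n"
  proof -
    have "(of_int (idx_weight i) :: complex) = of_nat (2 * k + length ?J) - of_nat n"
      using arg_cong[OF len, of "of_int :: int \<Rightarrow> complex"] by (simp add: i idx_weight_def)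
    then show ?thesis by (simp only: sc_diff sc_of_nat)
  qed
  ultimately have "hh 0 * ?b - sc (of_int (idx_weight i)) * ?b = ?b * (hh 0 + of_nat n)"
    by (simp add: left_diff_distrib distrib_left mult_of_nat_commute)
  also have "\<dots> \<in> weyl_cls n" by (intro W.mult_I W.hh_0_I)
  finally have "cls (gen (osp_h, 0) * basis_tensor n i - scal (of_int (idx_weight i)) * basis_tensor n i) \<in> weyl_cls n"
    using basis_tensor_tensors[OF assms] cls_basis_tensor[of n S k \<mu>] by (simp add: cls_diff cls_mult i sc_def hh_def lt_def)
  then show ?thesis using basis_tensor_tensors[OF assms] by (subst (asm) cls_mem_weyl_cls) auto
qed

text \<open>The vector \<open>gp n\<close> satisfies the relations of the smaller module inside the
  larger one: positive \<open>hh\<close> turn it into some \<open>gp j\<close> with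
  \<open>j > n\<close>, which vanishes by \<open>gp_I\<close>, and \<open>gm\<close> turns it into a
  positive \<open>hh\<close>. This makes \<open>weyl_emb\<close> well defined.\<close>

lemma weyl_ideal_embed:
  assumes "p \<in> weyl_ideal n"
  shows "p * gen (osp_gp, 2 * n + 1) \<in> weyl_ideal (Suc n)"
proof -
  let ?g = "gen (osp_gp, 2 * n + 1)"
  have gt: "?g \<in> tensors" by simp
  have cg: "cls ?g = gp n" by (simp add: gp_def lt_def)
  have I: "x * y \<in> weyl_cls (Suc n)" if "y \<in> weyl_cls (Suc n)" for x y by (rule W.mult_I[OF that])
  have gpI: "gp j \<in> weyl_cls (Suc n)" if "j > n" for j by (rule W.gp_I) (use that in simp)
  have ff: "ff i * gp n \<in> weyl_cls (Suc n)" for i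
    unfolding bracket_eqs(12) by (intro W.SI(3) I W.ff_I W.gm_I)
  have gm: "gm i * gp n \<in> weyl_cls (Suc n)" for i
    unfolding bracket_eqs(9) using W.hh_I[of "i + n" "Suc n"] by (intro W.SI(3) I W.gm_I) simp
  have hh: "hh (Suc i) * gp n \<in> weyl_cls (Suc n)" for i
    unfolding bracket_eqs(7) by (intro W.SI(2) I W.hh_I gpI) simp
  have "(hh 0 + of_nat n) * gp n = gp n * (hh 0 + of_nat (Suc n))"
    by (simp add: distrib_left distrib_right bracket_eqs(7) mult_of_nat_commute)
  then have h0: "(hh 0 + of_nat n) * gp n \<in> weyl_cls (Suc n)" using I[OF W.hh_0_I] by metis
  have ec: "ee 0 ^ k * gp n = gp n * ee 0 ^ k" for k
    by (rule power_commuting_commutes) (rule bracket_eqs(15))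
  interpret lw: lowest_weight "weyl_cls (Suc n)" "gp n" n "Suc n + 1"
  proof
    show "ev_stable (weyl_cls (Suc n))" by (rule W.ev_stable_I)
    show "hh 0 * gp n + of_nat n * gp n \<in> weyl_cls (Suc n)" using h0 by (simp add: distrib_right)
    show "ee 0 ^ (Suc n + 1) * gp n \<in> weyl_cls (Suc n)" unfolding ec by (intro I W.ee_I)
  qed (rule ff hh)+
  \<comment> \<open>The larger module only provides the exponent \<open>n + 2\<close>; the lowest
    weight \<open>-n\<close> of \<open>gp n\<close> improves it to \<open>n + 1\<close>.\<close>
  have e: "ee 0 ^ (n + 1) * gp n \<in> weyl_cls (Suc n)" by (rule lw.power_vanish) simp
  have rel: "r * ?g \<in> weyl_ideal (Suc n)" if r: "r \<in> weyl_rels n" for r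
  proof -
    have rt: "r \<in> tensors" using r weyl_rels_tensors by blast
    have "cls r * gp n \<in> weyl_cls (Suc n)"
    proof -
      consider i where "r = gen (osp_f, 2 * i)" | i where "r = gen (osp_gm, 2 * i + 1)" | i where "r = gen (osp_h, 2 * Suc i)"
        | "r = gen (osp_h, 0) + scal (of_nat n)" | "r = gen (osp_e, 0) ^ (n + 1)"
        using r by (auto simp: weyl_rels_def)
      then show ?thesis
      proof cases
        case (1 i) then show ?thesis using ff[of i] by (simp add: ff_def lt_def)
      next
        case (2 i) then show ?thesis using gm[of i] by (simp add: gm_def lt_def)
      next
        case (3 i) then show ?thesis using hh[of i] unfolding hh_def lt_def by (simp only:)
      next
        case 4 then show ?thesis using h0 by (simp add: cls_add hh_def lt_def flip: sc_def sc_of_nat)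
      next
        case 5
        have "cls r = ee 0 ^ (n + 1)" unfolding 5 by (subst cls_power) (simp_all add: ee_def lt_def del: power_Suc)
        then show ?thesis using e by (simp only:)
      qed
    qed
    then have "cls (r * ?g) \<in> weyl_cls (Suc n)" using cls_mult[OF rt gt] cg by (simp only:)
    then show ?thesis by (rule cls_mem_weyl_cls[THEN iffD1, OF tensors_mult[OF rt gt]])
  qed
  show ?thesis
    using assms unfolding weyl_ideal_def
  proof induction
    case (mult p r)
    have "r * ?g \<in> weyl_ideal (Suc n)"
      using mult(2)
    proof
      assume "r \<in> enveloping_rels"
      then have "r * ?g \<in> left_ideal enveloping_rels"
        using enveloping_ideal_mult_right[OF left_ideal_gen gt] by blast
      then show ?thesis unfolding weyl_ideal_def by (rule left_ideal_mono) auto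
    qed (rule rel)
    then have "p * (r * ?g) \<in> weyl_ideal (Suc n)" using mult(1) by (rule weyl_ideal_closed(4))
    then show ?case unfolding weyl_ideal_def by (simp only: mult.assoc)
  next
    case (add p q)
    then show ?case unfolding distrib_right by (intro left_ideal.add)
  qed (simp add: left_ideal.zero)
qed

text \<open>The new index \<open>n\<close> is larger than all others and absent from
  \<open>S\<close>, so it comes last in the sorted product and the equality already holds in the
  free algebra.\<close>

lemma basis_tensor_embed:
  assumes "i \<in> idx n"
  shows "basis_tensor n i * gen (osp_gp, 2 * n + 1) = basis_tensor (Suc n) i"
proof -
  obtain S k \<mu> where i: "i = (S, k, \<mu>)" by (cases i)
  have S: "S \<subseteq> {..<n}" using assms by (simp add: idx_def i)
  have "{..<Suc n} - S = insert n ({..<n} - S)" using S by auto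
  moreover have "sorted_list_of_set (insert n ({..<n} - S)) = sorted_list_of_set ({..<n} - S) @ [n]"
    by (rule sorted_distinct_set_unique) (auto simp: sorted_append less_imp_le sorted_insort distinct_insort set_insort_key)
  ultimately show ?thesis by (simp add: i basis_tensor_def mult.assoc)
qed

section \<open>Operations of the Weyl module on cosets\<close>

lemma mem_weyl_class: "q \<in> weyl_class n p \<longleftrightarrow> q - p \<in> weyl_ideal n"
proof -
  have "q \<in> weyl_class n p \<longleftrightarrow> (\<exists>h\<in>weyl_ideal n. q = h + p)"
    by (simp add: a_r_coset_def')
  also have "\<dots> \<longleftrightarrow> q - p \<in> weyl_ideal n"
    by (metis add_diff_cancel_right' diff_add_cancel)
  finally show ?thesis .
qed

lemma weyl_class_eq: "weyl_class n p = weyl_class n q \<longleftrightarrow> p - q \<in> weyl_ideal n"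
proof
  assume "weyl_class n p = weyl_class n q"
  moreover have "p \<in> weyl_class n p" unfolding mem_weyl_class by (simp add: weyl_ideal_closed)
  ultimately show "p - q \<in> weyl_ideal n" using mem_weyl_class by blast
next
  assume pq: "p - q \<in> weyl_ideal n"
  have "x - p \<in> weyl_ideal n \<longleftrightarrow> x - q \<in> weyl_ideal n" for x
    using weyl_ideal_closed(2)[OF _ pq, of "x - p"] weyl_ideal_closed(3)[OF _ pq, of "x - q"] by auto
  then show "weyl_class n p = weyl_class n q"
    by (intro Set.set_eqI) (simp only: mem_weyl_class)
qed

lemma weyl_class_UN:
  assumes "p \<in> tensors" "\<And>h. h \<in> weyl_ideal n \<Longrightarrow> f (h + p) - f p \<in> weyl_ideal m"
  shows "(\<Union>q\<in>weyl_class n p. weyl_class m (f q)) = weyl_class m (f p)"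
proof -
  have "weyl_class m (f q) = weyl_class m (f p)" if "q \<in> weyl_class n p" for q
    using assms(2)[of "q - p"] that unfolding mem_weyl_class weyl_class_eq by simp
  moreover have "p \<in> weyl_class n p" unfolding mem_weyl_class by (simp add: weyl_ideal_closed)
  ultimately show ?thesis by blast
qed

lemma weyl_carrier: "carrier (weyl n) = {weyl_class n p | p. p \<in> tensors}"
  by (auto simp: weyl_def A_RCOSETS_def')

lemma weyl_add: "weyl_class n p \<oplus>\<^bsub>weyl n\<^esub> weyl_class n q = weyl_class n (p + q)"
proof -
  have "weyl_class n p \<oplus>\<^bsub>weyl n\<^esub> weyl_class n q = {x + y | x y. x \<in> weyl_class n p \<and> y \<in> weyl_class n q}"
    by (auto simp: weyl_def set_add_def')
  also have "\<dots> = weyl_class n (p + q)"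
  proof (intro equalityI subsetI)
    fix z assume "z \<in> {x + y | x y. x \<in> weyl_class n p \<and> y \<in> weyl_class n q}"
    then obtain x y where "z = x + y" "x - p \<in> weyl_ideal n" "y - q \<in> weyl_ideal n"
      unfolding mem_weyl_class by blast
    then show "z \<in> weyl_class n (p + q)"
      using weyl_ideal_closed(2)[of "x - p" n "y - q"] unfolding mem_weyl_class by (simp add: algebra_simps)
  next
    fix z assume "z \<in> weyl_class n (p + q)"
    then have "(z - q) - p \<in> weyl_ideal n" "q - q \<in> weyl_ideal n"
      unfolding mem_weyl_class by (simp_all add: algebra_simps weyl_ideal_closed)
    moreover have "z = (z - q) + q" by simp
    ultimately show "z \<in> {x + y | x y. x \<in> weyl_class n p \<and> y \<in> weyl_class n q}"
      unfolding mem_weyl_class by blast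
  qed
  finally show ?thesis .
qed

lemma weyl_smult: "p \<in> tensors \<Longrightarrow> c \<odot>\<^bsub>weyl n\<^esub> weyl_class n p = weyl_class n (scal c * p)"
  unfolding weyl_def module.simps
  by (rule weyl_class_UN) (simp_all add: distrib_left weyl_ideal_closed)

lemma weyl_act: "p \<in> tensors \<Longrightarrow> l \<in> twisted \<Longrightarrow> act (weyl n) l (weyl_class n p) = weyl_class n (gen l * p)"
  unfolding weyl_def osp_module.simps
  by (rule weyl_class_UN) (simp_all add: distrib_left weyl_ideal_closed)

lemma weyl_emb_class:
  "p \<in> tensors \<Longrightarrow> weyl_emb n (weyl_class n p) = weyl_class (Suc n) (p * gen (osp_gp, 2 * n + 1))"
  unfolding weyl_emb_def
  by (rule weyl_class_UN) (simp_all add: distrib_right weyl_ideal_embed[simplified])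

subsection \<open>Coordinates\<close>

definition comb :: "nat \<Rightarrow> (index \<Rightarrow> complex) \<Rightarrow> tensor" where
  "comb n c = (\<Sum>i\<in>idx n. scal (c i) * basis_tensor n i)"

definition psi :: "nat \<Rightarrow> (index \<Rightarrow> complex) \<Rightarrow> tensor set" where
  "psi n c = weyl_class n (comb n c)"

text \<open>\<open>psi n c\<close> only sees \<open>c\<close> on \<open>idx n\<close>. Prescribing
  the support makes coordinates unique and lets the same function be read at every later
  stage.\<close>

definition supp :: "index set \<Rightarrow> (index \<Rightarrow> complex) \<Rightarrow> bool" where
  "supp B c \<longleftrightarrow> (\<forall>i. i \<notin> B \<longrightarrow> c i = 0)"

lemma suppI: "(\<And>i. i \<notin> B \<Longrightarrow> c i = 0) \<Longrightarrow> supp B c"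
  unfolding supp_def by blast

lemma suppD: "supp B c \<Longrightarrow> i \<notin> B \<Longrightarrow> c i = 0"
  unfolding supp_def by blast

lemma supp_mono: "supp A c \<Longrightarrow> A \<subseteq> B \<Longrightarrow> supp B c"
  unfolding supp_def by blast

lemma supp_add: "supp B c \<Longrightarrow> supp B d \<Longrightarrow> supp B (\<lambda>i. c i + d i)"
  by (rule suppI) (simp add: suppD)

lemma supp_mult: "supp B c \<Longrightarrow> supp B (\<lambda>i. k i * c i)"
  by (rule suppI) (simp add: suppD)

lemma comb_tensor [simp]: "comb n c \<in> tensors" by (simp only: comb_def comb_tensors)

lemma psi_add: "psi n c \<oplus>\<^bsub>weyl n\<^esub> psi n d = psi n (\<lambda>i. c i + d i)"
  unfolding psi_def weyl_add comb_def by (simp only: scal_add distrib_right sum.distrib)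

lemma psi_smult: "k \<odot>\<^bsub>weyl n\<^esub> psi n c = psi n (\<lambda>i. k * c i)"
  unfolding psi_def weyl_smult[OF comb_tensor]
  unfolding comb_def sum_distrib_left scal_mult mult.assoc by (rule refl)

lemma psi_zero: "\<zero>\<^bsub>weyl n\<^esub> = psi n (\<lambda>_. 0)"
proof -
  have "\<zero>\<^bsub>weyl n\<^esub> = weyl_ideal n" by (simp add: weyl_def)
  also have "\<dots> = weyl_class n 0" by (rule Set.set_eqI) (simp only: mem_weyl_class diff_0_right)
  finally show ?thesis by (simp add: psi_def comb_def)
qed

lemma psi_carrier: "psi n c \<in> carrier (weyl n)"
  unfolding weyl_carrier psi_def using comb_tensor by blast

lemma psi_inj:
  assumes "supp (idx n) c" "supp (idx n) d" "psi n c = psi n d"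
  shows "c = d"
proof
  fix i
  have "comb n c - comb n d = (\<Sum>i\<in>idx n. scal (c i - d i) * basis_tensor n i)"
    unfolding comb_def sum_subtractf[symmetric] left_diff_distrib[symmetric]
    by (simp only: scal_add[of "c _" "- d _", unfolded scal_minus, simplified])
  then have "(\<Sum>i\<in>idx n. scal (c i - d i) * basis_tensor n i) \<in> weyl_ideal n"
    using assms(3) unfolding psi_def weyl_class_eq by (simp only:)
  from B.b_independent[OF this] show "c i = d i"
    using suppD[OF assms(1), of i] suppD[OF assms(2), of i] by (cases "i \<in> idx n") auto
qed

lemma comb_cong: "(\<And>i. i \<in> idx n \<Longrightarrow> c i = d i) \<Longrightarrow> comb n c = comb n d"
  unfolding comb_def by (intro sum.cong refl) simp

lemma psi_surj:
  assumes "X \<in> carrier (weyl n)"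
  obtains c where "supp (idx n) c" "X = psi n c"
proof -
  obtain p where p: "p \<in> tensors" "X = weyl_class n p" using assms unfolding weyl_carrier by blast
  obtain c where c: "p - (\<Sum>i\<in>idx n. scal (c i) * basis_tensor n i) \<in> weyl_ideal n" using basis_tensor_spanning[OF p(1)] by blast
  define c' where "c' i = (if i \<in> idx n then c i else 0)" for i
  have "comb n c' = comb n c" by (rule comb_cong) (simp add: c'_def)
  then have "X = psi n c'" using c unfolding p(2) psi_def weyl_class_eq by (simp only: comb_def)
  moreover have "supp (idx n) c'" by (simp add: supp_def c'_def)
  ultimately show ?thesis using that by blast
qed

lemma idx_mono: "n \<le> m \<Longrightarrow> idx n \<subseteq> idx m"
  by (auto simp: idx_def)

text \<open>Since basis vectors go to basis vectors with the same index, the embedding is the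
  identity on coordinates. Its injectivity and the shape of the limit follow from this.\<close>

lemma psi_emb:
  assumes "supp (idx n) c"
  shows "weyl_emb n (psi n c) = psi (Suc n) c"
proof -
  have "comb n c * gen (osp_gp, 2 * n + 1) = (\<Sum>i\<in>idx n. scal (c i) * basis_tensor (Suc n) i)"
    unfolding comb_def sum_distrib_right mult.assoc by (intro sum.cong refl) (simp only: basis_tensor_embed)
  also have "\<dots> = comb (Suc n) c"
    unfolding comb_def using idx_mono[of n "Suc n"] suppD[OF assms]
    by (intro sum.mono_neutral_left) (auto simp: finite_idx)
  finally show ?thesis unfolding psi_def weyl_emb_class[OF comb_tensor] by (simp only:)
qed

lemma psi_hh: "act (weyl n) (osp_h, 0) (psi n c) = psi n (\<lambda>i. of_int (idx_weight i) * c i)"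
proof -
  have "gen (osp_h, 0) * comb n c - comb n (\<lambda>i. of_int (idx_weight i) * c i)
      = (\<Sum>i\<in>idx n. scal (c i) * (gen (osp_h, 0) * basis_tensor n i - scal (of_int (idx_weight i)) * basis_tensor n i))"
    unfolding comb_def sum_distrib_left sum_subtractf[symmetric]
    by (rule sum.cong[OF refl], unfold right_diff_distrib mult.assoc[symmetric] scal_mult[symmetric])
      (simp only: scal_mult_commute mult.commute[of "of_int _"])
  also have "\<dots> \<in> weyl_ideal n"
  proof -
    have "sum f A \<in> weyl_ideal n" if "\<And>i. i \<in> A \<Longrightarrow> f i \<in> weyl_ideal n" for f :: "index \<Rightarrow> tensor" and A
      using that by (induction A rule: infinite_finite_induct) (auto intro: weyl_ideal_closed)
    note sum_closed = this
    show ?thesis by (rule sum_closed) (intro weyl_ideal_closed(4) hh_0_basis_tensor tensors_scal)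
  qed
  finally have "weyl_class n (gen (osp_h, 0) * comb n c) = weyl_class n (comb n (\<lambda>i. of_int (idx_weight i) * c i))"
    unfolding weyl_class_eq .
  then show ?thesis unfolding psi_def by (subst weyl_act) simp_all
qed

lemma psi_piece:
  "X \<in> piece (weyl n) s \<longleftrightarrow> (\<exists>c. supp {i \<in> idx n. tdeg n i = s} c \<and> X = psi n c)"
proof
  assume "X \<in> piece (weyl n) s"
  then obtain p where p: "X = weyl_class n p" "p \<in> tensors" "\<forall>w\<in>Poly_Mapping.keys p. t_degree w = s"
    by (auto simp: weyl_def)
  obtain c where c: "\<And>i. i \<in> idx n \<Longrightarrow> tdeg n i \<noteq> s \<Longrightarrow> c i = 0"
    "p - (\<Sum>i\<in>idx n. scal (c i) * basis_tensor n i) \<in> weyl_ideal n"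
    \<comment> \<open>A homogeneous representative must receive coordinates in its own degree only,
      which plain spanning would not provide.\<close>
    using B.b_homogeneous_spanning[OF p(2,3)] by blast
  define c' where "c' i = (if i \<in> idx n then c i else 0)" for i
  have "comb n c' = comb n c" by (rule comb_cong) (simp add: c'_def)
  then have "X = psi n c'" using c(2) unfolding p(1) psi_def weyl_class_eq by (simp only: comb_def)
  moreover have "supp {i \<in> idx n. tdeg n i = s} c'" using c(1) by (auto simp: supp_def c'_def)
  ultimately show "\<exists>c. supp {i \<in> idx n. tdeg n i = s} c \<and> X = psi n c" by blast
next
  assume "\<exists>c. supp {i \<in> idx n. tdeg n i = s} c \<and> X = psi n c"
  then obtain c where c: "supp {i \<in> idx n. tdeg n i = s} c" "X = psi n c" by blast
  have "hom_deg (scal (c i) * basis_tensor n i) s" if "i \<in> idx n" for i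
  proof (cases "tdeg n i = s")
    case True
    have "hom_deg (basis_tensor n i) (tdeg n i)" using that hom_deg_basis_tensor by (cases i) (auto simp: idx_def)
    then show ?thesis unfolding True by (rule hom_deg_scal_mult)
  next
    case False
    then have "c i = 0" by (intro suppD[OF c(1)]) simp
    then show ?thesis by (simp add: hom_deg_def)
  qed
  then have "hom_deg (comb n c) s" unfolding comb_def by (rule hom_deg_sum)
  then show "X \<in> piece (weyl n) s" unfolding c(2) psi_def by (auto simp: weyl_def hom_deg_def)
qed

lemma weight_supp:
  assumes "supp D c" "supp D (\<lambda>i. of_int (idx_weight i) * c i)"
    "(\<lambda>i. of_int (idx_weight i) * c i) = (\<lambda>i. of_int a * c i)"
  shows "supp {i \<in> D. idx_weight i = a} c"
proof (rule suppI)
  fix i assume "i \<notin> {i \<in> D. idx_weight i = a}"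
  then show "c i = 0" using suppD[OF assms(1), of i] fun_cong[OF assms(3), of i] by auto
qed

lemma weight_space_weyl:
  "weight_space (weyl n) a s = psi n ` {c. supp {i \<in> idx n. idx_weight i = a \<and> tdeg n i = s} c}"
proof (intro equalityI subsetI)
  fix X assume "X \<in> weight_space (weyl n) a s"
  then have X: "X \<in> piece (weyl n) s" "act (weyl n) (osp_h, 0) X = of_int a \<odot>\<^bsub>weyl n\<^esub> X"
    by (auto simp: weight_space_def)
  obtain c where c: "supp {i \<in> idx n. tdeg n i = s} c" "X = psi n c" using X(1) psi_piece by blast
  have c': "supp (idx n) c" by (rule supp_mono[OF c(1)]) auto
  have "(\<lambda>i. of_int (idx_weight i) * c i) = (\<lambda>i. of_int a * c i)"
    by (rule psi_inj) (use X(2) supp_mult[OF c'] in \<open>simp_all only: c(2) psi_hh psi_smult\<close>)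
  from weight_supp[OF c(1) supp_mult[OF c(1)] this]
  have "supp {i \<in> idx n. idx_weight i = a \<and> tdeg n i = s} c" by (rule supp_mono) auto
  then show "X \<in> psi n ` {c. supp {i \<in> idx n. idx_weight i = a \<and> tdeg n i = s} c}" using c(2) by blast
next
  fix X assume "X \<in> psi n ` {c. supp {i \<in> idx n. idx_weight i = a \<and> tdeg n i = s} c}"
  then obtain c where c: "X = psi n c" "supp {i \<in> idx n. idx_weight i = a \<and> tdeg n i = s} c" by blast
  have "supp {i \<in> idx n. tdeg n i = s} c" by (rule supp_mono[OF c(2)]) auto
  moreover have "(\<lambda>i. of_int (idx_weight i) * c i) = (\<lambda>i. of_int a * c i)"
    using suppD[OF c(2)] by fastforce
  ultimately show "X \<in> weight_space (weyl n) a s"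
    unfolding weight_space_def c(1) mem_Collect_eq psi_piece psi_hh psi_smult by auto
qed

lemma ch_weyl: "ch (weyl n) a (int (n\<^sup>2) - b) = card {i \<in> idx n. idx_weight i = a \<and> idx_degree i = b}"
proof -
  let ?B = "{i \<in> idx n. idx_weight i = a \<and> tdeg n i = int (n\<^sup>2) - b}"
  have sub: "supp (idx n) c" if "supp ?B c" for c by (rule supp_mono[OF that]) auto
  have "ch (weyl n) a (int (n\<^sup>2) - b) = card ?B"
    unfolding ch_def
  proof (rule dim_coord(2)[where \<phi> = "psi n"])
    show "finite ?B" using finite_idx by simp
    show "carrier (weyl n\<lparr>carrier := weight_space (weyl n) a (int (n\<^sup>2) - b)\<rparr>) = psi n ` {c. \<forall>i. i \<notin> ?B \<longrightarrow> c i = 0}"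
      by (simp add: weight_space_weyl supp_def)
    show "inj_on (psi n) {c. \<forall>i. i \<notin> ?B \<longrightarrow> c i = 0}"
      by (rule inj_onI, rule psi_inj[of n]) (use sub in \<open>auto simp: supp_def\<close>)
  qed (simp_all add: psi_add psi_smult psi_zero)
  also have "?B = {i \<in> idx n. idx_weight i = a \<and> idx_degree i = b}" by (auto simp: tdeg_def)
  finally show ?thesis .
qed

lemma weyl_embedding: "osp_embedding (weyl n) (weyl (Suc n)) (weyl_emb n)"
  unfolding osp_embedding_def LinearCombinations.module_hom_def
proof (intro conjI CollectI allI impI ballI Pi_I)
  show "inj_on (weyl_emb n) (carrier (weyl n))"
  proof (rule inj_onI)
    fix X Y assume XY: "X \<in> carrier (weyl n)" "Y \<in> carrier (weyl n)" "weyl_emb n X = weyl_emb n Y"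
    obtain c where c: "supp (idx n) c" "X = psi n c" by (rule psi_surj[OF XY(1)])
    obtain d where d: "supp (idx n) d" "Y = psi n d" by (rule psi_surj[OF XY(2)])
    have "psi (Suc n) c = psi (Suc n) d" using XY(3) psi_emb c d by simp
    then have "c = d" using c d idx_mono[of n "Suc n"] by (intro psi_inj[of "Suc n"]) (auto intro: supp_mono)
    then show "X = Y" using c d by simp
  qed
next
  fix X assume "X \<in> carrier (weyl n)"
  then show "weyl_emb n X \<in> carrier (weyl (Suc n))" by (elim psi_surj) (simp only: psi_emb psi_carrier)
next
  fix X Y assume "X \<in> carrier (weyl n) \<and> Y \<in> carrier (weyl n)"
  then show "weyl_emb n (X \<oplus>\<^bsub>weyl n\<^esub> Y) = weyl_emb n X \<oplus>\<^bsub>weyl (Suc n)\<^esub> weyl_emb n Y"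
    by (elim conjE psi_surj) (simp only: psi_add psi_emb supp_add)
next
  fix k :: complex and X assume "k \<in> carrier class_ring \<and> X \<in> carrier (weyl n)"
  then show "weyl_emb n (k \<odot>\<^bsub>weyl n\<^esub> X) = k \<odot>\<^bsub>weyl (Suc n)\<^esub> weyl_emb n X"
    by (elim conjE psi_surj) (simp only: psi_smult psi_emb supp_mult)
next
  fix l X assume l: "l \<in> twisted" and "X \<in> carrier (weyl n)"
  then obtain p where p: "p \<in> tensors" "X = weyl_class n p" unfolding weyl_carrier by blast
  let ?g = "gen (osp_gp, 2 * n + 1)"
  have g: "?g \<in> tensors" by simp
  show "weyl_emb n (act (weyl n) l X) = act (weyl (Suc n)) l (weyl_emb n X)"
    unfolding p(2) weyl_act[OF p(1) l] weyl_emb_class[OF p(1)]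
      weyl_emb_class[OF tensors_mult[OF tensors_gen[OF l] p(1)]] weyl_act[OF tensors_mult[OF p(1) g] l]
    by (simp only: mult.assoc)
qed

lemma weyl_emb_gen: "weyl_emb n (weyl_gen n) = act (weyl (Suc n)) (osp_gp, 2 * n + 1) (weyl_gen (Suc n))"
  unfolding weyl_gen_def weyl_emb_class[OF tensors_1] by (subst weyl_act) simp_all

subsection \<open>The inductive limit\<close>

lemma regraded_simps [simp]:
  "carrier (regraded_weyl n) = carrier (weyl n)" "add (regraded_weyl n) = add (weyl n)"
  "module.smult (regraded_weyl n) = module.smult (weyl n)" "zero (regraded_weyl n) = zero (weyl n)"
  "act (regraded_weyl n) = act (weyl n)" "piece (regraded_weyl n) b = piece (weyl n) (int (n\<^sup>2) - b)"
  by (simp_all add: regraded_weyl_def)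

lemma trans_psi: "n \<le> k \<Longrightarrow> supp (idx n) c \<Longrightarrow> trans_map weyl_emb n k (psi n c) = psi k c"
proof (induction k rule: dec_induct)
  case (step k)
  then have "supp (idx k) c" using idx_mono supp_mono by blast
  then show ?case using step by (simp add: trans_map_def psi_emb)
qed (simp add: trans_map_def)

text \<open>The whole equivalence class belonging to \<open>c\<close>: one representative at each
  stage that is large enough to contain the support.\<close>

definition limit_vector :: "(index \<Rightarrow> complex) \<Rightarrow> (nat \<times> tensor set) set" where
  "limit_vector c = {(m, psi m c) | m. supp (idx m) c}"

lemma mem_limit_vector: "(m, X) \<in> limit_vector c \<longleftrightarrow> supp (idx m) c \<and> X = psi m c"
  by (auto simp: limit_vector_def)

lemma lim_class_psi:
  assumes "supp (idx n) c"
  shows "lim_class regraded_weyl weyl_emb n (psi n c) = limit_vector c"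
proof -
  have "(m, X) \<in> lim_class regraded_weyl weyl_emb n (psi n c) \<longleftrightarrow> (m, X) \<in> limit_vector c" for m X
  proof
    assume "(m, X) \<in> lim_class regraded_weyl weyl_emb n (psi n c)"
    then obtain k where X: "X \<in> carrier (weyl m)" and k: "n \<le> k" "m \<le> k"
      "trans_map weyl_emb n k (psi n c) = trans_map weyl_emb m k X"
      by (auto simp: lim_class_def lim_rel_def)
    obtain d where d: "supp (idx m) d" "X = psi m d" by (rule psi_surj[OF X])
    have "psi k c = psi k d" using k(3) trans_psi[OF k(1) assms] trans_psi[OF k(2) d(1)] d(2) by simp
    then have "c = d"
      by (rule psi_inj[rotated 2]) (rule supp_mono[OF assms idx_mono[OF k(1)]], rule supp_mono[OF d(1) idx_mono[OF k(2)]])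
    then show "(m, X) \<in> limit_vector c" using d by (simp add: mem_limit_vector)
  next
    assume "(m, X) \<in> limit_vector c"
    then have m: "supp (idx m) c" "X = psi m c" by (auto simp: mem_limit_vector)
    have "trans_map weyl_emb n (max n m) (psi n c) = trans_map weyl_emb m (max n m) (psi m c)"
      using trans_psi[of n "max n m" c] trans_psi[of m "max n m" c] assms m by simp
    then have "\<exists>k\<ge>n. m \<le> k \<and> trans_map weyl_emb n k (psi n c) = trans_map weyl_emb m k (psi m c)"
      by (intro exI[of _ "max n m"]) simp
    then show "(m, X) \<in> lim_class regraded_weyl weyl_emb n (psi n c)"
      unfolding lim_class_def lim_rel_def m(2) Image_singleton_iff mem_Collect_eq prod.case regraded_simps
      by (intro conjI psi_carrier)
  qed
  then show ?thesis by (intro Set.set_eqI) (metis surj_pair)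
qed

lemma limit_vector_inj: "supp (idx n) c \<Longrightarrow> limit_vector c = limit_vector d \<Longrightarrow> c = d"
proof -
  assume c: "supp (idx n) c" "limit_vector c = limit_vector d"
  then have "(n, psi n c) \<in> limit_vector d" using mem_limit_vector by blast
  then show "c = d" using psi_inj[OF c(1)] by (auto simp: mem_limit_vector)
qed

lemma common_stage:
  assumes "supp (idx n) c" "supp (idx m) d"
  shows "supp (idx (max n m)) c" "supp (idx (max n m)) d"
  using supp_mono[OF assms(1) idx_mono[of n "max n m"]] supp_mono[OF assms(2) idx_mono[of m "max n m"]]
  by simp_all

lemma limit_vector_add:
  assumes "supp (idx n) c" "supp (idx m) d"
  shows "limit_vector c \<oplus>\<^bsub>L_sigma\<^esub> limit_vector d = limit_vector (\<lambda>i. c i + d i)"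
proof -
  let ?A = "{lim_class regraded_weyl weyl_emb n (v \<oplus>\<^bsub>weyl n\<^esub> u) | n v u. (n, v) \<in> limit_vector c \<and> (n, u) \<in> limit_vector d}"
  \<comment> \<open>All common stages give the same class, so the union in the definition of
    addition has a single member; the stage \<open>max n m\<close> shows that it is not
    empty.\<close>
  have "x = limit_vector (\<lambda>i. c i + d i)" if "x \<in> ?A" for x
    using that by (auto simp: mem_limit_vector psi_add lim_class_psi supp_add)
  moreover have "limit_vector (\<lambda>i. c i + d i) \<in> ?A"
    using common_stage[OF assms]
    by (intro CollectI exI[of _ "max n m"] exI[of _ "psi (max n m) c"] exI[of _ "psi (max n m) d"])
      (simp add: mem_limit_vector psi_add lim_class_psi supp_add)
  ultimately have "?A = {limit_vector (\<lambda>i. c i + d i)}" by blast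
  then show ?thesis by (simp add: L_sigma_def inductive_limit_def)
qed

lemma limit_vector_smult:
  assumes "supp (idx n) c"
  shows "k \<odot>\<^bsub>L_sigma\<^esub> limit_vector c = limit_vector (\<lambda>i. k * c i)"
proof -
  let ?A = "{lim_class regraded_weyl weyl_emb n (k \<odot>\<^bsub>weyl n\<^esub> v) | n v. (n, v) \<in> limit_vector c}"
  have "x = limit_vector (\<lambda>i. k * c i)" if "x \<in> ?A" for x
    using that by (auto simp: mem_limit_vector psi_smult lim_class_psi supp_mult)
  moreover have "limit_vector (\<lambda>i. k * c i) \<in> ?A"
    using assms by (intro CollectI exI[of _ n] exI[of _ "psi n c"]) (simp add: mem_limit_vector psi_smult lim_class_psi supp_mult)
  ultimately have "?A = {limit_vector (\<lambda>i. k * c i)}" by blast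
  then show ?thesis by (simp add: L_sigma_def inductive_limit_def)
qed

lemma limit_vector_hh:
  assumes "supp (idx n) c"
  shows "act L_sigma (osp_h, 0) (limit_vector c) = limit_vector (\<lambda>i. of_int (idx_weight i) * c i)"
proof -
  let ?A = "{lim_class regraded_weyl weyl_emb n (act (weyl n) (osp_h, 0) v) | n v. (n, v) \<in> limit_vector c}"
  have "x = limit_vector (\<lambda>i. of_int (idx_weight i) * c i)" if "x \<in> ?A" for x
    using that by (auto simp: mem_limit_vector psi_hh lim_class_psi supp_mult)
  moreover have "limit_vector (\<lambda>i. of_int (idx_weight i) * c i) \<in> ?A"
    using assms by (intro CollectI exI[of _ n] exI[of _ "psi n c"]) (simp add: mem_limit_vector psi_hh lim_class_psi supp_mult)
  ultimately have "?A = {limit_vector (\<lambda>i. of_int (idx_weight i) * c i)}" by blast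
  then show ?thesis by (simp add: L_sigma_def inductive_limit_def)
qed

lemma limit_vector_zero: "\<zero>\<^bsub>L_sigma\<^esub> = limit_vector (\<lambda>_. 0)"
  by (simp add: L_sigma_def inductive_limit_def psi_zero lim_class_psi supp_def)

lemma limit_vector_piece:
  "X \<in> piece L_sigma b \<longleftrightarrow> (\<exists>n c. supp {i \<in> idx n. idx_degree i = b} c \<and> X = limit_vector c)"
proof -
  have B: "{i \<in> idx n. tdeg n i = int (n\<^sup>2) - b} = {i \<in> idx n. idx_degree i = b}" for n
    by (auto simp: tdeg_def)
  have "X \<in> piece L_sigma b \<longleftrightarrow> (\<exists>n c. supp {i \<in> idx n. idx_degree i = b} c \<and> X = lim_class regraded_weyl weyl_emb n (psi n c))"
    unfolding L_sigma_def inductive_limit_def osp_module.simps regraded_simps psi_piece B by blast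
  also have "\<dots> \<longleftrightarrow> (\<exists>n c. supp {i \<in> idx n. idx_degree i = b} c \<and> X = limit_vector c)"
  proof -
    have "lim_class regraded_weyl weyl_emb n (psi n c) = limit_vector c" if "supp {i \<in> idx n. idx_degree i = b} c" for n c
      by (rule lim_class_psi, rule supp_mono[OF that]) auto
    then show ?thesis by (intro ex_cong1 conj_cong refl) (simp only:)
  qed
  finally show ?thesis .
qed

text \<open>Only finitely many indices share a weight and a degree, so one bound contains all their
  sets \<open>S\<close>. Each coefficient of the character is therefore eventually constant.\<close>

lemma idx_exhaust:
  "\<exists>n0. \<forall>n\<ge>n0. {i \<in> idx n. idx_weight i = a \<and> idx_degree i = b} = {i \<in> all_idx. idx_weight i = a \<and> idx_degree i = b}"
proof -
  let ?B = "{i \<in> all_idx. idx_weight i = a \<and> idx_degree i = b}"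
  have "finite (\<Union>i\<in>?B. fst i)" using idx_count(1) by (intro finite_UN_I) (auto simp: all_idx_def)
  then obtain n0 where n0: "(\<Union>i\<in>?B. fst i) \<subseteq> {..<n0}" using finite_nat_iff_bounded by blast
  have "{i \<in> idx n. idx_weight i = a \<and> idx_degree i = b} = ?B" if "n \<ge> n0" for n
    using n0 that by (force simp: idx_def)
  then show ?thesis by blast
qed

lemma ch_L_sigma: "ch L_sigma a b = card {i \<in> all_idx. idx_weight i = a \<and> idx_degree i = b}"
proof -
  let ?B = "{i \<in> all_idx. idx_weight i = a \<and> idx_degree i = b}"
  obtain n0 where n0: "\<forall>n\<ge>n0. {i \<in> idx n. idx_weight i = a \<and> idx_degree i = b} = ?B"
    using idx_exhaust by blast
  then have "?B \<subseteq> idx n0" by auto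
  then have sub: "supp (idx n0) c" if "supp ?B c" for c by (rule supp_mono[OF that])
  have ws: "weight_space L_sigma a b = limit_vector ` {c. supp ?B c}"
  proof (intro equalityI subsetI)
    fix X assume "X \<in> weight_space L_sigma a b"
    then have X: "X \<in> piece L_sigma b" "act L_sigma (osp_h, 0) X = of_int a \<odot>\<^bsub>L_sigma\<^esub> X"
      by (auto simp: weight_space_def)
    obtain n c where c: "supp {i \<in> idx n. idx_degree i = b} c" "X = limit_vector c" using X(1) limit_vector_piece by blast
    have c': "supp (idx n) c" by (rule supp_mono[OF c(1)]) auto
    have "(\<lambda>i. of_int (idx_weight i) * c i) = (\<lambda>i. of_int a * c i)"
      using X(2) unfolding c(2) limit_vector_hh[OF c'] limit_vector_smult[OF c'] by (rule limit_vector_inj[OF supp_mult[OF c']])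
    from weight_supp[OF c(1) supp_mult[OF c(1)] this]
    have "supp ?B c" by (rule supp_mono) (auto simp: idx_def)
    then show "X \<in> limit_vector ` {c. supp ?B c}" using c(2) by blast
  next
    fix X assume "X \<in> limit_vector ` {c. supp ?B c}"
    then obtain c where c: "X = limit_vector c" "supp ?B c" by blast
    have "?B \<subseteq> {i \<in> idx n0. idx_degree i = b}" using \<open>?B \<subseteq> idx n0\<close> by auto
    then have "X \<in> piece L_sigma b" unfolding limit_vector_piece using supp_mono[OF c(2)] c(1) by blast
    moreover have "(\<lambda>i. of_int (idx_weight i) * c i) = (\<lambda>i. of_int a * c i)"
      using suppD[OF c(2)] by fastforce
    ultimately show "X \<in> weight_space L_sigma a b"
      unfolding weight_space_def using limit_vector_hh[OF sub[OF c(2)]] limit_vector_smult[OF sub[OF c(2)]] c(1) by auto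
  qed
  show ?thesis unfolding ch_def
  proof (rule dim_coord(2)[where \<phi> = limit_vector])
    show "finite ?B" by (rule idx_count(1))
    show "carrier (L_sigma\<lparr>carrier := weight_space L_sigma a b\<rparr>) = limit_vector ` {c. \<forall>i. i \<notin> ?B \<longrightarrow> c i = 0}"
      by (simp add: ws supp_def)
    show "inj_on limit_vector {c. \<forall>i. i \<notin> ?B \<longrightarrow> c i = 0}"
      by (rule inj_onI, rule limit_vector_inj[of n0]) (use sub in \<open>auto simp: supp_def\<close>)
  next
    fix c d :: "index \<Rightarrow> complex"
    assume "\<forall>i. i \<notin> ?B \<longrightarrow> c i = 0" "\<forall>i. i \<notin> ?B \<longrightarrow> d i = 0"
    then have "supp (idx n0) c" "supp (idx n0) d" using sub unfolding supp_def by blast+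
    from limit_vector_add[OF this] show "limit_vector c \<oplus>\<^bsub>L_sigma\<lparr>carrier := weight_space L_sigma a b\<rparr>\<^esub> limit_vector d = limit_vector (\<lambda>i. c i + d i)"
      by simp
  next
    fix k and c :: "index \<Rightarrow> complex"
    assume "\<forall>i. i \<notin> ?B \<longrightarrow> c i = 0"
    then have "supp (idx n0) c" using sub unfolding supp_def by blast
    from limit_vector_smult[OF this] show "k \<odot>\<^bsub>L_sigma\<lparr>carrier := weight_space L_sigma a b\<rparr>\<^esub> limit_vector c = limit_vector (\<lambda>i. k * c i)"
      by simp
  qed (simp add: limit_vector_zero)
qed

theorem theorem1p20:
  shows "(\<forall>n. osp_embedding (weyl n) (weyl (Suc n)) (weyl_emb n) \<and>
              weyl_emb n (weyl_gen n) = act (weyl (Suc n)) (osp_gp, 2 * n + 1) (weyl_gen (Suc n))) \<and>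
         (\<forall>a b :: int.
            (\<lambda>n. int (ch (weyl n) a (int (n\<^sup>2) - b))) \<longlonglongrightarrow> int (ch L_sigma a b) \<and>
            int (ch L_sigma a b) = product_coeff a b)"
proof (intro conjI allI)
  fix n
  show "osp_embedding (weyl n) (weyl (Suc n)) (weyl_emb n)" by (rule weyl_embedding)
  show "weyl_emb n (weyl_gen n) = act (weyl (Suc n)) (osp_gp, 2 * n + 1) (weyl_gen (Suc n))" by (rule weyl_emb_gen)
next
  fix a b :: int
  obtain n0 where "\<forall>n\<ge>n0. {i \<in> idx n. idx_weight i = a \<and> idx_degree i = b} = {i \<in> all_idx. idx_weight i = a \<and> idx_degree i = b}"
    using idx_exhaust by blast
  then have "\<forall>\<^sub>F n in sequentially. int (ch (weyl n) a (int (n\<^sup>2) - b)) = int (ch L_sigma a b)"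
    unfolding ch_weyl ch_L_sigma eventually_sequentially by (intro exI[of _ n0] allI impI) (simp only:)
  then show "(\<lambda>n. int (ch (weyl n) a (int (n\<^sup>2) - b))) \<longlonglongrightarrow> int (ch L_sigma a b)"
    by (rule tendsto_eventually)
  show "int (ch L_sigma a b) = product_coeff a b"
    unfolding ch_L_sigma by (rule idx_count(2))
qed

end
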